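(* Let $G$ be a compact connected Hausdorff abelian topological group and let $k\in\mathbb N$. All finite-sheeted covering mappings $p:X\to G$ of degree $k$ (with $X$ an arbitrary Hausdorff topological space, not necessarily connected) are trivial if and only if the character group $\widehat G$ is $k!$-divisible.
   Context: $\mathbb N=\{1,2,\dots\}$. A continuous surjection $p:X\to Y$ between topological spaces is a $k$-fold covering mapping (a finite-sheeted covering mapping of degree $k$) if every $y\in Y$ has an open neighborhood $W$ such that $p^{-1}(W)$ is a disjoint union of $k$ open sets $V_1,\dots,V_k$ of $X$, each mapped homeomorphically onto $W$ by $p$. A $k$-fold covering mapping $p:X\to Y$ is trivial if there is a homeomorphism $\rho:Y\times\{1,\dots,k\}\to X$, where $\{1,\dots,k\}$ is discrete, such that $p(\rho(y,n))=y$ for all $(y,n)$. $\widehat G$ denotes the (Pontryagin) character group of $G$, written additively. For $m\in\mathbb N$, $\widehat G$ is $m$-divisible if the homomorphism $\widehat G\to\widehat G$, $\chi\mapsto m\chi$, is surjective. *)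

theory Defs
  imports "HOL-Analysis.Analysis" "HOL-Algebra.Group"
begin

definition sheeted_covering_map ::
  "nat \<Rightarrow> 'x topology \<Rightarrow> 'y topology \<Rightarrow> ('x \<Rightarrow> 'y) \<Rightarrow> bool" where
  "sheeted_covering_map k X Y p \<longleftrightarrow>
     continuous_map X Y p \<and> p ` topspace X = topspace Y \<and>
     (\<forall>y \<in> topspace Y. \<exists>W. openin Y W \<and> y \<in> W \<and>
        (\<exists>V :: nat \<Rightarrow> 'x set.
           disjoint_family_on V {1..k} \<and>
           {x \<in> topspace X. p x \<in> W} = (\<Union>i\<in>{1..k}. V i) \<and>
           (\<forall>i\<in>{1..k}. openin X (V i) \<and>
              homeomorphic_map (subtopology X (V i)) (subtopology Y W) p)))"

text \<open>HOL cannot quantify over types inside a formula. A k-fold covering space of a space of type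
  \<^typ>\<open>'y\<close> is in bijection with the product of its base with k points, so
  \<^typ>\<open>'y \<times> nat\<close> is large enough to carry every such space up to homeomorphism. A statement about
  all total spaces is therefore made for topologies on that type; an implication from the base
  to its coverings can moreover be stated for a free type of total spaces.\<close>

definition trivial_covering_map ::
  "nat \<Rightarrow> 'x topology \<Rightarrow> 'y topology \<Rightarrow> ('x \<Rightarrow> 'y) \<Rightarrow> bool" where
  "trivial_covering_map k X Y p \<longleftrightarrow>
     (\<exists>\<rho>. homeomorphic_map (prod_topology Y (discrete_topology {1..k})) X \<rho> \<and>
        (\<forall>y \<in> topspace Y. \<forall>n \<in> {1..k}. p (\<rho> (y, n)) = y))"

text \<open>The circle group is the unit circle in the complex plane, so the group operation on
  characters is pointwise multiplication, and the multiple of a character by a natural number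
  in additive notation is a power here.\<close>

definition character_group :: "('g::topological_ab_group_add \<Rightarrow> complex) monoid" where
  "character_group =
     \<lparr>carrier = {\<phi>. continuous_on UNIV \<phi> \<and> (\<forall>x. cmod (\<phi> x) = 1) \<and>
                     (\<forall>x y. \<phi> (x + y) = \<phi> x * \<phi> y)},
      monoid.mult = (\<lambda>\<phi> \<psi> x. \<phi> x * \<psi> x),
      one = (\<lambda>x. 1)\<rparr>"

lemma comm_group_character_group:
  "comm_group (character_group :: ('g::topological_ab_group_add \<Rightarrow> complex) monoid)"
proof (rule comm_groupI)
  fix \<phi> :: "'g \<Rightarrow> complex"
  assume \<phi>: "\<phi> \<in> carrier character_group"
  have nz: "\<phi> x \<noteq> 0" for x
  proof -
    have "cmod (\<phi> x) = 1"
      using \<phi> by (simp add: character_group_def)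
    then show ?thesis
      by auto
  qed
  have "continuous_on UNIV (\<lambda>x. inverse (\<phi> x))"
    using \<phi> nz by (intro continuous_on_inverse) (auto simp: character_group_def)
  then have "(\<lambda>x. inverse (\<phi> x)) \<in> carrier character_group"
    using \<phi> by (simp add: character_group_def norm_inverse)
  moreover have "(\<lambda>x. inverse (\<phi> x)) \<otimes>\<^bsub>character_group\<^esub> \<phi> = \<one>\<^bsub>character_group\<^esub>"
    using nz by (simp add: character_group_def)
  ultimately show "\<exists>\<psi>\<in>carrier character_group. \<psi> \<otimes>\<^bsub>character_group\<^esub> \<phi> = \<one>\<^bsub>character_group\<^esub>"
    by blast
qed (auto simp: character_group_def norm_mult intro!: continuous_on_mult)

definition divisible_by :: "nat \<Rightarrow> ('a, 'b) monoid_scheme \<Rightarrow> bool" where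
  "divisible_by m H \<longleftrightarrow> (\<lambda>x. x [^]\<^bsub>H\<^esub> m) ` carrier H = carrier H"

end

theory Submission
  imports Defs
begin

text \<open>If every \<open>k\<close>-fold covering is trivial, then for \<open>j \<le> k\<close> the covering by the \<open>j\<close>-th roots of a
  character \<open>\<theta>\<close>, padded with trivial sheets, has a continuous section. After normalisation at \<open>0\<close> this
  section is a character, because its deviation from multiplicativity is a continuous function on a
  connected space with values in the \<open>j\<close>-th roots of unity.

  Conversely, let \<open>p\<close> be a covering. A clopen set with minimal fibre is a connected covering of degree
  \<open>j \<le> k\<close>, and it suffices to show \<open>j = 1\<close>. Small translations of the base lift uniquely to small
  displacements of the covering space, and these lifts commute. They give a transitive action of
  the monoid of multisets of small translations, so no group structure on the covering space
  is needed. If \<open>j \<ge> 2\<close>, there is a nonzero continuous function \<open>f\<close> whose sum over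
  every fibre vanishes. By a Peter-Weyl argument for the convolution operator of \<open>f\<close> there is a
  continuous unimodular eigenfunction \<open>\<psi>\<close> of the action whose fibre sums vanish as well.
  Then \<open>\<psi> ^ j\<close> is constant on fibres and induces a character of the base. A \<open>j\<close>-th root \<open>\<phi>\<close> of it
  differs from \<open>\<psi>\<close> by a continuous function with values in the roots of unity, hence by a constant, so
  \<open>\<psi>\<close> is constant on fibres, and its fibre sums cannot vanish.\<close>

section \<open>Invariant means on commutative monoids\<close>

text \<open>The classical route makes a connected finite covering a compact group and then uses Haar
  measure and the spectral theorem. The base need not be locally connected, so neither path lifting
  nor open components are at hand, and the covering space offers no obvious measure. Its place is
  taken by an invariant mean on the acting monoid, which exists because commutative monoids are
  amenable. A mean brings no complete Hilbert space and no compact operator, so no eigenvector is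
  produced directly: finite Fourier averages give approximate eigenvectors for finitely many
  translations, and Tychonoff gives a character in the limit. What has to survive this limit is a
  single estimate: a uniform bound on a linear combination of translates of \<open>f\<close> bounds,
  up to a constant factor, the same combination of values of the character. It makes \<psi> well
  defined and continuous on the covering space, and with all coefficients equal to 1 it makes the
  fibre sums vanish. The factorial arises because the degree of a connected piece can be any number
  up to k, and divisibility by all of these amounts to divisibility by k!.\<close>

lemma bounded_family_cluster_point:
  fixes M :: "'i \<Rightarrow> 'a \<Rightarrow> 'b::{heine_borel, real_normed_vector}"
  assumes "F \<noteq> bot" and bd: "\<And>i a. norm (M i a) \<le> B a"
  shows "\<exists>m. \<forall>Z. closed Z \<longrightarrow> eventually (\<lambda>i. M i \<in> Z) F \<longrightarrow> m \<in> Z"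
proof -
  \<comment> \<open>Tychonoff: a product of closed balls contains the whole family, so the filter
    has a cluster point for pointwise convergence. Closed conditions that hold eventually, such as
    identities or non-strict inequalities between finitely many coordinates, pass to it. Both the
    mean and the character are limits of this kind.\<close>
  let ?K = "PiE UNIV (\<lambda>a. cball (0::'b) (B a))"
  have "compactin (product_topology (\<lambda>_. euclidean) UNIV) ?K"
    by (simp add: compactin_PiE)
  then have "compact ?K"
    by (simp add: euclidean_product_topology)
  moreover have "filtermap M F \<noteq> bot"
    using assms(1) by (simp add: filtermap_bot_iff)
  moreover have "eventually (\<lambda>m. m \<in> ?K) (filtermap M F)"
    using bd by (auto simp: eventually_filtermap PiE_iff)
  ultimately obtain m where m: "inf (nhds m) (filtermap M F) \<noteq> bot"
    unfolding compact_filter by blast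
  show ?thesis
  proof (intro exI[of _ m] allI impI)
    fix Z assume Z: "closed Z" "eventually (\<lambda>i. M i \<in> Z) F"
    show "m \<in> Z"
    proof (rule ccontr)
      assume "m \<notin> Z"
      then have "eventually (\<lambda>x. x \<in> - Z) (nhds m)"
        using Z(1) by (intro eventually_nhds_in_open) auto
      moreover have "eventually (\<lambda>x. x \<in> Z) (filtermap M F)"
        using Z(2) by (simp add: eventually_filtermap)
      ultimately have "eventually (\<lambda>x. False) (inf (nhds m) (filtermap M F))"
        by (auto simp: eventually_inf)
      then show False
        using m by (simp add: trivial_limit_def)
    qed
  qed
qed

section \<open>Bounded functions\<close>

definition bdd_fun :: "('s \<Rightarrow> 'b::real_normed_vector) \<Rightarrow> bool" where
  "bdd_fun f \<longleftrightarrow> (\<exists>B. \<forall>s. norm (f s) \<le> B)"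

named_theorems bdd_intros

lemma bdd_funI: "(\<And>s. norm (f s) \<le> B) \<Longrightarrow> bdd_fun f"
  by (auto simp: bdd_fun_def)

lemma bdd_funE:
  assumes "bdd_fun f"
  obtains B where "B \<ge> 0" "\<And>s. norm (f s) \<le> B"
proof -
  obtain B where B: "\<And>s. norm (f s) \<le> B"
    using assms by (auto simp: bdd_fun_def)
  show thesis
    using B[of undefined] by (intro that[OF _ B]) (meson norm_ge_zero order_trans)
qed

lemma bdd_fun_const [bdd_intros]: "bdd_fun (\<lambda>_. c)"
  by (rule bdd_funI[where B = "norm c"]) simp

lemma bdd_fun_add [bdd_intros]:
  assumes "bdd_fun f" "bdd_fun g" shows "bdd_fun (\<lambda>s. f s + g s)"
proof -
  obtain A B where "\<And>s. norm (f s) \<le> A" "\<And>s. norm (g s) \<le> B"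
    using assms by (auto simp: bdd_fun_def)
  then show ?thesis
    by (intro bdd_funI[where B = "A + B"]) (meson add_mono norm_triangle_le)
qed

lemma bdd_fun_mult [bdd_intros]:
  fixes f g :: "'s \<Rightarrow> 'b::real_normed_algebra"
  assumes "bdd_fun f" "bdd_fun g" shows "bdd_fun (\<lambda>s. f s * g s)"
proof -
  obtain A B where "\<And>s. norm (f s) \<le> A" "\<And>s. norm (g s) \<le> B" "A \<ge> 0"
    using assms by (metis bdd_funE)
  then show ?thesis
    by (intro bdd_funI[where B = "A * B"]) (meson norm_mult_ineq mult_mono norm_ge_zero order_trans)
qed

lemma bdd_fun_minus [bdd_intros]: "bdd_fun f \<Longrightarrow> bdd_fun (\<lambda>s. - f s)"
  by (simp add: bdd_fun_def)

lemma bdd_fun_diff [bdd_intros]: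
  "bdd_fun f \<Longrightarrow> bdd_fun g \<Longrightarrow> bdd_fun (\<lambda>s. f s - g s)"
  using bdd_fun_add[of f "\<lambda>s. - g s"] bdd_fun_minus[of g] by simp

lemma bdd_fun_sum [bdd_intros]:
  "(\<And>i. i \<in> I \<Longrightarrow> bdd_fun (f i)) \<Longrightarrow> bdd_fun (\<lambda>s. \<Sum>i\<in>I. f i s)"
  by (induction I rule: infinite_finite_induct) (auto intro: bdd_intros)

lemma bdd_fun_comp: "bdd_fun f \<Longrightarrow> bdd_fun (\<lambda>s. f (h s))"
  by (auto simp: bdd_fun_def)

lemma bdd_fun_norm [bdd_intros]: "bdd_fun f \<Longrightarrow> bdd_fun (\<lambda>s. norm (f s))"
  by (simp add: bdd_fun_def)

lemma bdd_fun_power [bdd_intros]: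
  fixes f :: "'s \<Rightarrow> 'b::real_normed_algebra_1"
  shows "bdd_fun f \<Longrightarrow> bdd_fun (\<lambda>s. f s ^ n)"
  by (induction n) (auto intro: bdd_intros)

lemma bdd_fun_Re [bdd_intros]: "bdd_fun f \<Longrightarrow> bdd_fun (\<lambda>s. Re (f s))"
  unfolding bdd_fun_def by (metis abs_Re_le_cmod order_trans real_norm_def)

lemma bdd_fun_Im [bdd_intros]: "bdd_fun f \<Longrightarrow> bdd_fun (\<lambda>s. Im (f s))"
  unfolding bdd_fun_def by (metis abs_Im_le_cmod order_trans real_norm_def)

lemma bdd_fun_cnj [bdd_intros]: "bdd_fun f \<Longrightarrow> bdd_fun (\<lambda>s. cnj (f s))"
  by (simp add: bdd_fun_def)

section \<open>Invariant means from Folner averages\<close>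

primrec nmul :: "nat \<Rightarrow> 's::comm_monoid_add \<Rightarrow> 's" where
  "nmul 0 a = 0"
| "nmul (Suc n) a = a + nmul n a"

text \<open>A finitely additive, translation invariant probability on the monoid. On all real
  functions there is none in general, as shifting the identity of the naturals by 1 adds 1; hence
  the restriction to bounded functions.\<close>

locale invariant_mean =
  fixes \<mu> :: "('s::comm_monoid_add \<Rightarrow> real) \<Rightarrow> real"
  assumes add: "bdd_fun f \<Longrightarrow> bdd_fun g \<Longrightarrow> \<mu> (\<lambda>s. f s + g s) = \<mu> f + \<mu> g"
    and scale: "bdd_fun f \<Longrightarrow> \<mu> (\<lambda>s. c * f s) = c * \<mu> f"
    and nonneg: "bdd_fun f \<Longrightarrow> (\<And>s. f s \<ge> 0) \<Longrightarrow> \<mu> f \<ge> 0"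
    and one: "\<mu> (\<lambda>_. 1) = 1"
    and shift: "bdd_fun f \<Longrightarrow> \<mu> (\<lambda>s. f (s + a)) = \<mu> f"

text \<open>The average of \<open>f\<close> over the combinations of the listed directions with
  coefficients below \<open>n\<close>, counted with multiplicity. For growing \<open>n\<close> these
  boxes are Folner sets for the listed directions.\<close>

primrec box_average :: "nat \<Rightarrow> 's::comm_monoid_add list \<Rightarrow> ('s \<Rightarrow> real) \<Rightarrow> real" where
  "box_average n [] f = f 0"
| "box_average n (a # as) f = box_average n as (\<lambda>s. (\<Sum>i<n. f (s + nmul i a)) / real n)"

lemma box_average_add:
  "box_average n as (\<lambda>s. f s + g s) = box_average n as f + box_average n as g"
  by (induction as arbitrary: f g) (simp_all add: sum.distrib add_divide_distrib)

lemma box_average_scale: "box_average n as (\<lambda>s. c * f s) = c * box_average n as f"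
  by (induction as arbitrary: f) (simp_all flip: sum_distrib_left times_divide_eq_right)

lemma box_average_diff:
  "box_average n as (\<lambda>s. f s - g s) = box_average n as f - box_average n as g"
  using box_average_add[of n as f "\<lambda>s. (-1) * g s"] box_average_scale[of n as "-1" g] by simp

lemma box_average_nonneg: "(\<And>s. f s \<ge> 0) \<Longrightarrow> box_average n as f \<ge> 0"
  by (induction as arbitrary: f) (simp_all add: sum_nonneg)

lemma box_average_const: "n > 0 \<Longrightarrow> box_average n as (\<lambda>_. c) = c"
  by (induction as) simp_all

lemma box_average_bound:
  assumes "n > 0" "\<And>s. \<bar>f s\<bar> \<le> B"
  shows "\<bar>box_average n as f\<bar> \<le> B"
proof -
  have "B - f s \<ge> 0" "f s - (- B) \<ge> 0" for s
    using assms(2)[of s] by linarith+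
  then have "box_average n as (\<lambda>s. B - f s) \<ge> 0" "box_average n as (\<lambda>s. f s - (- B)) \<ge> 0"
    by (auto intro: box_average_nonneg)
  then show ?thesis
    unfolding box_average_diff box_average_const[OF assms(1)] by linarith
qed

text \<open>In the shifted direction the average telescopes to two end values divided by
  \<open>n\<close>, and averaging in the remaining directions does not enlarge this. A shift in a
  later direction commutes with the first average, which keeps the bound \<open>B\<close>, so
  induction applies.\<close>

lemma box_average_shift:
  assumes "n > 0" "\<And>s. \<bar>f s\<bar> \<le> B" "a \<in> set as"
  shows "\<bar>box_average n as (\<lambda>s. f (s + a)) - box_average n as f\<bar> \<le> 2 * B / n"
  using assms(2,3)
proof (induction as arbitrary: f)
  case (Cons b as)
  have avg: "\<bar>(\<Sum>i<n. f (s + nmul i c)) / real n\<bar> \<le> B" for s c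
  proof -
    have "\<bar>\<Sum>i<n. f (s + nmul i c)\<bar> \<le> (\<Sum>i<n. B)"
      using Cons.prems(1) by (intro order_trans[OF sum_abs] sum_mono)
    then show ?thesis
      using assms(1) by (simp add: field_simps)
  qed
  show ?case
  proof (cases "a = b")
    case True
    have "(\<Sum>i<n. f (s + nmul i b + b)) - (\<Sum>i<n. f (s + nmul i b)) = f (s + nmul n b) - f s" for s
      using sum_lessThan_telescope[of "\<lambda>i. f (s + nmul i b)" n]
      by (simp add: sum_subtractf ac_simps)
    then have *: "(\<Sum>i<n. f (s + nmul i b + b)) / n - (\<Sum>i<n. f (s + nmul i b)) / n
        = (f (s + nmul n b) - f s) / n" for s
      by (simp flip: diff_divide_distrib)
    have "\<bar>(f (s + nmul n b) - f s) / n\<bar> \<le> 2 * B / n" for s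
      using Cons.prems(1)[of s] Cons.prems(1)[of "s + nmul n b"] assms(1)
      by (simp add: abs_divide divide_right_mono)
    then have "\<bar>box_average n as (\<lambda>s. (f (s + nmul n b) - f s) / n)\<bar> \<le> 2 * B / n"
      by (rule box_average_bound[OF assms(1)])
    then show ?thesis
      unfolding True by (simp flip: box_average_diff add: *)
  next
    case False
    then show ?thesis
      using Cons.IH[of "\<lambda>s. (\<Sum>i<n. f (s + nmul i b)) / real n"] avg Cons.prems(2)
      by (simp add: ac_simps)
  qed
qed auto

text \<open>Linearity, positivity and normalisation hold exactly for every box average. Only shift
  invariance is approximate, with an error that tends to 0 along growing boxes whose directions
  include the shift.\<close>

lemma invariant_mean_exists:
  "\<exists>\<mu> :: ('s::comm_monoid_add \<Rightarrow> real) \<Rightarrow> real. invariant_mean \<mu>"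
proof -
  define F where "F = finite_subsets_at_top (UNIV :: 's set) \<times>\<^sub>F sequentially"
  \<comment> \<open>Any list enumerating \<open>A\<close> will do, repetitions included. The side
    \<open>Suc n\<close> keeps the boxes nonempty, and the value 0 on unbounded functions provides
    the bound in each coordinate that compactness requires.\<close>
  define M where "M = (\<lambda>(A::'s set, n) f.
    if bdd_fun f then box_average (Suc n) (SOME as. set as = A) f else 0)"
  define B where "B = (\<lambda>f :: 's \<Rightarrow> real. if bdd_fun f then SOME B. \<forall>s. \<bar>f s\<bar> \<le> B else 0)"
  have B: "\<bar>f s\<bar> \<le> B f" if "bdd_fun f" for f s
  proof -
    have "\<exists>B. \<forall>s. \<bar>f s\<bar> \<le> B" using that by (simp add: bdd_fun_def)
    from someI_ex[OF this] show ?thesis using that by (simp add: B_def)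
  qed
  have "F \<noteq> bot"
    by (simp add: F_def prod_filter_eq_bot)
  moreover have "norm (M i f) \<le> B f" for i f
  proof (cases "bdd_fun f")
    case True
    then show ?thesis
      using B[OF True] by (auto simp: M_def split: prod.split intro!: box_average_bound)
  qed (auto simp: M_def B_def split: prod.split)
  ultimately obtain \<mu> where \<mu>: "\<And>Z. closed Z \<Longrightarrow> eventually (\<lambda>i. M i \<in> Z) F \<Longrightarrow> \<mu> \<in> Z"
    using bounded_family_cluster_point[of F M B] by blast
  have cont: "continuous_on UNIV (\<lambda>m. m f :: real)" for f :: "'s \<Rightarrow> real"
    by simp
  have "invariant_mean \<mu>"
  proof
    fix f g :: "'s \<Rightarrow> real" and c
    assume f: "bdd_fun f"
    {
      assume g: "bdd_fun g"
      have "\<mu> \<in> {m. m (\<lambda>s. f s + g s) = m f + m g}"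
        by (intro \<mu> closed_Collect_eq continuous_intros cont)
          (auto simp: M_def f g bdd_intros box_average_add intro!: always_eventually)
      then show "\<mu> (\<lambda>s. f s + g s) = \<mu> f + \<mu> g" by simp
    }
    have "\<mu> \<in> {m. m (\<lambda>s. c * f s) = c * m f}"
      by (intro \<mu> closed_Collect_eq continuous_intros cont)
        (auto simp: M_def f bdd_intros box_average_scale intro!: always_eventually)
    then show "\<mu> (\<lambda>s. c * f s) = c * \<mu> f" by simp
    {
      assume "\<And>s. f s \<ge> 0"
      then have "\<mu> \<in> {m. 0 \<le> m f}"
        by (intro \<mu> closed_Collect_le continuous_intros cont)
          (auto simp: M_def f intro!: always_eventually box_average_nonneg)
      then show "\<mu> f \<ge> 0" by simp
    }
  next
    have "\<mu> \<in> {m. m (\<lambda>_. 1) = 1}"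
      by (intro \<mu> closed_Collect_eq continuous_intros cont)
        (auto simp: M_def bdd_intros box_average_const intro!: always_eventually)
    then show "\<mu> (\<lambda>_. 1) = 1" by simp
  next
    fix f :: "'s \<Rightarrow> real" and a
    assume f: "bdd_fun f"
    have "\<bar>\<mu> (\<lambda>s. f (s + a)) - \<mu> f\<bar> \<le> 0 + e" if "e > 0" for e
    proof -
      have "eventually (\<lambda>n. 2 * B f / real (Suc n) < e) sequentially"
      proof -
        have "(\<lambda>n. 2 * B f / real (Suc n)) \<longlonglongrightarrow> 0"
          by (rule LIMSEQ_Suc[OF lim_const_over_n])
        then show ?thesis using that by (rule order_tendstoD)
      qed
      moreover have "eventually (\<lambda>A. finite A \<and> {a} \<subseteq> A) (finite_subsets_at_top (UNIV::'s set))"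
        unfolding eventually_finite_subsets_at_top by (intro exI[of _ "{a}"]) auto
      ultimately have ev: "eventually (\<lambda>i. (finite (fst i) \<and> {a} \<subseteq> fst i) \<and> 2 * B f / real (Suc (snd i)) < e) F"
        unfolding F_def by (intro eventually_prodI)
      have "eventually (\<lambda>i. M i \<in> {m. \<bar>m (\<lambda>s. f (s + a)) - m f\<bar> \<le> e}) F"
        using ev
      proof eventually_elim
        case (elim i)
        obtain A n where i: "i = (A, n)" by force
        define as where "as = (SOME as. set as = A)"
        have "\<exists>as. set as = A" using elim i by (simp add: finite_list)
        then have "set as = A" unfolding as_def by (rule someI_ex)
        then have "\<bar>box_average (Suc n) as (\<lambda>s. f (s + a)) - box_average (Suc n) as f\<bar> \<le> 2 * B f / Suc n"
          using elim i B[OF f] by (intro box_average_shift) auto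
        then show ?case
          using elim f bdd_fun_comp[OF f, of "\<lambda>s. s + a"] by (simp add: i M_def as_def)
      qed
      then have "\<mu> \<in> {m. \<bar>m (\<lambda>s. f (s + a)) - m f\<bar> \<le> e}"
        by (intro \<mu> closed_Collect_le continuous_intros cont)
      then show ?thesis by simp
    qed
    then have "\<bar>\<mu> (\<lambda>s. f (s + a)) - \<mu> f\<bar> \<le> 0" by (rule field_le_epsilon)
    then show "\<mu> (\<lambda>s. f (s + a)) = \<mu> f" by simp
  qed
  then show ?thesis by blast
qed

context invariant_mean
begin

lemma diff: "bdd_fun f \<Longrightarrow> bdd_fun g \<Longrightarrow> \<mu> (\<lambda>s. f s - g s) = \<mu> f - \<mu> g"
  using add[of f "\<lambda>s. (-1) * g s"] scale[of g "-1"] bdd_fun_minus[of g] by simp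

lemma const: "\<mu> (\<lambda>_. c) = c"
  using scale[of "\<lambda>_. 1" c] one by (simp add: bdd_intros)

lemma mono:
  assumes "bdd_fun f" "bdd_fun g" "\<And>s. f s \<le> g s"
  shows "\<mu> f \<le> \<mu> g"
  using nonneg[of "\<lambda>s. g s - f s"] diff[of g f] assms by (simp add: bdd_intros)

lemma sum:
  assumes "finite I" "\<And>i. i \<in> I \<Longrightarrow> bdd_fun (f i)"
  shows "\<mu> (\<lambda>s. \<Sum>i\<in>I. f i s) = (\<Sum>i\<in>I. \<mu> (f i))"
  using assms by (induction I) (simp_all add: const add bdd_fun_sum)

text \<open>The variance of \<open>h\<close> is nonnegative.\<close>

lemma square_mean_le:
  assumes h: "bdd_fun h"
  shows "(\<mu> h)\<^sup>2 \<le> \<mu> (\<lambda>s. (h s)\<^sup>2)"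
proof -
  define t where "t = \<mu> h"
  have "0 \<le> \<mu> (\<lambda>s. (h s - t)\<^sup>2)"
    by (intro nonneg bdd_intros h) simp
  also have "(\<lambda>s. (h s - t)\<^sup>2) = (\<lambda>s. ((h s)\<^sup>2 - (2 * t) * h s) + t\<^sup>2)"
    by (auto simp: power2_eq_square algebra_simps)
  also have "\<mu> \<dots> = \<mu> (\<lambda>s. (h s)\<^sup>2) - 2 * t * t + t\<^sup>2"
    using h scale[OF h, of "2 * t"] by (simp add: add diff const bdd_intros t_def)
  finally show ?thesis
    by (simp add: t_def power2_eq_square)
qed

section \<open>Complex means and the L2 seminorm\<close>

definition cmean :: "('s \<Rightarrow> complex) \<Rightarrow> complex" where
  "cmean f = Complex (\<mu> (\<lambda>s. Re (f s))) (\<mu> (\<lambda>s. Im (f s)))"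

lemma cmean_add:
  "bdd_fun f \<Longrightarrow> bdd_fun g \<Longrightarrow> cmean (\<lambda>s. f s + g s) = cmean f + cmean g"
  by (simp add: cmean_def complex_eq_iff add bdd_intros)

lemma cmean_scale:
  assumes f: "bdd_fun f"
  shows "cmean (\<lambda>s. c * f s) = c * cmean f"
proof -
  have "\<mu> (\<lambda>s. a * Re (f s) - b * Im (f s)) = a * \<mu> (\<lambda>s. Re (f s)) - b * \<mu> (\<lambda>s. Im (f s))"
    "\<mu> (\<lambda>s. a * Im (f s) + b * Re (f s)) = a * \<mu> (\<lambda>s. Im (f s)) + b * \<mu> (\<lambda>s. Re (f s))" for a b
    using f by (simp_all add: diff add scale bdd_intros)
  then show ?thesis
    by (simp add: cmean_def complex_eq_iff)
qed

lemma cmean_diff: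
  "bdd_fun f \<Longrightarrow> bdd_fun g \<Longrightarrow> cmean (\<lambda>s. f s - g s) = cmean f - cmean g"
  by (simp add: cmean_def complex_eq_iff diff bdd_intros)

lemma cmean_shift: "bdd_fun f \<Longrightarrow> cmean (\<lambda>s. f (s + a)) = cmean f"
  using shift[of "\<lambda>s. Re (f s)" a] shift[of "\<lambda>s. Im (f s)" a] by (simp add: cmean_def bdd_intros)

lemma cmean_sum:
  assumes "finite I" "\<And>i. i \<in> I \<Longrightarrow> bdd_fun (f i)"
  shows "cmean (\<lambda>s. \<Sum>i\<in>I. f i s) = (\<Sum>i\<in>I. cmean (f i))"
  using assms
proof (induction I)
  case empty
  then show ?case by (simp add: cmean_def const complex_eq_iff)
qed (simp add: cmean_add bdd_fun_sum)

text \<open>A unimodular factor rotates the mean onto the nonnegative real axis, where it is a mean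
  of real parts.\<close>

lemma cmod_cmean_le:
  assumes f: "bdd_fun f"
  shows "cmod (cmean f) \<le> \<mu> (\<lambda>s. cmod (f s))"
proof -
  obtain c where c: "cmod c = 1" "c * cmean f = cmod (cmean f)"
  proof (cases "cmean f = 0")
    case False
    moreover have "cnj (cmean f) * cmean f = complex_of_real (cmod (cmean f)) * complex_of_real (cmod (cmean f))"
      using complex_norm_square[of "cmean f"] by (simp add: power2_eq_square mult.commute)
    ultimately show ?thesis
      by (intro that[of "cnj (cmean f) / cmod (cmean f)"]) (simp_all add: norm_divide)
  qed (auto intro: that[of 1])
  have "cmod (cmean f) = Re (cmean (\<lambda>s. c * f s))"
    using c f by (simp add: cmean_scale)
  also have "\<dots> = \<mu> (\<lambda>s. Re (c * f s))"
    by (simp add: cmean_def)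
  also have "\<dots> \<le> \<mu> (\<lambda>s. cmod (f s))"
    using complex_Re_le_cmod[of "c * f s" for s] c(1)
    by (intro mono bdd_intros f) (simp add: norm_mult)
  finally show ?thesis .
qed

lemma cmod_cmean_bound:
  assumes "\<And>s. cmod (f s) \<le> B"
  shows "cmod (cmean f) \<le> B"
proof -
  have f: "bdd_fun f" using assms by (rule bdd_funI)
  have "\<mu> (\<lambda>s. cmod (f s)) \<le> \<mu> (\<lambda>_. B)"
    by (intro mono bdd_intros f assms)
  then show ?thesis
    using cmod_cmean_le[OF f] by (simp add: const)
qed

text \<open>The square of an L2 seminorm. A mean can vanish on a nonzero nonnegative function, so
  strict positivity has to come from recurrence, as in \<open>sq_norm_pos\<close>.\<close>

definition sq_norm :: "('s \<Rightarrow> complex) \<Rightarrow> real" where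
  "sq_norm u = \<mu> (\<lambda>s. (cmod (u s))\<^sup>2)"

lemma sq_norm_nonneg: "bdd_fun u \<Longrightarrow> sq_norm u \<ge> 0"
  unfolding sq_norm_def by (intro nonneg bdd_intros) auto

lemma sq_norm_shift: "bdd_fun u \<Longrightarrow> sq_norm (\<lambda>s. u (s + a)) = sq_norm u"
  unfolding sq_norm_def using shift[of "\<lambda>s. (cmod (u s))\<^sup>2" a] by (simp add: bdd_intros)

lemma sq_norm_mono:
  "bdd_fun u \<Longrightarrow> bdd_fun v \<Longrightarrow> (\<And>s. cmod (u s) \<le> cmod (v s)) \<Longrightarrow> sq_norm u \<le> sq_norm v"
  unfolding sq_norm_def by (intro mono bdd_intros) auto

lemma sq_norm_le: "(\<And>s. cmod (u s) \<le> B) \<Longrightarrow> sq_norm u \<le> B\<^sup>2"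
  using mono[of "\<lambda>s. (cmod (u s))\<^sup>2" "\<lambda>_. B\<^sup>2"] bdd_funI[of u B]
  unfolding sq_norm_def by (simp add: const bdd_intros power_mono)

lemma sq_norm_scale: "bdd_fun u \<Longrightarrow> sq_norm (\<lambda>s. c * u s) = (cmod c)\<^sup>2 * sq_norm u"
  unfolding sq_norm_def by (simp add: norm_mult power_mult_distrib scale bdd_intros)

lemma sq_norm_diff_le:
  assumes "bdd_fun u" "bdd_fun v"
  shows "sq_norm (\<lambda>s. u s - v s) \<le> 2 * sq_norm u + 2 * sq_norm v"
proof -
  have "sq_norm (\<lambda>s. u s - v s) \<le> \<mu> (\<lambda>s. 2 * (cmod (u s))\<^sup>2 + 2 * (cmod (v s))\<^sup>2)"
    unfolding sq_norm_def
  proof (intro mono bdd_intros assms)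
    fix s
    have "(cmod (u s - v s))\<^sup>2 \<le> (cmod (u s) + cmod (v s))\<^sup>2"
      by (intro power_mono norm_triangle_ineq4) auto
    also have "\<dots> \<le> 2 * (cmod (u s))\<^sup>2 + 2 * (cmod (v s))\<^sup>2"
      using zero_le_power2[of "cmod (u s) - cmod (v s)"] by (simp add: power2_eq_square algebra_simps)
    finally show "(cmod (u s - v s))\<^sup>2 \<le> 2 * (cmod (u s))\<^sup>2 + 2 * (cmod (v s))\<^sup>2" .
  qed
  also have "\<dots> = 2 * sq_norm u + 2 * sq_norm v"
    unfolding sq_norm_def using assms by (simp add: add scale bdd_intros)
  finally show ?thesis .
qed

lemma cmod_cmean_sq_le: "bdd_fun f \<Longrightarrow> (cmod (cmean f))\<^sup>2 \<le> sq_norm f"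
  unfolding sq_norm_def
  using power_mono[OF cmod_cmean_le[of f], of 2] square_mean_le[of "\<lambda>s. cmod (f s)"] bdd_fun_norm[of f]
  by simp

text \<open>The set where the modulus of \<open>u\<close> is at least \<beta> is syndetic: finitely
  many of its translates cover the monoid. All translates have the same mean, so the set cannot be
  null.\<close>

lemma sq_norm_pos:
  assumes u: "bdd_fun u" and "finite A" "\<beta> > 0"
    and syn: "\<And>s. \<exists>a\<in>A. cmod (u (s + a)) \<ge> \<beta>"
  shows "sq_norm u > 0"
proof -
  have "\<beta>\<^sup>2 = \<mu> (\<lambda>_. \<beta>\<^sup>2)" by (simp add: const)
  also have "\<dots> \<le> \<mu> (\<lambda>s. \<Sum>a\<in>A. (cmod (u (s + a)))\<^sup>2)"
  proof (intro mono bdd_intros bdd_fun_comp[OF u])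
    fix s
    obtain a where a: "a \<in> A" "cmod (u (s + a)) \<ge> \<beta>" using syn by blast
    have "\<beta>\<^sup>2 \<le> (cmod (u (s + a)))\<^sup>2" using a assms(3) by (intro power_mono) auto
    also have "\<dots> \<le> (\<Sum>a\<in>A. (cmod (u (s + a)))\<^sup>2)"
      using a assms(2) by (intro member_le_sum) auto
    finally show "\<beta>\<^sup>2 \<le> (\<Sum>a\<in>A. (cmod (u (s + a)))\<^sup>2)" .
  qed
  also have "\<dots> = (\<Sum>a\<in>A. sq_norm (\<lambda>s. u (s + a)))"
    unfolding sq_norm_def using assms(2) by (intro sum bdd_intros bdd_fun_comp[OF u])
  also have "\<dots> = card A * sq_norm u"
    using sq_norm_shift[OF u] by simp
  finally have "\<beta>\<^sup>2 \<le> card A * sq_norm u" .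
  moreover have "\<beta>\<^sup>2 > 0" using assms(3) by simp
  ultimately show ?thesis
    by (metis not_less mult_nonneg_nonpos of_nat_0_le_iff order_less_le_trans)
qed

end

section \<open>Fourier analysis on the n-th roots of unity\<close>

lemma roots_unity_orthogonal:
  assumes "i < n" "j < n"
  shows "(\<Sum>c | c ^ n = 1. c ^ i * cnj (c ^ j)) = (if i = j then of_nat n else (0::complex))"
proof -
  let ?R = "{c::complex. c ^ n = 1}"
  have n: "n > 0" using assms by simp
  have unit: "c * cnj c = 1" if "c ^ n = 1" for c
  proof -
    have "cmod c ^ n = 1" using that by (metis norm_one norm_power)
    then have "cmod c = 1" using n power_eq_imp_eq_base[of "cmod c" n 1] by simp
    then show ?thesis using complex_norm_square[of c] by simp
  qed
  show ?thesis
  proof (cases "i = j")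
    case True
    have "c ^ i * cnj (c ^ i) = 1" if "c \<in> ?R" for c
      using unit[of c] that by (simp flip: power_mult_distrib)
    then show ?thesis
      using True card_roots_unity_eq[OF n] by simp
  next
    case False
    define \<omega> where "\<omega> = cis (2 * pi / n)"
    have pow: "\<omega> ^ k = cis (2 * pi * real k / real n)" for k
      by (simp add: \<omega>_def Complex.DeMoivre mult_ac)
    have \<omega>: "\<omega> ^ n = 1"
      using n by (simp add: pow)
    have \<omega>0: "\<omega> \<noteq> 0" by (simp add: \<omega>_def)
    have "\<omega> ^ i \<noteq> \<omega> ^ j"
      using bij_betw_imp_inj_on[OF Complex.bij_betw_roots_unity[OF n]] False assms
      unfolding pow by (auto simp: inj_on_def)
    moreover have "\<omega> ^ j * cnj (\<omega> ^ j) = 1"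
      using unit[OF \<omega>] by (simp flip: power_mult_distrib)
    moreover have "a = b" if "b * cnj b = 1" "a * cnj b = 1" for a b
    proof -
      have "a = a * cnj b * b" using that(1) by (simp add: mult_ac)
      then show ?thesis using that(2) by simp
    qed
    ultimately have ne: "\<omega> ^ i * cnj (\<omega> ^ j) \<noteq> 1" by blast
    \<comment> \<open>Multiplication by the generator permutes the roots and multiplies the sum by a
      factor other than 1, so the sum is 0.\<close>
    have "bij_betw (\<lambda>c. \<omega> * c) ?R ?R"
    proof (rule bij_betwI[where g = "\<lambda>c. c / \<omega>"])
    qed (use \<omega> \<omega>0 in \<open>auto simp: power_mult_distrib power_divide\<close>)
    then have "(\<Sum>c\<in>?R. c ^ i * cnj (c ^ j)) = (\<Sum>c\<in>?R. (\<omega> * c) ^ i * cnj ((\<omega> * c) ^ j))"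
      by (rule sum.reindex_bij_betw[symmetric])
    also have "\<dots> = (\<omega> ^ i * cnj (\<omega> ^ j)) * (\<Sum>c\<in>?R. c ^ i * cnj (c ^ j))"
      by (simp add: sum_distrib_left power_mult_distrib mult_ac)
    finally have "(\<Sum>c\<in>?R. c ^ i * cnj (c ^ j)) = 0"
      using ne unfolding mult_cancel_right1 by blast
    then show ?thesis using False by simp
  qed
qed

lemma parseval_roots_unity:
  fixes w :: "nat \<Rightarrow> complex"
  assumes n: "n > 0"
  shows "(\<Sum>c | c ^ n = 1. (cmod ((\<Sum>i<n. c ^ i * w i) / of_nat n))\<^sup>2) = (\<Sum>i<n. (cmod (w i))\<^sup>2) / n"
proof -
  let ?R = "{c::complex. c ^ n = 1}"
  have "complex_of_real (\<Sum>c\<in>?R. (cmod (\<Sum>i<n. c ^ i * w i))\<^sup>2)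
      = (\<Sum>c\<in>?R. (\<Sum>i<n. c ^ i * w i) * cnj (\<Sum>j<n. c ^ j * w j))"
    by (simp only: of_real_sum complex_norm_square)
  also have "\<dots> = (\<Sum>c\<in>?R. \<Sum>i<n. \<Sum>j<n. (w i * cnj (w j)) * (c ^ i * cnj (c ^ j)))"
    by (simp add: sum_product mult_ac)
  also have "\<dots> = (\<Sum>i<n. \<Sum>c\<in>?R. \<Sum>j<n. (w i * cnj (w j)) * (c ^ i * cnj (c ^ j)))"
    by (rule sum.swap)
  also have "\<dots> = (\<Sum>i<n. \<Sum>j<n. \<Sum>c\<in>?R. (w i * cnj (w j)) * (c ^ i * cnj (c ^ j)))"
    by (intro sum.cong refl sum.swap)
  also have "\<dots> = (\<Sum>i<n. \<Sum>j<n. if i = j then of_nat n * (w i * cnj (w j)) else 0)"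
    by (intro sum.cong refl) (simp only: roots_unity_orthogonal lessThan_iff flip: sum_distrib_left, simp)
  also have "\<dots> = complex_of_real (n * (\<Sum>i<n. (cmod (w i))\<^sup>2))"
    by (simp add: sum_distrib_left complex_norm_square[symmetric] del: of_real_power)
  finally have "(\<Sum>c\<in>?R. (cmod (\<Sum>i<n. c ^ i * w i))\<^sup>2) = n * (\<Sum>i<n. (cmod (w i))\<^sup>2)"
    by (simp only: of_real_eq_iff)
  then show ?thesis
    using n by (simp add: norm_divide power_divide power2_eq_square flip: sum_divide_distrib)
qed

context invariant_mean
begin

text \<open>Parseval at each point \<open>s\<close>, followed by the mean. This finite Fourier
  transform takes the place of a spectral decomposition of one translation.\<close>

lemma sum_sq_norm_roots_unity:
  fixes w :: "nat \<Rightarrow> 's \<Rightarrow> complex"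
  assumes n: "n > 0" and w: "\<And>i. i < n \<Longrightarrow> bdd_fun (w i)"
  shows "(\<Sum>c | c ^ n = 1. sq_norm (\<lambda>s. (\<Sum>i<n. c ^ i * w i s) / of_nat n)) = (\<Sum>i<n. sq_norm (w i)) / n"
proof -
  let ?R = "{c::complex. c ^ n = 1}"
  have fin: "finite ?R" using n by (intro finite_roots_unity) auto
  have "(\<Sum>c\<in>?R. sq_norm (\<lambda>s. (\<Sum>i<n. c ^ i * w i s) / of_nat n))
      = \<mu> (\<lambda>s. \<Sum>c\<in>?R. (cmod ((\<Sum>i<n. c ^ i * w i s) / of_nat n))\<^sup>2)"
    unfolding sq_norm_def divide_inverse
    by (intro sum[symmetric] fin bdd_intros) (use w in auto)
  also have "\<dots> = \<mu> (\<lambda>s. (1 / n) * (\<Sum>i<n. (cmod (w i s))\<^sup>2))"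
    by (simp add: parseval_roots_unity[OF n])
  also have "\<dots> = (1 / n) * (\<Sum>i<n. sq_norm (w i))"
    unfolding sq_norm_def using w by (subst scale) (auto intro!: bdd_intros sum)
  finally show ?thesis by simp
qed

end

section \<open>Characters from almost periodic functions\<close>

lemma (in invariant_mean) cmod_cmean_mult_le:
  assumes g: "\<And>t. cmod (g t) \<le> \<omega>" and u: "bdd_fun u"
  shows "cmod (cmean (\<lambda>t. g t * u t)) \<le> \<omega> * sqrt (sq_norm u)"
proof -
  have \<omega>: "\<omega> \<ge> 0" using g[of undefined] norm_ge_zero order_trans by blast
  have gb: "bdd_fun g" using g by (rule bdd_funI)
  have "(cmod (cmean (\<lambda>t. g t * u t)))\<^sup>2 \<le> sq_norm (\<lambda>t. g t * u t)"
    by (intro cmod_cmean_sq_le bdd_intros gb u)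
  also have "\<dots> \<le> sq_norm (\<lambda>t. of_real \<omega> * u t)"
    using g \<omega> by (intro sq_norm_mono bdd_intros gb u) (simp add: norm_mult mult_right_mono)
  also have "\<dots> = \<omega>\<^sup>2 * sq_norm u"
    by (simp add: sq_norm_scale u)
  also have "\<dots> = (\<omega> * sqrt (sq_norm u))\<^sup>2"
    by (simp add: power_mult_distrib sq_norm_nonneg u)
  finally show ?thesis
    by (rule power2_le_imp_le) (simp add: \<omega> sq_norm_nonneg u)
qed

section \<open>Approximate eigenvectors of a convolution operator\<close>

locale convolution = invariant_mean \<mu>
  for \<mu> :: "('s::comm_monoid_add \<Rightarrow> real) \<Rightarrow> real" +
  fixes f :: "'s \<Rightarrow> complex"
  assumes f_le: "\<And>s. cmod (f s) \<le> 1"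
begin

lemma f_bdd: "bdd_fun (\<lambda>t. f (h t))"
  using f_le by (intro bdd_funI[where B = 1])

text \<open>A monoid has no \<open>s - t\<close>; with the kernel \<open>f (s + t)\<close> the operator turns translations into their
  inverses, which suffices for the argument.\<close>

definition conv :: "('s \<Rightarrow> complex) \<Rightarrow> 's \<Rightarrow> complex" where
  "conv u s = cmean (\<lambda>t. f (s + t) * u t)"

lemma cmod_conv_le: "bdd_fun u \<Longrightarrow> cmod (conv u s) \<le> sqrt (sq_norm u)"
  unfolding conv_def using cmod_cmean_mult_le[of "\<lambda>t. f (s + t)" 1 u] f_le by simp

lemma bdd_conv: "bdd_fun u \<Longrightarrow> bdd_fun (conv u)"
  using cmod_conv_le by (intro bdd_funI)

lemma sq_norm_conv_le: "bdd_fun u \<Longrightarrow> sq_norm (conv u) \<le> sq_norm u"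
  using sq_norm_le[of "conv u" "sqrt (sq_norm u)"] cmod_conv_le sq_norm_nonneg by simp

text \<open>Shift invariance of the mean moves a translation from one factor to the other:
  translating \<open>u\<close> forwards amounts to translating \<open>conv u\<close>
  backwards.\<close>

lemma conv_eq_shift:
  assumes "bdd_fun u"
  shows "conv u s = cmean (\<lambda>t. f (s + a + t) * u (t + a))"
proof -
  have "conv u s = cmean (\<lambda>t. f (s + (t + a)) * u (t + a))"
    unfolding conv_def by (rule cmean_shift[symmetric]) (intro bdd_intros f_bdd assms)
  then show ?thesis by (simp add: ac_simps)
qed

text \<open>Since \<open>conv\<close> turns translations into their inverses and the mean ignores
  both, this quadratic form in \<open>u\<close> is translation invariant, as the averaging over
  roots of unity demands.\<close>

lemma sq_norm_conv_shift:
  assumes u: "bdd_fun u"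
  shows "sq_norm (conv (\<lambda>t. u (t + a))) = sq_norm (conv u)"
proof -
  have "sq_norm (conv (\<lambda>t. u (t + a))) = sq_norm (\<lambda>s. conv (\<lambda>t. u (t + a)) (s + a))"
    by (rule sq_norm_shift[symmetric, OF bdd_conv[OF bdd_fun_comp[OF u]]])
  also have "(\<lambda>s. conv (\<lambda>t. u (t + a)) (s + a)) = conv u"
    unfolding conv_def[of "\<lambda>t. u (t + a)"] by (rule ext) (rule conv_eq_shift[OF u, symmetric])
  finally show ?thesis .
qed

lemma conv_sum:
  assumes "\<And>i. i < n \<Longrightarrow> bdd_fun (w i)"
  shows "conv (\<lambda>s. (\<Sum>i<n. c i * w i s) / of_nat n) s = (\<Sum>i<n. c i * conv (w i) s) / of_nat n"
proof -
  have "conv (\<lambda>s. (\<Sum>i<n. c i * w i s) / of_nat n) s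
      = cmean (\<lambda>t. \<Sum>i<n. (c i / of_nat n) * (f (s + t) * w i t))"
    by (simp add: conv_def sum_distrib_left sum_divide_distrib mult_ac)
  also have "\<dots> = (\<Sum>i<n. cmean (\<lambda>t. (c i / of_nat n) * (f (s + t) * w i t)))"
    by (intro cmean_sum bdd_intros f_bdd) (use assms in auto)
  also have "\<dots> = (\<Sum>i<n. (c i / of_nat n) * conv (w i) s)"
    unfolding conv_def by (intro sum.cong refl cmean_scale bdd_intros f_bdd) (use assms in auto)
  finally show ?thesis
    by (simp add: sum_divide_distrib)
qed

text \<open>Averaging \<open>u\<close> along powers of one translation, twisted by an \<open>n\<close>-th root of unity \<open>z\<close>, gives
  an approximate eigenvector of that translation. Summed over all \<open>z\<close>, every quadratic form that
  is invariant under translations is preserved by Parseval, so some \<open>z\<close> does not lose against the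
  inequality below. The constant \<open>K\<close> is free, which makes the eigenvector errors small.\<close>

lemma approximate_joint_eigenvector:
  assumes "finite A" and u0: "bdd_fun u0" "sq_norm (conv u0) > \<delta> * sq_norm u0" and K: "K \<ge> 0"
  shows "\<exists>u c. bdd_fun u \<and> (\<forall>a\<in>A. cmod (c a) = 1) \<and>
    sq_norm (conv u) > \<delta> * sq_norm u + K * (\<Sum>a\<in>A. sq_norm (\<lambda>s. c a * u (s + a) - u s))"
  using assms(1)
proof (induction A)
  case empty
  then show ?case using u0 by auto
next
  case (insert a A)
  obtain u c where u: "bdd_fun u" and c: "\<And>b. b \<in> A \<Longrightarrow> cmod (c b) = 1"
    and gap: "sq_norm (conv u) > \<delta> * sq_norm u + K * (\<Sum>b\<in>A. sq_norm (\<lambda>s. c b * u (s + b) - u s))"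
    using insert.IH by blast
  define g where "g = sq_norm (conv u) - \<delta> * sq_norm u - K * (\<Sum>b\<in>A. sq_norm (\<lambda>s. c b * u (s + b) - u s))"
  have g: "g > 0" using gap by (simp add: g_def)
  \<comment> \<open>The new direction contributes an eigenvector error of at most
    \<open>4 * sq_norm u / n\<close> in total, weighted by \<open>K\<close>; \<open>n\<close> is so
    large that the gap \<open>g\<close> pays for it.\<close>
  obtain n :: nat where n: "n > 0" "K * (4 * sq_norm u) / n < g"
  proof -
    obtain n :: nat where n: "K * (4 * sq_norm u) / g < n" using reals_Archimedean2 by blast
    have "0 \<le> K * (4 * sq_norm u) / g"
      using K g sq_norm_nonneg[OF u] by simp
    then have "n > 0" using n by (metis of_nat_0_less_iff order_le_less_trans)
    then show thesis
      using n g by (intro that[of n]) (auto simp: field_simps)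
  qed
  let ?R = "{z::complex. z ^ n = 1}"
  define v where "v = (\<lambda>z s. (\<Sum>i<n. z ^ i * u (s + nmul i a)) / of_nat n)"
  define L where "L = (\<lambda>b u s. c b * u (s + b) - u s :: complex)"
  have us: "bdd_fun (\<lambda>s. u (s + x))" for x
    by (rule bdd_fun_comp[OF u])
  have vb: "bdd_fun (v z)" for z
    unfolding v_def divide_inverse by (intro bdd_intros us)
  have Lu: "bdd_fun (L b u)" if "b \<in> A" for b
    unfolding L_def by (intro bdd_intros us u)
  have sum1: "(\<Sum>z\<in>?R. sq_norm (v z)) = sq_norm u"
    unfolding v_def using n by (subst sum_sq_norm_roots_unity) (auto simp: us sq_norm_shift u)
  have sumT: "(\<Sum>z\<in>?R. sq_norm (conv (v z))) = sq_norm (conv u)"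
  proof -
    have "conv (v z) = (\<lambda>s. (\<Sum>i<n. z ^ i * conv (\<lambda>s. u (s + nmul i a)) s) / of_nat n)" for z
      unfolding v_def by (intro ext conv_sum us)
    then show ?thesis
      using n by (simp add: sum_sq_norm_roots_unity bdd_conv us sq_norm_conv_shift u)
  qed
  \<comment> \<open>The errors for the directions already treated are translation invariant forms as
    well, so their total over all roots is the old value.\<close>
  have sumL: "(\<Sum>z\<in>?R. sq_norm (L b (v z))) = sq_norm (L b u)" if b: "b \<in> A" for b
  proof -
    have "L b (v z) = (\<lambda>s. (\<Sum>i<n. z ^ i * L b u (s + nmul i a)) / of_nat n)" for z
      unfolding v_def L_def
      by (simp add: sum_distrib_left sum_subtractf ring_distribs diff_divide_distrib ac_simps)
    then show ?thesis
      using n by (simp add: sum_sq_norm_roots_unity bdd_fun_comp[OF Lu[OF b]] sq_norm_shift[OF Lu[OF b]])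
  qed
  define E where "E = (\<lambda>z. sq_norm (\<lambda>s. z * v z (s + a) - v z s))"
  have sumE: "(\<Sum>z\<in>?R. E z) \<le> 4 * sq_norm u / n"
  proof -
    have "E z \<le> 4 * sq_norm u / n\<^sup>2" if z: "z \<in> ?R" for z
    proof -
      \<comment> \<open>As \<open>z ^ n = 1\<close>, the twisted sum telescopes to its two ends.
        Each of the \<open>n\<close> roots contributes an error of order 1 / n^2, hence order 1 / n
        in total.\<close>
      have tel: "z * (\<Sum>i<n. z ^ i * u (s + a + nmul i a)) - (\<Sum>i<n. z ^ i * u (s + nmul i a))
          = z ^ n * u (s + nmul n a) - u s" for s
        using sum_lessThan_telescope[of "\<lambda>i. z ^ i * u (s + nmul i a)" n]
        by (simp add: sum_subtractf sum_distrib_left ac_simps)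
      have "z * v z (s + a) - v z s = (1 / of_nat n) * (u (s + nmul n a) - u s)" for s
      proof -
        have "z * v z (s + a) - v z s
            = (z * (\<Sum>i<n. z ^ i * u (s + a + nmul i a)) - (\<Sum>i<n. z ^ i * u (s + nmul i a))) / of_nat n"
          by (simp add: v_def diff_divide_distrib)
        then show ?thesis unfolding tel using z by simp
      qed
      then have "E z = sq_norm (\<lambda>s. (1 / of_nat n) * (u (s + nmul n a) - u s))"
        by (simp only: E_def)
      also have "\<dots> = (cmod (1 / of_nat n))\<^sup>2 * sq_norm (\<lambda>s. u (s + nmul n a) - u s)"
        by (intro sq_norm_scale bdd_intros us u)
      also have "\<dots> = sq_norm (\<lambda>s. u (s + nmul n a) - u s) / n\<^sup>2"
        by (simp add: norm_divide power_divide)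
      also have "\<dots> \<le> (2 * sq_norm (\<lambda>s. u (s + nmul n a)) + 2 * sq_norm u) / n\<^sup>2"
        by (intro divide_right_mono sq_norm_diff_le us u) simp
      finally show ?thesis by (simp add: sq_norm_shift u)
    qed
    then have "(\<Sum>z\<in>?R. E z) \<le> (\<Sum>z\<in>?R. 4 * sq_norm u / n\<^sup>2)" by (rule sum_mono)
    also have "\<dots> = 4 * sq_norm u / n"
      using n by (simp add: card_roots_unity_eq power2_eq_square)
    finally show ?thesis .
  qed
  \<comment> \<open>The slack of the claimed inequality at \<open>v z\<close>. Its total over the
    roots is positive, so it is positive at some root.\<close>
  define Q where "Q = (\<lambda>z. sq_norm (conv (v z)) - \<delta> * sq_norm (v z) - K * (\<Sum>b\<in>A. sq_norm (L b (v z))) - K * E z)"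
  have "(\<Sum>z\<in>?R. \<Sum>b\<in>A. sq_norm (L b (v z))) = (\<Sum>b\<in>A. sq_norm (L b u))"
    by (subst sum.swap) (simp add: sumL)
  then have "(\<Sum>z\<in>?R. Q z) = g - K * (\<Sum>z\<in>?R. E z)"
    unfolding Q_def by (simp add: sum_subtractf flip: sum_distrib_left) (simp add: sum1 sumT g_def L_def)
  moreover have "K * (\<Sum>z\<in>?R. E z) \<le> K * (4 * sq_norm u / n)"
    using sumE K by (rule mult_left_mono)
  ultimately have "(\<Sum>z\<in>?R. Q z) > 0" using n(2) by simp
  then obtain z where z: "z \<in> ?R" "Q z > 0"
    by (meson not_le sum_nonpos)
  have "cmod z = 1"
    using z(1) n(1) power_eq_imp_eq_base[of "cmod z" n 1] by (simp flip: norm_power)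
  moreover have "(\<Sum>b\<in>insert a A. sq_norm (\<lambda>s. (c(a := z)) b * v z (s + b) - v z s))
      = E z + (\<Sum>b\<in>A. sq_norm (L b (v z)))"
    using insert.hyps unfolding E_def L_def
    by (simp add: sum.insert) (intro sum.cong refl, auto)
  ultimately show ?case
    using z(2) c vb[of z] by (intro exI[of _ "v z"] exI[of _ "c(a := z)"]) (auto simp: Q_def algebra_simps)
qed

text \<open>Applying \<open>conv\<close> to an approximate eigenvector turns L2 estimates into
  uniform ones, because the L2 seminorm of \<open>u\<close> bounds \<open>conv u\<close> pointwise.
  The result is a mean of translates of \<open>f\<close>, so it inherits every uniform bound on
  their linear combinations.\<close>

lemma approximate_character:
  assumes "finite A" and u0: "bdd_fun u0" "sq_norm (conv u0) > \<delta> * sq_norm u0"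
    and \<delta>: "\<delta> > 0" and \<eta>: "\<eta> > 0"
  shows "\<exists>v c. (\<forall>a\<in>A. cmod (c a) = 1 \<and> (\<forall>s. cmod (c a * v s - v (s + a)) \<le> \<eta>)) \<and>
    (\<forall>s. cmod (v s) \<le> 1) \<and> (cmod (v 0))\<^sup>2 \<ge> \<delta> \<and>
    (\<forall>I \<alpha> \<omega>. (\<forall>t. cmod (\<Sum>s\<in>I. \<alpha> s * f (s + t)) \<le> \<omega>) \<longrightarrow> cmod (\<Sum>s\<in>I. \<alpha> s * v s) \<le> \<omega>)"
proof -
  \<comment> \<open>With \<open>K = 1 / \<eta>^2\<close>, the gap and
    \<open>sq_norm (conv u) \<le> sq_norm u\<close> together keep each eigenvector error within
    \<open>\<eta>^2 * sq_norm u\<close>.\<close>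
  obtain u c where u: "bdd_fun u" and c: "\<And>a. a \<in> A \<Longrightarrow> cmod (c a) = 1"
    and big: "sq_norm (conv u) > \<delta> * sq_norm u + (1 / \<eta>\<^sup>2) * (\<Sum>a\<in>A. sq_norm (\<lambda>s. c a * u (s + a) - u s))"
    using approximate_joint_eigenvector[OF assms(1) u0, of "1 / \<eta>\<^sup>2"] by auto
  define N where "N = sqrt (sq_norm u)"
  have us: "bdd_fun (\<lambda>s. u (s + x))" for x
    by (rule bdd_fun_comp[OF u])
  have term_nonneg: "sq_norm (\<lambda>s. c a * u (s + a) - u s) \<ge> 0" for a
    by (intro sq_norm_nonneg bdd_intros us u)
  have sum_nn: "(1 / \<eta>\<^sup>2) * (\<Sum>a\<in>A. sq_norm (\<lambda>s. c a * u (s + a) - u s)) \<ge> 0"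
    using term_nonneg by (simp add: sum_nonneg)
  have Npos: "N > 0"
    using big sum_nn sq_norm_conv_le[OF u] sq_norm_nonneg[OF u] \<delta> mult_nonneg_nonneg[of \<delta> "sq_norm u"]
    unfolding N_def by (smt (verit) real_sqrt_gt_zero)
  have NN: "N\<^sup>2 = sq_norm u" by (simp add: N_def sq_norm_nonneg u)
  \<comment> \<open>If \<open>conv u\<close> were small everywhere, so would be its mean square.
    Moving a large value to 0 keeps the later limit away from zero there.\<close>
  obtain s0 where s0: "(cmod (conv u s0))\<^sup>2 > \<delta> * N\<^sup>2"
  proof (rule ccontr)
    assume "\<not> thesis"
    then have le: "(cmod (conv u s))\<^sup>2 \<le> \<delta> * N\<^sup>2" for s using that not_le by blast
    have "sq_norm (conv u) \<le> \<mu> (\<lambda>_. \<delta> * N\<^sup>2)"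
      unfolding sq_norm_def by (intro mono bdd_intros bdd_conv u le)
    then show False using big sum_nn by (simp add: const NN)
  qed
  define v where "v s = conv u (s + s0) / of_real N" for s
  have "cmod (c a * v s - v (s + a)) \<le> \<eta>" if a: "a \<in> A" for a s
  proof -
    have "(1 / \<eta>\<^sup>2) * sq_norm (\<lambda>s. c a * u (s + a) - u s)
        \<le> (1 / \<eta>\<^sup>2) * (\<Sum>a\<in>A. sq_norm (\<lambda>s. c a * u (s + a) - u s))"
      using assms(1) a term_nonneg by (intro mult_left_mono member_le_sum) auto
    also have "\<dots> \<le> N\<^sup>2"
      using big sq_norm_conv_le[OF u] \<delta> sq_norm_nonneg[OF u] mult_nonneg_nonneg[of \<delta> "sq_norm u"]
      unfolding NN by linarith
    finally have "sq_norm (\<lambda>s. c a * u (s + a) - u s) \<le> (\<eta> * N)\<^sup>2"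
      using \<eta> by (simp add: field_simps power_mult_distrib)
    then have small: "sqrt (sq_norm (\<lambda>s. c a * u (s + a) - u s)) \<le> \<eta> * N"
      using \<eta> Npos by (simp add: real_le_lsqrt)
    \<comment> \<open>The shifted form of \<open>conv u x\<close> has the same kernel
      \<open>f (x + a + t)\<close> as \<open>conv u (x + a)\<close>, so the difference is a single
      mean against the eigenvector error.\<close>
    have "c a * conv u x - conv u (x + a) = cmean (\<lambda>t. f (x + a + t) * (c a * u (t + a) - u t))" for x
    proof -
      have "c a * conv u x = cmean (\<lambda>t. c a * (f (x + a + t) * u (t + a)))"
        by (subst conv_eq_shift[OF u, of _ a], subst cmean_scale) (auto intro!: bdd_intros f_bdd us)
      then have "c a * conv u x - conv u (x + a)
          = cmean (\<lambda>t. c a * (f (x + a + t) * u (t + a)) - f (x + a + t) * u t)"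
        unfolding conv_def[of u "x + a"] by (subst cmean_diff) (auto intro!: bdd_intros f_bdd us u)
      then show ?thesis by (simp add: algebra_simps)
    qed
    then have "cmod (c a * conv u x - conv u (x + a)) \<le> 1 * sqrt (sq_norm (\<lambda>s. c a * u (s + a) - u s))" for x
      by (simp only:) (intro cmod_cmean_mult_le f_le bdd_intros us u)
    from order_trans[OF this, of "\<eta> * N" "s + s0"] small
    have "cmod (c a * conv u (s + s0) - conv u (s + s0 + a)) / N \<le> \<eta>"
      using Npos by (simp add: field_simps)
    moreover have "c a * v s - v (s + a) = (c a * conv u (s + s0) - conv u (s + s0 + a)) / of_real N"
      by (simp add: v_def diff_divide_distrib ac_simps)
    ultimately show ?thesis
      using Npos by (simp add: norm_divide)
  qed
  moreover have "cmod (v s) \<le> 1" for s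
    using cmod_conv_le[OF u, of "s + s0"] Npos by (simp add: v_def norm_divide N_def)
  moreover have "(cmod (v 0))\<^sup>2 \<ge> \<delta>"
    using s0 Npos by (simp add: v_def norm_divide power_divide field_simps)
  moreover have "cmod (\<Sum>s\<in>I. \<alpha> s * v s) \<le> \<omega>"
    if \<omega>: "\<And>t. cmod (\<Sum>s\<in>I. \<alpha> s * f (s + t)) \<le> \<omega>" for I \<alpha> \<omega>
  proof (cases "finite I")
    case True
    have "(\<Sum>s\<in>I. \<alpha> s * conv u (s + s0)) = (\<Sum>s\<in>I. cmean (\<lambda>t. \<alpha> s * (f (s + (s0 + t)) * u t)))"
      unfolding conv_def by (intro sum.cong refl) (subst cmean_scale, auto intro!: bdd_intros f_bdd u simp: ac_simps)
    also have "\<dots> = cmean (\<lambda>t. \<Sum>s\<in>I. \<alpha> s * (f (s + (s0 + t)) * u t))"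
      using True by (intro cmean_sum[symmetric] bdd_intros f_bdd u)
    also have "\<dots> = cmean (\<lambda>t. (\<Sum>s\<in>I. \<alpha> s * f (s + (s0 + t))) * u t)"
      by (simp add: sum_distrib_right mult.assoc)
    finally have "cmod (\<Sum>s\<in>I. \<alpha> s * conv u (s + s0)) \<le> \<omega> * N"
      unfolding N_def using \<omega> by (simp only:) (intro cmod_cmean_mult_le u)
    moreover have "(\<Sum>s\<in>I. \<alpha> s * v s) = (\<Sum>s\<in>I. \<alpha> s * conv u (s + s0)) / of_real N"
      by (simp add: v_def sum_divide_distrib)
    ultimately show ?thesis
      using Npos by (simp add: norm_divide pos_divide_le_eq)
  qed (use \<omega>[of undefined] in simp)
  ultimately show ?thesis
    using c by (intro exI[of _ v] exI[of _ c]) blast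
qed

text \<open>Approximate characters for growing finite sets and shrinking errors have a cluster point
  \<open>v\<close>, multiplicative up to the factor \<open>v 0\<close>. Dividing by
  \<open>v 0\<close>, whose modulus is at least \<open>sqrt \<delta>\<close>, gives \<kappa> and
  explains the constant in the last estimate.\<close>

lemma character_of_conv_nonzero:
  assumes u0: "bdd_fun u0" "sq_norm (conv u0) > \<delta> * sq_norm u0" and \<delta>: "\<delta> > 0"
  shows "\<exists>\<kappa>. (\<forall>s t. \<kappa> (s + t) = \<kappa> s * \<kappa> t) \<and> (\<forall>s. cmod (\<kappa> s) = 1) \<and>
    (\<forall>I \<alpha> \<omega>. (\<forall>t. cmod (\<Sum>s\<in>I. \<alpha> s * f (s + t)) \<le> \<omega>) \<longrightarrow> cmod (\<Sum>s\<in>I. \<alpha> s * \<kappa> s) \<le> \<omega> / sqrt \<delta>)"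
proof -
  define P where "P = (\<lambda>A \<eta> v. (\<exists>c. \<forall>a\<in>A. cmod (c a) = 1 \<and> (\<forall>s. cmod (c a * v s - v (s + a)) \<le> \<eta>)) \<and>
    (\<forall>s. cmod (v s) \<le> 1) \<and> (cmod (v 0))\<^sup>2 \<ge> \<delta> \<and>
    (\<forall>I \<alpha> \<omega>. (\<forall>t. cmod (\<Sum>s\<in>I. \<alpha> s * f (s + t)) \<le> \<omega>) \<longrightarrow> cmod (\<Sum>s\<in>I. \<alpha> s * v s) \<le> \<omega>))"
  define F where "F = finite_subsets_at_top (UNIV :: 's set) \<times>\<^sub>F sequentially"
  define M where "M = (\<lambda>(A, n). if finite A then SOME v. P A (1 / Suc n) v else (\<lambda>_. 0))"
  have M: "P A (1 / Suc n) (M (A, n))" if "finite A" for A n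
  proof -
    have "\<exists>v. P A (1 / Suc n) v"
      using approximate_character[OF that u0 \<delta>, of "1 / Suc n"] unfolding P_def by (simp; blast)
    from someI_ex[OF this] show ?thesis using that by (simp add: M_def)
  qed
  have "eventually finite (finite_subsets_at_top (UNIV :: 's set))"
    unfolding eventually_finite_subsets_at_top by (intro exI[of _ "{}"]) auto
  then have fin: "eventually (\<lambda>i. finite (fst i)) F"
    unfolding F_def using eventually_prodI[where Q = "\<lambda>_. True"] by force
  have "F \<noteq> bot"
    by (simp add: F_def prod_filter_eq_bot)
  moreover have "norm (M i s) \<le> 1" for i s
    by (cases i; cases "finite (fst i)") (use M in \<open>auto simp: P_def M_def\<close>)
  ultimately obtain v where v: "\<And>Z. closed Z \<Longrightarrow> eventually (\<lambda>i. M i \<in> Z) F \<Longrightarrow> v \<in> Z"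
    using bounded_family_cluster_point[of F M "\<lambda>_. 1"] by blast
  have cont: "continuous_on UNIV (\<lambda>m. m s :: complex)" for s :: 's
    by simp
  have v0: "(cmod (v 0))\<^sup>2 \<ge> \<delta>"
  proof -
    have "v \<in> {v. \<delta> \<le> (cmod (v 0))\<^sup>2}"
      by (intro v closed_Collect_le continuous_intros cont eventually_mono[OF fin])
        (use M in \<open>force simp: P_def\<close>)
    then show ?thesis by simp
  qed
  then have v00: "cmod (v 0) \<ge> sqrt \<delta>" by (simp add: real_le_lsqrt)
  then have v0_pos: "cmod (v 0) > 0" using \<delta> by (meson order_less_le_trans real_sqrt_gt_zero)
  have bound: "cmod (\<Sum>s\<in>I. \<alpha> s * v s) \<le> \<omega>"
    if "\<And>t. cmod (\<Sum>s\<in>I. \<alpha> s * f (s + t)) \<le> \<omega>" for I \<alpha> \<omega>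
  proof -
    have "v \<in> {v. cmod (\<Sum>s\<in>I. \<alpha> s * v s) \<le> \<omega>}"
      by (intro v closed_Collect_le continuous_intros cont eventually_mono[OF fin])
        (use M that in \<open>force simp: P_def\<close>)
    then show ?thesis by simp
  qed
  have approx: "cmod (v (s + a) * v 0 - v s * v a) \<le> 0 + e \<and> \<bar>cmod (v a) - cmod (v 0)\<bar> \<le> 0 + e"
    if e: "e > 0" for s a e
  proof -
    have "eventually (\<lambda>n. 2 / real (Suc n) < e) sequentially"
      by (rule order_tendstoD(2)[OF LIMSEQ_Suc[OF lim_const_over_n] e])
    moreover have "eventually (\<lambda>A. finite A \<and> {a} \<subseteq> A) (finite_subsets_at_top (UNIV::'s set))"
      unfolding eventually_finite_subsets_at_top by (intro exI[of _ "{a}"]) auto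
    ultimately have ev: "eventually (\<lambda>i. (finite (fst i) \<and> {a} \<subseteq> fst i) \<and> 2 / real (Suc (snd i)) < e) F"
      unfolding F_def by (intro eventually_prodI)
    have "eventually (\<lambda>i. M i \<in> {v. cmod (v (s + a) * v 0 - v s * v a) \<le> e} \<inter> {v. \<bar>cmod (v a) - cmod (v 0)\<bar> \<le> e}) F"
      using ev
    proof eventually_elim
      case (elim i)
      define w where "w = M i"
      define \<eta> where "\<eta> = 1 / Suc (snd i)"
      have "P (fst i) \<eta> w"
        using M[of "fst i" "snd i"] elim by (simp add: w_def \<eta>_def)
      then obtain c where c: "cmod c = 1" "\<And>s. cmod (c * w s - w (s + a)) \<le> \<eta>" and w: "\<And>s. cmod (w s) \<le> 1"
        using elim unfolding P_def by auto
      \<comment> \<open>The relations at \<open>s\<close> and at 0 share the eigenvalue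
        \<open>c\<close>. Eliminating it leaves an estimate on \<open>w\<close> alone, which
        survives the limit.\<close>
      have "w (s + a) * w 0 - w s * w a = (w s * (c * w 0 - w (0 + a))) - w 0 * (c * w s - w (s + a))"
        by (simp add: algebra_simps)
      also have "cmod \<dots> \<le> cmod (w s) * cmod (c * w 0 - w (0 + a)) + cmod (w 0) * cmod (c * w s - w (s + a))"
        by (metis norm_mult norm_triangle_ineq4)
      also have "\<dots> \<le> 1 * \<eta> + 1 * \<eta>"
        by (intro add_mono mult_mono c w) auto
      finally have 1: "cmod (w (s + a) * w 0 - w s * w a) \<le> e"
        using elim by (simp add: \<eta>_def)
      have "\<bar>cmod (c * w 0) - cmod (w (0 + a))\<bar> \<le> \<eta>"
        using norm_triangle_ineq3 c(2) order_trans by blast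
      moreover have "\<eta> \<le> e"
        using elim by (simp add: \<eta>_def field_simps)
      ultimately have 2: "\<bar>cmod (w a) - cmod (w 0)\<bar> \<le> e"
        using c(1) by (simp add: norm_mult)
      show ?case using 1 2 by (simp add: w_def)
    qed
    then have "v \<in> {v. cmod (v (s + a) * v 0 - v s * v a) \<le> e} \<inter> {v. \<bar>cmod (v a) - cmod (v 0)\<bar> \<le> e}"
      by (intro v closed_Collect_le closed_Int continuous_intros cont)
    then show ?thesis by simp
  qed
  have mult: "v (s + a) * v 0 = v s * v a" for s a
  proof -
    have "cmod (v (s + a) * v 0 - v s * v a) \<le> 0"
      by (rule field_le_epsilon) (rule approx[THEN conjunct1])
    then show ?thesis by simp
  qed
  have norm: "cmod (v a) = cmod (v 0)" for a
  proof -
    have "\<bar>cmod (v a) - cmod (v 0)\<bar> \<le> 0"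
      by (rule field_le_epsilon) (rule approx[THEN conjunct2])
    then show ?thesis by simp
  qed
  define \<kappa> where "\<kappa> s = v s / v 0" for s
  have "v 0 \<noteq> 0" using v0_pos by auto
  then have "\<kappa> (s + t) = \<kappa> s * \<kappa> t" "cmod (\<kappa> s) = 1" for s t
    using mult[of s t] norm[of s] by (auto simp: \<kappa>_def norm_divide field_simps)
  moreover have "cmod (\<Sum>s\<in>I. \<alpha> s * \<kappa> s) \<le> \<omega> / sqrt \<delta>"
    if \<omega>: "\<forall>t. cmod (\<Sum>s\<in>I. \<alpha> s * f (s + t)) \<le> \<omega>" for I \<alpha> \<omega>
  proof -
    have "\<omega> \<ge> 0" using \<omega> norm_ge_zero order_trans by blast
    have "cmod (\<Sum>s\<in>I. \<alpha> s * \<kappa> s) = cmod (\<Sum>s\<in>I. \<alpha> s * v s) / cmod (v 0)"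
      by (simp add: \<kappa>_def flip: sum_divide_distrib norm_divide)
    also have "\<dots> \<le> \<omega> / sqrt \<delta>"
      using bound \<omega> v00 \<delta> \<open>\<omega> \<ge> 0\<close> by (intro frac_le) auto
    finally show ?thesis .
  qed
  ultimately show ?thesis by blast
qed

end

text \<open>The third hypothesis is Bohr almost periodicity for a monoid: up to a correction from a
  finite set, every element is an \<epsilon>-period. It makes recurrence syndetic, so the
  convolution of \<open>f\<close> with its conjugate has positive L2 seminorm. The last conclusion
  carries continuity and linear relations from \<open>f\<close> over to \<kappa>.\<close>

theorem character_of_almost_periodic:
  fixes f :: "'s::comm_monoid_add \<Rightarrow> complex"
  assumes f_le: "\<And>s. cmod (f s) \<le> 1" and f0: "f 0 \<noteq> 0"
    and ap: "\<And>\<epsilon>. \<epsilon> > 0 \<Longrightarrow> \<exists>A. finite A \<and> (\<forall>s. \<exists>a\<in>A. \<forall>t. cmod (f (s + a + t) - f t) \<le> \<epsilon>)"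
  obtains \<kappa> C where "\<And>s t. \<kappa> (s + t) = \<kappa> s * \<kappa> t" "\<And>s. cmod (\<kappa> s) = 1"
    "\<And>I \<alpha> \<omega>. (\<And>t. cmod (\<Sum>s\<in>I. \<alpha> s * f (s + t)) \<le> \<omega>) \<Longrightarrow> cmod (\<Sum>s\<in>I. \<alpha> s * \<kappa> s) \<le> C * \<omega>"
proof -
  obtain \<mu> :: "('s \<Rightarrow> real) \<Rightarrow> real" where "invariant_mean \<mu>"
    using invariant_mean_exists by blast
  then interpret convolution \<mu> f
    by (simp add: convolution_def convolution_axioms_def f_le)
  have fb: "bdd_fun f" using f_bdd[of "\<lambda>t. t"] .
  \<comment> \<open>An almost period of \<open>f\<close> moves \<open>h\<close> little, so the
    modulus of \<open>h\<close> is at least half its value at 0 on a syndetic set.\<close>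
  have pos: "sq_norm h > 0"
    if h: "bdd_fun h" "h 0 \<noteq> 0"
      and osc: "\<And>s \<epsilon>. (\<And>t. cmod (f (s + t) - f t) \<le> \<epsilon>) \<Longrightarrow> cmod (h s - h 0) \<le> \<epsilon>" for h
  proof -
    obtain A where A: "finite A" "\<And>s. \<exists>a\<in>A. \<forall>t. cmod (f (s + a + t) - f t) \<le> cmod (h 0) / 2"
      using ap[of "cmod (h 0) / 2"] h(2) by auto
    have "\<exists>a\<in>A. cmod (h (s + a)) \<ge> cmod (h 0) / 2" for s
    proof -
      obtain a where a: "a \<in> A" "\<And>t. cmod (f (s + a + t) - f t) \<le> cmod (h 0) / 2"
        using A(2) by blast
      from osc[OF a(2)] have "cmod (h 0) - cmod (h (s + a)) \<le> cmod (h 0) / 2"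
        by (smt (verit) norm_minus_commute norm_triangle_ineq2)
      then show ?thesis using a(1) by (intro bexI[of _ a]) auto
    qed
    with A(1) h show ?thesis
      by (intro sq_norm_pos[of h A "cmod (h 0) / 2"]) auto
  qed
  have pos_f: "sq_norm f > 0"
    using fb f0 by (intro pos) (auto, metis add_0_right)
  \<comment> \<open>Against its own conjugate, \<open>f\<close> gives
    \<open>conv u0 0 = sq_norm f\<close>, so the operator does not annihilate
    \<open>u0\<close>.\<close>
  define u0 where "u0 t = cnj (f t)" for t
  have u0: "bdd_fun u0" unfolding u0_def by (intro bdd_intros fb)
  have "conv u0 0 = of_real (sq_norm f)"
    unfolding conv_def u0_def cmean_def sq_norm_def complex_norm_square[symmetric, simplified]
    by (simp add: complex_eq_iff const complex_norm_square[symmetric] del: of_real_power)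
  then have "conv u0 0 \<noteq> 0" using pos_f by simp
  moreover have "cmod (conv u0 s - conv u0 0) \<le> \<epsilon>"
    if "\<And>t. cmod (f (s + t) - f t) \<le> \<epsilon>" for s \<epsilon>
  proof -
    have "conv u0 s - conv u0 0 = cmean (\<lambda>t. (f (s + t) - f t) * u0 t)"
      unfolding conv_def
      by (subst cmean_diff[symmetric]) (auto intro!: bdd_intros f_bdd u0 fb simp: algebra_simps)
    also have "cmod \<dots> \<le> \<epsilon>"
    proof (rule cmod_cmean_bound)
      fix t
      have "cmod (f (s + t) - f t) * cmod (u0 t) \<le> \<epsilon> * 1"
        using that f_le[of t] by (intro mult_mono) (auto simp: u0_def intro: order_trans[OF norm_ge_zero])
      then show "cmod ((f (s + t) - f t) * u0 t) \<le> \<epsilon>" by (simp add: norm_mult)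
    qed
    finally show ?thesis .
  qed
  ultimately have pos_conv: "sq_norm (conv u0) > 0"
    by (intro pos bdd_conv u0) auto
  \<comment> \<open>The summand 1 in the denominator yields the strict inequality that the gap
    requires.\<close>
  define \<delta> where "\<delta> = sq_norm (conv u0) / (sq_norm u0 + 1)"
  have nn: "sq_norm u0 \<ge> 0" by (rule sq_norm_nonneg[OF u0])
  have \<delta>: "\<delta> > 0" using pos_conv nn by (simp add: \<delta>_def)
  have "\<delta> * sq_norm u0 < \<delta> * (sq_norm u0 + 1)" using \<delta> by simp
  also have "\<dots> = sq_norm (conv u0)" using nn by (simp add: \<delta>_def)
  finally show thesis
    using character_of_conv_nonzero[OF u0 _ \<delta>] that[where C = "1 / sqrt \<delta>"] by auto
qed

section \<open>Finite coverings of compact groups\<close>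

lemma continuous_map_locally_equal:
  assumes "\<And>x. x \<in> topspace X \<Longrightarrow> \<exists>U g. openin X U \<and> x \<in> U \<and> continuous_map X Y g \<and> (\<forall>z\<in>U. f z = g z)"
  shows "continuous_map X Y f"
  unfolding continuous_map_eq_topcontinuous_at topcontinuous_at_def
proof (intro ballI conjI allI impI)
  show "f \<in> topspace X \<rightarrow> topspace Y"
  proof
    fix x assume x: "x \<in> topspace X"
    from assms[OF x] obtain U g where "x \<in> U" "continuous_map X Y g" "\<forall>z\<in>U. f z = g z" by blast
    then show "f x \<in> topspace Y" using x by (auto simp: continuous_map_def)
  qed
  fix x V assume x: "x \<in> topspace X" and V: "openin Y V \<and> f x \<in> V"
  obtain U g where U: "openin X U" "x \<in> U" and g: "continuous_map X Y g" and eq: "\<And>z. z \<in> U \<Longrightarrow> f z = g z"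
    using assms[OF x] by blast
  have "openin X {z \<in> topspace X. g z \<in> V}"
    using g V by (simp add: continuous_map_def)
  then have "openin X (U \<inter> {z \<in> topspace X. g z \<in> V})"
    using U by blast
  then show "\<exists>U. openin X U \<and> x \<in> U \<and> (\<forall>y\<in>U. f y \<in> V)"
    using U x V eq by (intro exI[of _ "U \<inter> {z \<in> topspace X. g z \<in> V}"]) auto
qed

lemma Hausdorff_space_euclidean_t2: "Hausdorff_space (euclidean :: 'a::t2_space topology)"
  unfolding Hausdorff_space_def by (simp add: disjnt_def) (metis separation_t2)

text \<open>A Urysohn function is only known to vanish outside \<open>W\<close>. Cutting it off at
  1/2 moves its support into a closed set \<open>K\<close> inside \<open>W\<close>, so that
  functions living over \<open>W\<close> extend continuously by 0.\<close>

lemma compact_t2_bump: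
  fixes W :: "'g::t2_space set"
  assumes "compact (UNIV :: 'g set)" "open W" "y \<in> W"
  obtains b :: "'g \<Rightarrow> real" and K where "continuous_on UNIV b" "\<And>z. 0 \<le> b z" "\<And>z. b z \<le> 1"
    "b y = 1" "closed K" "K \<subseteq> W" "\<And>z. z \<notin> K \<Longrightarrow> b z = 0"
proof -
  have "normal_space (euclidean :: 'g topology)"
    using assms(1)
    by (intro compact_Hausdorff_or_regular_imp_normal_space)
      (simp_all add: compact_space_def Hausdorff_space_euclidean_t2)
  then obtain a where a: "continuous_map euclidean (top_of_set {0..1::real}) a"
    "a ` (- W) \<subseteq> {0}" "a ` {y} \<subseteq> {1}"
    using Urysohn_lemma[of euclidean "- W" "{y}" 0 1] assms(2,3)
    by (auto simp: disjnt_def closed_closedin[symmetric])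
  have cont: "continuous_on UNIV a" and a01: "\<And>z. 0 \<le> a z \<and> a z \<le> 1"
    using a(1) by (auto simp: continuous_map_in_subtopology)
  define b where "b z = max 0 (2 * a z - 1)" for z
  show thesis
  proof (rule that[of b "{z. a z \<ge> 1 / 2}"])
    show "continuous_on UNIV b"
      unfolding b_def by (intro continuous_intros cont)
    show "closed {z. a z \<ge> 1 / 2}"
      using cont by (intro closed_Collect_le continuous_intros) auto
    show "{z. a z \<ge> 1 / 2} \<subseteq> W"
      using a(2) by force
    show "b z \<le> 1" for z
      using a01[of z] by (simp add: b_def)
  qed (use a(3) in \<open>auto simp: b_def\<close>)
qed

lemma compact_UNIV_subcover:
  fixes U :: "'a::topological_space \<Rightarrow> 'a set"
  assumes "compact (UNIV :: 'a set)" "\<And>y. open (U y)" "\<And>y. y \<in> U y"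
  obtains Y where "finite Y" "\<And>x. \<exists>y\<in>Y. x \<in> U y"
proof (rule compactE_image[OF assms(1), of UNIV U])
  show "UNIV \<subseteq> (\<Union>y\<in>UNIV. U y)" using assms(3) by blast
  fix Y assume "finite Y" "UNIV \<subseteq> (\<Union>y\<in>Y. U y)"
  then show thesis by (intro that[of Y]) auto
qed (rule assms(2))

text \<open>The Lebesgue number lemma for the translation uniformity, with \<open>N\<close> in the
  role of the number.\<close>

lemma compact_group_lebesgue:
  fixes U :: "'g::topological_ab_group_add \<Rightarrow> 'g set"
  assumes "compact (UNIV :: 'g set)" and U: "\<And>y. open (U y)" "\<And>y. y \<in> U y"
  obtains N where "open N" "0 \<in> N" "\<And>y. \<exists>z. \<forall>g\<in>N. y + g \<in> U z"
proof -
  have "\<exists>A N. open A \<and> y \<in> A \<and> open N \<and> 0 \<in> N \<and> (\<forall>a\<in>A. \<forall>g\<in>N. a + g \<in> U y)" for y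
  proof -
    have "continuous_on UNIV (\<lambda>(a, g). a + g :: 'g)"
      unfolding case_prod_unfold by (intro continuous_intros)
    then have "open ((\<lambda>(a, g). a + g :: 'g) -` U y)"
      using U(1) by (intro open_vimage) auto
    moreover have "(y, 0) \<in> (\<lambda>(a, g). a + g) -` U y"
      using U(2) by simp
    ultimately obtain A N where "open A" "open N" "(y, 0) \<in> A \<times> N" "A \<times> N \<subseteq> (\<lambda>(a, g). a + g) -` U y"
      by (rule open_prod_elim)
    then show ?thesis by (intro exI[of _ A] exI[of _ N]) auto
  qed
  then obtain A N where A: "\<And>y. open (A y)" "\<And>y. y \<in> A y" and N: "\<And>y. open (N y)" "\<And>y. 0 \<in> N y"
    and AN: "\<And>y a g. a \<in> A y \<Longrightarrow> g \<in> N y \<Longrightarrow> a + g \<in> U y"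
    by metis
  obtain Y where Y: "finite Y" "\<And>x. \<exists>y\<in>Y. x \<in> A y"
    using compact_UNIV_subcover[OF assms(1) A] by blast
  show thesis
  proof (rule that[of "\<Inter>y\<in>Y. N y"])
    show "\<exists>z. \<forall>g\<in>(\<Inter>y\<in>Y. N y). y + g \<in> U z" for y
      using Y(2)[of y] AN by blast
  qed (use Y(1) N in auto)
qed

text \<open>An evenly covered set whose sheets are recorded by their inverse maps. Distinct members
  of \<open>S\<close> agree nowhere on \<open>W\<close>, so the sheets are disjoint and
  \<open>card S\<close> is the number of points over each point of \<open>W\<close>.\<close>

definition local_sections ::
  "'x topology \<Rightarrow> ('x \<Rightarrow> 'g::topological_space) \<Rightarrow> 'g set \<Rightarrow> ('g \<Rightarrow> 'x) set \<Rightarrow> bool" where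
  "local_sections X p W S \<longleftrightarrow> open W \<and> finite S \<and>
     (\<forall>\<sigma>\<in>S. continuous_map (top_of_set W) X \<sigma> \<and> (\<forall>z\<in>W. p (\<sigma> z) = z) \<and> openin X (\<sigma> ` W)) \<and>
     (\<forall>x\<in>topspace X. p x \<in> W \<longrightarrow> (\<exists>\<sigma>\<in>S. \<sigma> (p x) = x)) \<and>
     (\<forall>\<sigma>\<in>S. \<forall>\<tau>\<in>S. \<forall>z\<in>W. \<sigma> z = \<tau> z \<longrightarrow> \<sigma> = \<tau>)"

lemma local_sectionsD:
  assumes "local_sections X p W S"
  shows "open W" "finite S"
    "\<And>\<sigma>. \<sigma> \<in> S \<Longrightarrow> continuous_map (top_of_set W) X \<sigma>"
    "\<And>\<sigma> z. \<sigma> \<in> S \<Longrightarrow> z \<in> W \<Longrightarrow> \<sigma> z \<in> topspace X"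
    "\<And>\<sigma> z. \<sigma> \<in> S \<Longrightarrow> z \<in> W \<Longrightarrow> p (\<sigma> z) = z"
    "\<And>\<sigma>. \<sigma> \<in> S \<Longrightarrow> openin X (\<sigma> ` W)"
    "\<And>x. x \<in> topspace X \<Longrightarrow> p x \<in> W \<Longrightarrow> \<exists>\<sigma>\<in>S. \<sigma> (p x) = x"
    "\<And>\<sigma> \<tau> z. \<sigma> \<in> S \<Longrightarrow> \<tau> \<in> S \<Longrightarrow> z \<in> W \<Longrightarrow> \<sigma> z = \<tau> z \<Longrightarrow> \<sigma> = \<tau>"
  using assms unfolding local_sections_def continuous_map_def Pi_iff by (auto, blast)

locale finite_cover =
  fixes X :: "'x topology" and p :: "'x \<Rightarrow> 'g::topological_space"
  assumes cont: "continuous_map X euclidean p"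
    and loc: "\<exists>W S. y \<in> W \<and> local_sections X p W S"
begin

definition fiber :: "'g \<Rightarrow> 'x set" where
  "fiber y = {x \<in> topspace X. p x = y}"

lemma fiber_eq_sections:
  assumes "local_sections X p W S" "y \<in> W"
  shows "fiber y = (\<lambda>\<sigma>. \<sigma> y) ` S" "inj_on (\<lambda>\<sigma>. \<sigma> y) S"
proof -
  note D = local_sectionsD[OF assms(1)]
  show "fiber y = (\<lambda>\<sigma>. \<sigma> y) ` S"
    using D(4,5,7) assms(2) by (auto simp: fiber_def image_iff) metis
  show "inj_on (\<lambda>\<sigma>. \<sigma> y) S"
    using D(8) assms(2) by (intro inj_onI)
qed

lemma card_fiber: "local_sections X p W S \<Longrightarrow> y \<in> W \<Longrightarrow> card (fiber y) = card S"
  by (simp add: fiber_eq_sections card_image)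

lemma finite_fiber: "finite (fiber y)"
  using loc[of y] fiber_eq_sections(1) by (metis finite_imageI local_sectionsD(2))

lemma open_preimage: "open U \<Longrightarrow> openin X {x \<in> topspace X. p x \<in> U}"
  using cont by (simp add: continuous_map_def)

lemma open_section_preimage:
  assumes "local_sections X p W S" "\<sigma> \<in> S" "openin X U"
  shows "open {z \<in> W. \<sigma> z \<in> U}"
proof -
  have "openin (top_of_set W) {z \<in> W. \<sigma> z \<in> U}" "open W"
    using local_sectionsD(1,3)[OF assms(1)] assms(2,3) by (auto simp: continuous_map_def)
  then show ?thesis by (simp add: openin_open_eq)
qed

lemma card_fiber_eq:
  assumes "connected (UNIV :: 'g set)"
  shows "card (fiber y) = card (fiber z)"
proof (rule connected_local_const[OF assms])
  show "\<forall>a\<in>UNIV. \<forall>\<^sub>F b in at a within UNIV. card (fiber a) = card (fiber b)"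
  proof
    fix a
    obtain W S where W: "a \<in> W" "local_sections X p W S" using loc by blast
    then have "open W" by (simp add: local_sectionsD)
    then show "\<forall>\<^sub>F b in at a within UNIV. card (fiber a) = card (fiber b)"
      using W card_fiber by (auto simp: eventually_at_topological intro!: exI[of _ W])
  qed
qed auto

text \<open>As \<open>C\<close> and its complement are open, each section stays, on a neighbourhood
  of \<open>y\<close>, on the side of \<open>C\<close> where it is at \<open>y\<close>. The sections
  that start in \<open>C\<close> serve the subspace.\<close>

lemma clopen_subcover:
  assumes C: "openin X C" "closedin X C"
  shows "finite_cover (subtopology X C) p"
proof
  show "continuous_map (subtopology X C) euclidean p"
    by (rule continuous_map_from_subtopology[OF cont])
  fix y
  obtain W S where W: "y \<in> W" "local_sections X p W S" using loc by blast
  note D = local_sectionsD[OF W(2)]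
  define W' where "W' = W \<inter> (\<Inter>\<sigma>\<in>S. {z \<in> W. \<sigma> z \<in> C \<longleftrightarrow> \<sigma> y \<in> C})"
  define S' where "S' = {\<sigma> \<in> S. \<sigma> y \<in> C}"
  have "open {z \<in> W. \<sigma> z \<in> C \<longleftrightarrow> \<sigma> y \<in> C}" if \<sigma>: "\<sigma> \<in> S" for \<sigma>
  proof (cases "\<sigma> y \<in> C")
    case True
    then show ?thesis using open_section_preimage[OF W(2) \<sigma> C(1)] by simp
  next
    case False
    have "openin X (topspace X - C)" using C(2) by (simp add: closedin_def)
    from open_section_preimage[OF W(2) \<sigma> this] show ?thesis
      using False D(4)[OF \<sigma>] by (simp cong: conj_cong)
  qed
  then have "open W'"
    using D(1,2) unfolding W'_def by (intro open_Int open_INT) auto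
  moreover have "y \<in> W'" using W(1) by (simp add: W'_def)
  moreover have "continuous_map (top_of_set W') (subtopology X C) \<sigma>" if "\<sigma> \<in> S'" for \<sigma>
  proof -
    have "continuous_map (top_of_set W) X \<sigma>" using D(3) that by (auto simp: S'_def)
    then have "continuous_map (top_of_set W') X \<sigma>"
      by (rule continuous_map_from_subtopology_mono) (auto simp: W'_def)
    then show ?thesis
      using that by (auto simp: continuous_map_in_subtopology W'_def S'_def)
  qed
  moreover have "openin (subtopology X C) (\<sigma> ` W')" if \<sigma>: "\<sigma> \<in> S'" for \<sigma>
  proof -
    have "\<sigma> ` W' = (\<sigma> ` W \<inter> {x \<in> topspace X. p x \<in> W'}) \<inter> C"
      using \<sigma> D(4,5) unfolding S'_def W'_def by (auto simp: image_iff)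
    moreover have "openin X (\<sigma> ` W \<inter> {x \<in> topspace X. p x \<in> W'})"
      using \<sigma> D(6) open_preimage[OF \<open>open W'\<close>] by (auto simp: S'_def)
    ultimately show ?thesis by (auto simp: openin_subtopology)
  qed
  moreover have "\<exists>\<sigma>\<in>S'. \<sigma> (p x) = x" if "x \<in> topspace X" "x \<in> C" "p x \<in> W'" for x
    using that D(7)[of x] unfolding S'_def W'_def by force
  ultimately have "local_sections (subtopology X C) p W' S'"
    using D(2,5,8) unfolding local_sections_def by (auto simp: S'_def W'_def)
  then show "\<exists>W S. y \<in> W \<and> local_sections (subtopology X C) p W S"
    using \<open>y \<in> W'\<close> by blast
qed

text \<open>The weights tell the sheets apart: distinct integers will separate the points of a
  fibre, and weights with sum 0 will give vanishing fibre sums.\<close>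

lemma bump_function:
  fixes w :: "('g \<Rightarrow> 'x) \<Rightarrow> real"
  assumes W: "local_sections X p W S"
    and b: "continuous_on UNIV b" "closed K" "K \<subseteq> W" "\<And>z. z \<notin> K \<Longrightarrow> b z = (0::real)"
  obtains F where "continuous_map X euclideanreal F"
    "\<And>\<sigma> z. \<sigma> \<in> S \<Longrightarrow> z \<in> W \<Longrightarrow> F (\<sigma> z) = w \<sigma> * b z"
    "\<And>x. p x \<notin> W \<Longrightarrow> F x = 0"
proof -
  note D = local_sectionsD[OF W]
  define F where "F x = (if p x \<in> W then w (THE \<sigma>. \<sigma> \<in> S \<and> \<sigma> (p x) = x) * b (p x) else 0)" for x
  have F: "F (\<sigma> z) = w \<sigma> * b z" if "\<sigma> \<in> S" "z \<in> W" for \<sigma> z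
  proof -
    have "p (\<sigma> z) = z" using that D(5) by simp
    moreover have "(THE \<tau>. \<tau> \<in> S \<and> \<tau> z = \<sigma> z) = \<sigma>"
      using that D(8) by (intro the_equality) auto
    ultimately show ?thesis using that by (simp add: F_def)
  qed
  have bp: "continuous_map X euclideanreal (\<lambda>x. w \<sigma> * b (p x))" for \<sigma>
  proof -
    have "continuous_map X euclideanreal (b \<circ> p)"
      using b(1) by (intro continuous_map_compose[OF cont]) auto
    then show ?thesis unfolding o_def by (intro continuous_map_real_mult) auto
  qed
  have "continuous_map X euclideanreal F"
  proof (rule continuous_map_locally_equal)
    fix x assume x: "x \<in> topspace X"
    show "\<exists>U g. openin X U \<and> x \<in> U \<and> continuous_map X euclideanreal g \<and> (\<forall>z\<in>U. F z = g z)"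
    proof (cases "p x \<in> W")
      case True
      then obtain \<sigma> where \<sigma>: "\<sigma> \<in> S" "\<sigma> (p x) = x" using D(7)[OF x] by auto
      have "\<forall>z\<in>\<sigma> ` W. F z = w \<sigma> * b (p z)"
        using F[OF \<sigma>(1)] D(5)[OF \<sigma>(1)] by auto
      moreover have "openin X (\<sigma> ` W)" "x \<in> \<sigma> ` W"
        using \<sigma> D(6) True by (auto simp: image_iff intro!: bexI[of _ "p x"])
      ultimately show ?thesis using bp by blast
    next
      case False
      have "openin X {x \<in> topspace X. p x \<in> - K}" using b(2) by (intro open_preimage) auto
      moreover have "\<forall>z\<in>{x \<in> topspace X. p x \<in> - K}. F z = 0"
        using b(4) by (simp add: F_def)
      ultimately show ?thesis
        using x False b(3) by (intro exI[of _ "{x \<in> topspace X. p x \<in> - K}"] exI[of _ "\<lambda>_. 0"]) auto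
    qed
  qed
  then show thesis
    using F by (intro that[of F]) (auto simp: F_def)
qed

end

section \<open>Uniform lifting over a compact group\<close>

locale compact_group_cover = finite_cover X p
  for X :: "'x topology" and p :: "'x \<Rightarrow> 'g::{topological_ab_group_add, t2_space}" +
  assumes compact_base: "compact (UNIV :: 'g set)"
begin

text \<open>Distinct integer weights differ by at least 1 and the bump exceeds 1/2 near its centre,
  hence the gap 1/2. The finite family replaces a uniform structure on \<open>X\<close>: two points
  of a fibre that it does not tell apart by 1/2 coincide.\<close>

lemma separating_family:
  obtains FF :: "('x \<Rightarrow> real) set" where "finite FF" "\<And>F. F \<in> FF \<Longrightarrow> continuous_map X euclideanreal F"
    "\<And>x x'. x \<in> topspace X \<Longrightarrow> x' \<in> topspace X \<Longrightarrow> p x = p x' \<Longrightarrow> x \<noteq> x' \<Longrightarrow>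
      \<exists>F\<in>FF. \<bar>F x - F x'\<bar> \<ge> 1 / 2"
proof -
  have "\<exists>U F. open U \<and> y \<in> U \<and> continuous_map X euclideanreal F \<and>
    (\<forall>x\<in>topspace X. \<forall>x'\<in>topspace X. p x = p x' \<longrightarrow> x \<noteq> x' \<longrightarrow> p x \<in> U \<longrightarrow> \<bar>F x - F x'\<bar> \<ge> 1 / 2)" for y
  proof -
    obtain W S where W: "y \<in> W" "local_sections X p W S" using loc by blast
    then obtain b K where b: "continuous_on UNIV b" "closed K" "K \<subseteq> W" "\<And>z. z \<notin> K \<Longrightarrow> b z = (0::real)" "b y = 1"
      using compact_t2_bump[OF compact_base, of W y] by (metis local_sectionsD(1))
    obtain w :: "('g \<Rightarrow> 'x) \<Rightarrow> nat" where w: "inj_on w S"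
      using finite_imp_inj_to_nat_seg[OF local_sectionsD(2)[OF W(2)]] by metis
    obtain F where F: "continuous_map X euclideanreal F"
      "\<And>\<sigma> z. \<sigma> \<in> S \<Longrightarrow> z \<in> W \<Longrightarrow> F (\<sigma> z) = real (w \<sigma>) * b z"
      using bump_function[OF W(2) b(1-4), of "\<lambda>\<sigma>. real (w \<sigma>)"] by metis
    show ?thesis
    proof (intro exI[of _ "{z. b z > 1 / 2}"] exI[of _ F] conjI ballI impI)
      show "open {z. b z > 1 / 2}"
        using b(1) by (intro open_Collect_less continuous_intros) auto
      fix x x' assume x: "x \<in> topspace X" "x' \<in> topspace X" "p x = p x'" "x \<noteq> x'" "p x \<in> {z. b z > 1 / 2}"
      then have pW: "p x \<in> W" using b(3,4) by force
      then obtain \<sigma> \<tau> where \<sigma>: "\<sigma> \<in> S" "\<sigma> (p x) = x" "\<tau> \<in> S" "\<tau> (p x) = x'"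
        using local_sectionsD(7)[OF W(2)] x by metis
      then have "w \<sigma> \<noteq> w \<tau>" using w x(4) by (auto simp: inj_on_def)
      then have "\<bar>real (w \<sigma>) - real (w \<tau>)\<bar> \<ge> 1" by linarith
      moreover have "\<bar>F x - F x'\<bar> = \<bar>real (w \<sigma>) - real (w \<tau>)\<bar> * \<bar>b (p x)\<bar>"
        using F(2)[OF \<sigma>(1) pW] F(2)[OF \<sigma>(3) pW] \<sigma> by (simp add: left_diff_distrib flip: abs_mult)
      moreover have "\<bar>b (p x)\<bar> \<ge> 1 / 2" using x(5) by simp
      ultimately show "\<bar>F x - F x'\<bar> \<ge> 1 / 2"
        using mult_mono[of 1 "\<bar>real (w \<sigma>) - real (w \<tau>)\<bar>" "1 / 2" "\<bar>b (p x)\<bar>"] by simp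
    qed (use F b in auto)
  qed
  then obtain U F where U: "\<And>y. open (U y)" "\<And>y. y \<in> U y" and F: "\<And>y. continuous_map X euclideanreal (F y)"
    and sep: "\<And>y x x'. x \<in> topspace X \<Longrightarrow> x' \<in> topspace X \<Longrightarrow> p x = p x' \<Longrightarrow> x \<noteq> x' \<Longrightarrow> p x \<in> U y \<Longrightarrow>
      \<bar>F y x - F y x'\<bar> \<ge> 1 / 2"
    by metis
  obtain Y where Y: "finite Y" "\<And>x. \<exists>y\<in>Y. x \<in> U y"
    using compact_UNIV_subcover[OF compact_base U] by blast
  show thesis
  proof (rule that[of "F ` Y"])
    fix x x' assume x: "x \<in> topspace X" "x' \<in> topspace X" "p x = p x'" "x \<noteq> x'"
    obtain y where "y \<in> Y" "p x \<in> U y" using Y(2) by blast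
    then show "\<exists>F\<in>F ` Y. \<bar>F x - F x'\<bar> \<ge> 1 / 2" using sep[OF x] by blast
  qed (use Y F in auto)
qed

text \<open>Along a local section the values of \<open>FF\<close> vary little near a base point, so
  the section through \<open>x\<close> provides the lift. Compactness makes the neighbourhood
  independent of \<open>x\<close>.\<close>

lemma uniform_lift:
  assumes "finite FF" and FF: "\<And>F. F \<in> FF \<Longrightarrow> continuous_map X euclideanreal F" and \<epsilon>: "\<epsilon> > 0"
  obtains N where "open N" "0 \<in> N"
    "\<And>x g. x \<in> topspace X \<Longrightarrow> g \<in> N \<Longrightarrow> \<exists>x'\<in>topspace X. p x' = p x + g \<and> (\<forall>F\<in>FF. \<bar>F x - F x'\<bar> < \<epsilon>)"
proof -
  have "\<exists>U. open U \<and> y \<in> U \<and> (\<forall>x\<in>topspace X. p x \<in> U \<longrightarrow>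
    (\<forall>z\<in>U. \<exists>x'\<in>topspace X. p x' = z \<and> (\<forall>F\<in>FF. \<bar>F x - F x'\<bar> < \<epsilon>)))" for y
  proof -
    obtain W S where W: "y \<in> W" "local_sections X p W S" using loc by blast
    note D = local_sectionsD[OF W(2)]
    define B where "B \<sigma> F = {x \<in> topspace X. F x \<in> ball (F (\<sigma> y)) (\<epsilon> / 2)}" for \<sigma> :: "'g \<Rightarrow> 'x" and F :: "'x \<Rightarrow> real"
    define U where "U = W \<inter> (\<Inter>\<sigma>\<in>S. \<Inter>F\<in>FF. {z \<in> W. \<sigma> z \<in> B \<sigma> F})"
    have "openin X (B \<sigma> F)" if "F \<in> FF" for \<sigma> F
    proof -
      have "openin X {x \<in> topspace X. F x \<in> V}" if "open V" for V
        using FF[OF \<open>F \<in> FF\<close>] that by (simp add: continuous_map_def)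
      from this[OF open_ball] show ?thesis unfolding B_def .
    qed
    then have "open U"
      unfolding U_def using W(2) assms(1) D(1,2)
      by (intro open_Int open_INT ballI open_section_preimage) auto
    moreover have "y \<in> U"
      using W \<epsilon> D(4) by (simp add: U_def B_def)
    moreover have "\<exists>x'\<in>topspace X. p x' = z \<and> (\<forall>F\<in>FF. \<bar>F x - F x'\<bar> < \<epsilon>)"
      if x: "x \<in> topspace X" "p x \<in> U" and z: "z \<in> U" for x z
    proof -
      obtain \<sigma> where \<sigma>: "\<sigma> \<in> S" "\<sigma> (p x) = x" using D(7)[OF x(1)] x(2) by (auto simp: U_def)
      have "\<bar>F x - F (\<sigma> z)\<bar> < \<epsilon>" if F: "F \<in> FF" for F
      proof -
        have "\<sigma> (p x) \<in> B \<sigma> F" "\<sigma> z \<in> B \<sigma> F" using x z \<sigma>(1) F by (auto simp: U_def)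
        then have "\<bar>F (\<sigma> y) - F x\<bar> < \<epsilon> / 2" "\<bar>F (\<sigma> y) - F (\<sigma> z)\<bar> < \<epsilon> / 2"
          unfolding \<sigma>(2) by (simp_all add: B_def dist_real_def)
        then show ?thesis by linarith
      qed
      moreover have "\<sigma> z \<in> topspace X" "p (\<sigma> z) = z"
        using D(4,5)[OF \<sigma>(1)] z by (auto simp: U_def)
      ultimately show ?thesis by blast
    qed
    ultimately show ?thesis by blast
  qed
  then obtain U where U: "\<And>y. open (U y)" "\<And>y. y \<in> U y" and lift:
    "\<And>y x z. x \<in> topspace X \<Longrightarrow> p x \<in> U y \<Longrightarrow> z \<in> U y \<Longrightarrow>
      \<exists>x'\<in>topspace X. p x' = z \<and> (\<forall>F\<in>FF. \<bar>F x - F x'\<bar> < \<epsilon>)"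
    by metis
  obtain N where N: "open N" "0 \<in> N" "\<And>y. \<exists>z. \<forall>g\<in>N. y + g \<in> U z"
    using compact_group_lebesgue[of U, OF compact_base U] by metis
  show thesis
  proof (rule that[OF N(1,2)])
    fix x g assume x: "x \<in> topspace X" "g \<in> N"
    obtain z where z: "\<And>g. g \<in> N \<Longrightarrow> p x + g \<in> U z" using N(3) by blast
    show "\<exists>x'\<in>topspace X. p x' = p x + g \<and> (\<forall>F\<in>FF. \<bar>F x - F x'\<bar> < \<epsilon>)"
      using lift[OF x(1) _ z[OF x(2)]] z[OF N(2)] by simp
  qed
qed

end

section \<open>Lifting small translations\<close>

lemma continuous_map_epsilon:
  fixes f :: "'x \<Rightarrow> 'b::metric_space"
  assumes "\<And>x e. x \<in> topspace X \<Longrightarrow> e > 0 \<Longrightarrow> \<exists>U. openin X U \<and> x \<in> U \<and> (\<forall>z\<in>U. dist (f z) (f x) < e)"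
  shows "continuous_map X euclidean f"
  unfolding continuous_map_eq_topcontinuous_at topcontinuous_at_def
proof (intro ballI conjI allI impI)
  fix x V assume x: "x \<in> topspace X" and V: "openin euclidean V \<and> f x \<in> V"
  then obtain e where e: "e > 0" "ball (f x) e \<subseteq> V"
    by (metis open_contains_ball open_openin)
  obtain U where "openin X U" "x \<in> U" "\<forall>z\<in>U. dist (f z) (f x) < e"
    using assms[OF x e(1)] by blast
  then show "\<exists>U. openin X U \<and> x \<in> U \<and> (\<forall>y\<in>U. f y \<in> V)"
    using e(2) by (auto simp: subset_iff dist_commute)
qed auto

text \<open>Four displacements of size 1/8 add up to 1/2, the distance at which \<open>FF\<close>
  separates the points of a fibre; four are met when two lifted translations are commuted. The
  symmetry of \<open>N\<close> makes them invertible.\<close>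

locale local_action = compact_group_cover X p
  for X :: "'x topology" and p :: "'x \<Rightarrow> 'g::{topological_ab_group_add, t2_space}" +
  fixes FF :: "('x \<Rightarrow> real) set" and N :: "'g set"
  assumes finite_FF: "finite FF"
    and cont_FF: "F \<in> FF \<Longrightarrow> continuous_map X euclideanreal F"
    and sep_FF: "x \<in> topspace X \<Longrightarrow> x' \<in> topspace X \<Longrightarrow> p x = p x' \<Longrightarrow> x \<noteq> x' \<Longrightarrow>
      \<exists>F\<in>FF. \<bar>F x - F x'\<bar> \<ge> 1 / 2"
    and open_N: "open N" and zero_N: "0 \<in> N" and uminus_N: "g \<in> N \<Longrightarrow> - g \<in> N"
    and lift_N: "x \<in> topspace X \<Longrightarrow> g \<in> N \<Longrightarrow>
      \<exists>x'\<in>topspace X. p x' = p x + g \<and> (\<forall>F\<in>FF. \<bar>F x - F x'\<bar> < 1 / 8)"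
begin

definition near :: "real \<Rightarrow> 'x \<Rightarrow> 'x \<Rightarrow> bool" where
  "near \<epsilon> x x' \<longleftrightarrow> (\<forall>F\<in>FF. \<bar>F x - F x'\<bar> < \<epsilon>)"

lemma near_sym: "near \<epsilon> x x' \<Longrightarrow> near \<epsilon> x' x"
  by (simp add: near_def abs_minus_commute)

lemma near_trans:
  assumes "near \<epsilon> x x'" "near \<delta> x' x''" shows "near (\<epsilon> + \<delta>) x x''"
  unfolding near_def
proof
  fix F assume "F \<in> FF"
  then have "\<bar>F x - F x'\<bar> < \<epsilon>" "\<bar>F x' - F x''\<bar> < \<delta>" using assms by (auto simp: near_def)
  then show "\<bar>F x - F x''\<bar> < \<epsilon> + \<delta>" by linarith
qed

lemma near_mono: "near \<epsilon> x x' \<Longrightarrow> \<epsilon> \<le> \<delta> \<Longrightarrow> near \<delta> x x'"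
  by (force simp: near_def)

lemma near_unique:
  "x \<in> topspace X \<Longrightarrow> x' \<in> topspace X \<Longrightarrow> p x = p x' \<Longrightarrow> near (1 / 2) x x' \<Longrightarrow> x = x'"
  using sep_FF[of x x'] unfolding near_def by (meson not_le)

text \<open>Outside \<open>N\<close> or off the space, \<open>T g\<close> is the identity, so that
  these maps commute on the whole type, as folding over multisets requires.\<close>

definition T :: "'g \<Rightarrow> 'x \<Rightarrow> 'x" where
  "T g x = (if g \<in> N \<and> x \<in> topspace X
     then SOME x'. x' \<in> topspace X \<and> p x' = p x + g \<and> near (1 / 8) x x' else x)"

lemma T_trivial: "x \<notin> topspace X \<Longrightarrow> T g x = x" "g \<notin> N \<Longrightarrow> T g x = x"
  by (auto simp: T_def)

lemma T_lift:
  assumes "x \<in> topspace X" "g \<in> N"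
  shows "T g x \<in> topspace X" "p (T g x) = p x + g" "near (1 / 8) x (T g x)"
proof -
  have "\<exists>x'. x' \<in> topspace X \<and> p x' = p x + g \<and> near (1 / 8) x x'"
    using lift_N[OF assms] unfolding near_def by blast
  from someI_ex[OF this]
  show "T g x \<in> topspace X" "p (T g x) = p x + g" "near (1 / 8) x (T g x)"
    using assms by (auto simp: T_def)
qed

lemma T_in_topspace: "x \<in> topspace X \<Longrightarrow> T g x \<in> topspace X"
  using T_lift(1) T_trivial(2) by (cases "g \<in> N") auto

text \<open>Of the distance 1/2 below which points of a fibre coincide, \<open>T g x\<close> uses up
  1/8; this leaves 3/8 for \<open>x'\<close>.\<close>

lemma T_eqI:
  assumes "x \<in> topspace X" "g \<in> N" "x' \<in> topspace X" "p x' = p x + g" "near (3 / 8) x x'"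
  shows "T g x = x'"
proof (rule near_unique)
  have "near (1 / 8 + 3 / 8) (T g x) x'"
    by (rule near_trans[OF near_sym[OF T_lift(3)] assms(5)]) (use assms in auto)
  then show "near (1 / 2) (T g x) x'" by simp
qed (use assms T_lift in auto)

text \<open>Both composites lie over the same point, the base being abelian, and each is within 1/4
  of \<open>x\<close>, so they are too close to differ.\<close>

lemma T_commute: "T g (T h x) = T h (T g x)"
proof (cases "x \<in> topspace X \<and> g \<in> N \<and> h \<in> N")
  case True
  have two: "near (1 / 8 + 1 / 8) x (T g (T h x))" if "g \<in> N" "h \<in> N" for g h
    using that True by (intro near_trans[OF T_lift(3) T_lift(3)] T_lift(1)) auto
  have "near (1 / 8 + 1 / 8 + (1 / 8 + 1 / 8)) (T g (T h x)) (T h (T g x))"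
    using True by (intro near_trans[OF near_sym[OF two] two]) auto
  then show ?thesis
    using True T_lift by (intro near_unique) (auto simp: ac_simps)
qed (auto simp: T_trivial T_in_topspace)

lemma T_inverse:
  assumes x: "x \<in> topspace X" shows "T (- g) (T g x) = x"
proof (cases "g \<in> N")
  case True
  have "near (3 / 8) (T g x) x"
    by (rule near_mono[OF near_sym[OF T_lift(3)[OF x True]]]) simp
  then show ?thesis
    using True x T_lift uminus_N by (intro T_eqI) auto
next
  case False
  then have "- g \<notin> N" using uminus_N[of "- g"] by auto
  then show ?thesis using False by (simp add: T_trivial)
qed

sublocale T: comp_fun_commute T
  by standard (simp add: fun_eq_iff T_commute)

text \<open>Multisets are the free commutative monoid on the elements of the base and carry the
  invariant mean. Inverses act through \<open>image_mset uminus\<close>; they cancel in the action,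
  not in the monoid.\<close>

definition act :: "'g multiset \<Rightarrow> 'x \<Rightarrow> 'x" where
  "act M x = fold_mset T x M"

lemma act_simps [simp]: "act {#} x = x" "act (add_mset g M) x = T g (act M x)"
  by (simp_all add: act_def)

lemma act_T: "act M (T g x) = T g (act M x)"
  by (simp add: act_def T.fold_mset_fun_left_comm)

lemma act_union: "act (M + M') x = act M (act M' x)"
  by (induction M) simp_all

lemma act_zero [simp]: "act 0 x = x"
  by (simp add: act_def)

lemma act_in_topspace: "x \<in> topspace X \<Longrightarrow> act M x \<in> topspace X"
  by (induction M) (simp_all add: T_in_topspace)

lemma act_uminus: "x \<in> topspace X \<Longrightarrow> act (image_mset uminus M) (act M x) = x"
  by (induction M) (simp_all add: act_T[symmetric] T_inverse act_in_topspace)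

definition disp :: "'g multiset \<Rightarrow> 'g" where
  "disp M = (\<Sum>g\<in>#M. if g \<in> N then g else 0)"

lemma p_act: "x \<in> topspace X \<Longrightarrow> p (act M x) = p x + disp M"
  by (induction M) (auto simp: disp_def T_lift(2) act_in_topspace T_trivial ac_simps)

lemma disp_uminus: "disp (image_mset uminus M) = - disp M"
  using uminus_N[of "- g" for g] by (induction M) (auto simp: disp_def dest: uminus_N)

lemma act_fiber_bij: "bij_betw (act M) (fiber y) (fiber (y + disp M))"
proof (rule bij_betwI[where g = "act (image_mset uminus M)"])
  show "act (image_mset uminus M) (act M x) = x" if "x \<in> fiber y" for x
    using that by (intro act_uminus) (simp add: fiber_def)
  show "act M (act (image_mset uminus M) x) = x" if "x \<in> fiber (y + disp M)" for x
    using act_uminus[of x "image_mset uminus M"] that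
    by (simp add: fiber_def image_mset.compositionality o_def)
qed (auto simp: fiber_def p_act act_in_topspace disp_uminus)

lemma open_near_neighbourhood:
  assumes x: "x \<in> topspace X" and V: "open V" "0 \<in> V" and \<epsilon>: "\<epsilon> > 0"
  shows "openin X {z \<in> topspace X. p z - p x \<in> V \<and> near \<epsilon> x z}"
    "x \<in> {z \<in> topspace X. p z - p x \<in> V \<and> near \<epsilon> x z}"
proof -
  have "open ((\<lambda>y. y - p x) -` V)"
    using V(1) by (intro open_vimage continuous_intros)
  then have 1: "openin X {z \<in> topspace X. p z - p x \<in> V}"
    using open_preimage by force
  have 2: "openin X {z \<in> topspace X. \<bar>F x - F z\<bar> < \<epsilon>}" if "F \<in> FF" for F
  proof -
    have "openin X {z \<in> topspace X. F z \<in> V}" if "open V" for V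
      using cont_FF[OF \<open>F \<in> FF\<close>] that by (simp add: continuous_map_def)
    from this[OF open_ball, of "F x" \<epsilon>] show ?thesis by (simp add: dist_real_def)
  qed
  have "openin X ({z \<in> topspace X. p z - p x \<in> V} \<inter> \<Inter>((\<lambda>F. {z \<in> topspace X. \<bar>F x - F z\<bar> < \<epsilon>}) ` FF))"
    by (intro openin_Int_Inter 1) (use finite_FF 2 in auto)
  then show "openin X {z \<in> topspace X. p z - p x \<in> V \<and> near \<epsilon> x z}"
    by (rule back_subst[of "openin X"]) (auto simp: near_def)
  show "x \<in> {z \<in> topspace X. p z - p x \<in> V \<and> near \<epsilon> x z}"
    using x V(2) \<epsilon> by (simp add: near_def)
qed

lemma near_eq_T:
  assumes "x \<in> topspace X" "z \<in> topspace X" "p z - p x \<in> N" "near (1 / 8) x z"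
  shows "z = T (p z - p x) x"
  using assms by (intro T_eqI[symmetric] near_mono[OF assms(4)]) auto

text \<open>A smaller tolerance gives a smaller neighbourhood, but the lift found there is still
  \<open>T g x\<close> by \<open>T_eqI\<close>; hence the cap 3/8 in
  \<open>\<delta>\<close>.\<close>

lemma T_near:
  assumes "\<epsilon> > 0"
  obtains V where "open V" "0 \<in> V" "V \<subseteq> N" "\<And>x g. x \<in> topspace X \<Longrightarrow> g \<in> V \<Longrightarrow> near \<epsilon> x (T g x)"
proof -
  define \<delta> where "\<delta> = min \<epsilon> (3 / 8)"
  obtain V where V: "open V" "0 \<in> V"
    "\<And>x g. x \<in> topspace X \<Longrightarrow> g \<in> V \<Longrightarrow> \<exists>x'\<in>topspace X. p x' = p x + g \<and> (\<forall>F\<in>FF. \<bar>F x - F x'\<bar> < \<delta>)"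
    using uniform_lift[OF finite_FF cont_FF, of \<delta>] assms by (auto simp: \<delta>_def)
  show thesis
  proof (rule that[of "V \<inter> N"])
    fix x g assume x: "x \<in> topspace X" "g \<in> V \<inter> N"
    obtain x' where x': "x' \<in> topspace X" "p x' = p x + g" "near \<delta> x x'"
      using V(3)[of x g] x unfolding near_def by auto
    then have "T g x = x'"
      using x by (intro T_eqI near_mono[OF x'(3)]) (auto simp: \<delta>_def)
    then show "near \<epsilon> x (T g x)"
      using x' near_mono[OF x'(3)] by (simp add: \<delta>_def)
  qed (use V open_N zero_N in auto)
qed

text \<open>One lifted translation reaches every point near a given one, so orbits are open.
  Inverses make the complement of an orbit a union of orbits, and connectedness leaves only
  one.\<close>

lemma act_transitive:
  assumes "connected_space X" "e \<in> topspace X" "x \<in> topspace X"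
  shows "\<exists>M. act M e = x"
proof -
  let ?O = "\<lambda>x. {z. \<exists>M. act M x = z}"
  have op: "openin X (?O x)" if x: "x \<in> topspace X" for x
  proof (subst openin_subopen, intro ballI)
    fix z assume "z \<in> ?O x"
    then obtain M where M: "act M x = z" by blast
    have z: "z \<in> topspace X" using M x act_in_topspace by auto
    have "{w \<in> topspace X. p w - p z \<in> N \<and> near (1 / 8) z w} \<subseteq> ?O x"
    proof
      fix w assume "w \<in> {w \<in> topspace X. p w - p z \<in> N \<and> near (1 / 8) z w}"
      then have "w = T (p w - p z) z" using z by (intro near_eq_T) auto
      also have "\<dots> = act (add_mset (p w - p z) M) x" by (simp add: M)
      finally show "w \<in> ?O x" by (metis (mono_tags, lifting) mem_Collect_eq)
    qed
    then show "\<exists>U. openin X U \<and> z \<in> U \<and> U \<subseteq> ?O x"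
      using open_near_neighbourhood[OF z open_N zero_N, of "1 / 8"]
      by (intro exI[of _ "{w \<in> topspace X. p w - p z \<in> N \<and> near (1 / 8) z w}"] conjI) simp_all
  qed
  have "topspace X - ?O e = (\<Union>x\<in>topspace X - ?O e. ?O x)"
  proof (intro equalityI subsetI)
    fix z assume "z \<in> topspace X - ?O e"
    moreover have "z \<in> ?O z" using act_simps(1) by blast
    ultimately show "z \<in> (\<Union>x\<in>topspace X - ?O e. ?O x)" by blast
  next
    fix z assume "z \<in> (\<Union>x\<in>topspace X - ?O e. ?O x)"
    then obtain x M where x: "x \<in> topspace X" "x \<notin> ?O e" "act M x = z" by blast
    have "z \<notin> ?O e"
    proof
      assume "z \<in> ?O e"
      then obtain M' where "act M' e = z" by blast
      then have "act (image_mset uminus M + M') e = x"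
        using act_uminus[OF x(1), of M] x(3) by (simp add: act_union)
      then show False using x(2) by blast
    qed
    then show "z \<in> topspace X - ?O e" using x act_in_topspace by auto
  qed
  then have "openin X (topspace X - ?O e)"
    using op by (metis (no_types, lifting) DiffD1 imageE openin_Union)
  then have "closedin X (?O e)"
    using op[OF assms(2)] by (simp add: closedin_def openin_subset)
  moreover have "e \<in> ?O e" using act_simps(1) by blast
  ultimately have "?O e = topspace X"
    using op[OF assms(2)] assms(1) unfolding connected_space_clopen_in by blast
  then show ?thesis using assms(3) by blast
qed


text \<open>Along the orbit of \<open>e\<close>, the function \<open>f\<close> becomes a function
  \<open>h\<close> on the monoid. Compactness of the base makes \<open>h\<close> almost periodic,
  and the estimate on linear combinations makes \<kappa> depend only on the point reached.\<close>

lemma character_of_action: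
  assumes conn: "connected_space X" and f: "f \<in> FF" "\<And>x. x \<in> topspace X \<Longrightarrow> \<bar>f x\<bar> \<le> 1"
    and e: "e \<in> topspace X" "f e \<noteq> 0"
  obtains \<psi> :: "'x \<Rightarrow> complex" and \<kappa> where "continuous_map X euclidean \<psi>" "\<psi> e = 1"
    "\<And>x M. x \<in> topspace X \<Longrightarrow> \<psi> (act M x) = \<kappa> M * \<psi> x"
    "\<And>M. cmod (\<kappa> M) = 1" "\<And>M M'. \<kappa> (M + M') = \<kappa> M * \<kappa> M'"
    "(\<And>y. (\<Sum>x\<in>fiber y. f x) = 0) \<Longrightarrow> (\<Sum>x\<in>fiber (p e). \<psi> x) = 0"
proof -
  define h where "h M = complex_of_real (f (act M e))" for M
  define mm where "mm x = (SOME M. act M e = x)" for x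
  have mm: "act (mm x) e = x" if "x \<in> topspace X" for x
    using someI_ex[OF act_transitive[OF conn e(1) that]] by (simp add: mm_def)
  have ap: "\<exists>A. finite A \<and> (\<forall>s. \<exists>a\<in>A. \<forall>t. cmod (h (s + a + t) - h t) \<le> \<epsilon>)" if \<epsilon>: "\<epsilon> > 0" for \<epsilon>
  proof -
    obtain V where V: "open V" "0 \<in> V" "V \<subseteq> N" "\<And>x g. x \<in> topspace X \<Longrightarrow> g \<in> V \<Longrightarrow> near \<epsilon> x (T g x)"
      using T_near[OF \<epsilon>] by blast
    have "open ((\<lambda>z. z - y) -` V)" for y
      using V(1) by (intro open_vimage continuous_intros)
    then obtain Y where Y: "finite Y" "\<And>z. \<exists>y\<in>Y. z \<in> (\<lambda>z. z - y) -` V"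
      using compact_UNIV_subcover[OF compact_base, of "\<lambda>y. (\<lambda>z. z - y) -` V"] V(2) by auto
    \<comment> \<open>For the points \<open>x\<close> over a finite \<open>V\<close>-net of the
      base, the correction undoes the multiset \<open>mm x\<close> leading from \<open>e\<close> to
      \<open>x\<close>. An arbitrary \<open>s\<close> leads to a point one small \<open>T g\<close>
      away from such an \<open>x\<close>, so after the correction only \<open>T g\<close>
      remains.\<close>
    define A where "A = (\<lambda>x. image_mset uminus (mm x)) ` (\<Union>y\<in>Y. fiber y)"
    have "\<exists>a\<in>A. \<forall>t. cmod (h (s + a + t) - h t) \<le> \<epsilon>" for s
    proof -
      define z where "z = act s e"
      have z: "z \<in> topspace X" by (simp add: z_def act_in_topspace e)
      obtain y where y: "y \<in> Y" "p z - y \<in> V" using Y(2)[of "p z"] by auto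
      define g where "g = p z - y"
      define x where "x = T (- g) z"
      have g: "g \<in> V" "g \<in> N" using y V(3) by (auto simp: g_def)
      have x: "x \<in> topspace X" "p x = y"
        using T_lift[OF z uminus_N[OF g(2)]] by (auto simp: x_def g_def)
      have Tx: "T g x = z"
        using T_inverse[OF z, of "- g"] by (simp add: x_def)
      have "act (s + image_mset uminus (mm x)) e = act (image_mset uminus (mm x)) (T g x)"
        by (subst add.commute) (simp add: act_union Tx z_def)
      also have "\<dots> = T g (act (image_mset uminus (mm x)) (act (mm x) e))"
        using mm[OF x(1)] by (simp add: act_T)
      also have "\<dots> = T g e" using act_uminus[OF e(1)] by simp
      finally have *: "act (t + (s + image_mset uminus (mm x))) e = T g (act t e)" for t
        by (simp add: act_union act_T)
      have "cmod (h (s + image_mset uminus (mm x) + t) - h t) \<le> \<epsilon>" for t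
      proof -
        have "near \<epsilon> (act t e) (T g (act t e))"
          using V(4) g act_in_topspace e by blast
        then have "\<bar>f (T g (act t e)) - f (act t e)\<bar> \<le> \<epsilon>"
          using f(1) by (auto simp: near_def abs_minus_commute less_imp_le)
        moreover have "h (s + image_mset uminus (mm x) + t) - h t = of_real (f (T g (act t e)) - f (act t e))"
          using *[of t] by (simp add: h_def add.commute)
        ultimately show ?thesis by (simp only: norm_of_real)
      qed
      moreover have "image_mset uminus (mm x) \<in> A"
        using x y by (auto simp: A_def fiber_def)
      ultimately show ?thesis by blast
    qed
    moreover have "finite A" using Y(1) finite_fiber by (simp add: A_def)
    ultimately show ?thesis by blast
  qed
  obtain \<kappa> C where \<kappa>: "\<And>s t. \<kappa> (s + t) = \<kappa> s * \<kappa> t" "\<And>s. cmod (\<kappa> s) = 1"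
    and bound: "\<And>I \<alpha> \<omega>. (\<And>t. cmod (\<Sum>s\<in>I. \<alpha> s * h (s + t)) \<le> \<omega>) \<Longrightarrow> cmod (\<Sum>s\<in>I. \<alpha> s * \<kappa> s) \<le> C * \<omega>"
  proof (rule character_of_almost_periodic[of h])
    show "cmod (h s) \<le> 1" for s using f(2) act_in_topspace e(1) by (simp add: h_def)
    show "h 0 \<noteq> 0" using e by (simp add: h_def)
  qed (use ap in blast)+
  have C: "C \<ge> 0"
    using bound[where I = "{}" and \<omega> = 1] by simp
  \<comment> \<open>Coefficients 1 and -1 at two elements turn the bound into a Lipschitz estimate.
    With \<open>\<omega> = 0\<close> it shows that \<kappa> descends to \<open>X\<close>.\<close>
  have lip: "cmod (\<kappa> s - \<kappa> s') \<le> C * \<omega>" if "\<And>t. cmod (h (s + t) - h (s' + t)) \<le> \<omega>" for s s' \<omega>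
  proof (cases "s = s'")
    case True
    have "\<omega> \<ge> 0" using that[of 0] norm_ge_zero order_trans by blast
    then show ?thesis using True C by simp
  next
    case False
    then show ?thesis
      using bound[where I = "{s, s'}" and \<alpha> = "\<lambda>r. if r = s then 1 else - 1" and \<omega> = \<omega>] that by auto
  qed
  have \<kappa>0: "\<kappa> 0 = 1"
  proof -
    have "\<kappa> 0 \<noteq> 0" using \<kappa>(2)[of 0] by auto
    then show ?thesis using \<kappa>(1)[of 0 0] by simp
  qed
  define \<psi> where "\<psi> x = \<kappa> (mm x)" for x
  have \<psi>: "\<psi> x = \<kappa> M" if "act M e = x" "x \<in> topspace X" for x M
  proof -
    have "cmod (\<kappa> (mm x) - \<kappa> M) \<le> C * 0"
    proof (rule lip)
      fix t
      have "act (mm x + t) e = act (M + t) e"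
        using that mm[OF that(2)] by (metis act_union add.commute)
      then show "cmod (h (mm x + t) - h (M + t)) \<le> 0" by (simp add: h_def)
    qed
    then show ?thesis by (simp add: \<psi>_def)
  qed
  show thesis
  proof (rule that[of \<psi> \<kappa>])
    show "\<psi> e = 1" using \<psi>[of 0 e] e \<kappa>0 by simp
    show "\<psi> (act M x) = \<kappa> M * \<psi> x" if x: "x \<in> topspace X" for x M
      using \<psi>[of "M + mm x" "act M x"] \<psi>[of "mm x" x] mm[OF x] x
      by (simp add: act_union act_in_topspace \<kappa>(1))
    show "continuous_map X euclidean \<psi>"
    proof (rule continuous_map_epsilon)
      fix x \<epsilon> assume x: "x \<in> topspace X" and \<epsilon>: "(\<epsilon>::real) > 0"
      define \<delta> where "\<delta> = \<epsilon> / (C + 1)"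
      have \<delta>: "\<delta> > 0" "C * \<delta> < \<epsilon>" using \<epsilon> C by (auto simp: \<delta>_def field_simps)
      obtain V where V: "open V" "0 \<in> V" "V \<subseteq> N" "\<And>x g. x \<in> topspace X \<Longrightarrow> g \<in> V \<Longrightarrow> near \<delta> x (T g x)"
        using T_near[OF \<delta>(1)] by blast
      let ?U = "{z \<in> topspace X. p z - p x \<in> V \<and> near (1 / 8) x z}"
      have "dist (\<psi> z) (\<psi> x) < \<epsilon>" if "z \<in> ?U" for z
      proof -
        define g where "g = p z - p x"
        have g: "g \<in> V" "z = T g x" "z \<in> topspace X"
          using that V(3) near_eq_T[OF x] by (auto simp: g_def)
        have "\<psi> z = \<kappa> (add_mset g (mm x))"
          using g(3) mm[OF x] by (intro \<psi>) (simp_all add: g(2))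
        moreover have "cmod (\<kappa> (add_mset g (mm x)) - \<kappa> (mm x)) \<le> C * \<delta>"
        proof (rule lip)
          fix t
          have "near \<delta> (act (mm x + t) e) (T g (act (mm x + t) e))"
            using V(4) g(1) e act_in_topspace by blast
          then have "\<bar>f (T g (act (mm x + t) e)) - f (act (mm x + t) e)\<bar> \<le> \<delta>"
            using f(1) by (auto simp: near_def abs_minus_commute less_imp_le)
          moreover have "h (add_mset g (mm x) + t) - h (mm x + t)
              = of_real (f (T g (act (mm x + t) e)) - f (act (mm x + t) e))"
            by (simp add: h_def)
          ultimately show "cmod (h (add_mset g (mm x) + t) - h (mm x + t)) \<le> \<delta>"
            by (simp only: norm_of_real)
        qed
        ultimately show ?thesis using \<delta>(2) by (simp add: dist_norm \<psi>_def)
      qed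
      then show "\<exists>U. openin X U \<and> x \<in> U \<and> (\<forall>z\<in>U. dist (\<psi> z) (\<psi> x) < \<epsilon>)"
        using open_near_neighbourhood[OF x V(1,2), of "1 / 8"] by (intro exI[of _ ?U]) auto
    qed
    assume zero: "\<And>y. (\<Sum>x\<in>fiber y. f x) = 0"
    have inj: "inj_on mm (fiber (p e))"
      using mm by (intro inj_onI) (metis (mono_tags, lifting) fiber_def mem_Collect_eq)
    \<comment> \<open>Acting by \<open>t\<close> carries the fibre over \<open>p e\<close>
      bijectively onto another fibre, so the vanishing fibre sums of \<open>f\<close> give the bound
      0 for coefficients 1.\<close>
    have "cmod (\<Sum>s\<in>mm ` fiber (p e). 1 * \<kappa> s) \<le> C * 0"
    proof (rule bound)
      fix t
      have "(\<Sum>s\<in>mm ` fiber (p e). 1 * h (s + t)) = (\<Sum>x\<in>fiber (p e). of_real (f (act t x)))"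
        using mm by (subst sum.reindex[OF inj])
          (auto simp: h_def act_union[of t] add.commute[of _ t] fiber_def intro!: sum.cong)
      also have "\<dots> = of_real (\<Sum>x\<in>fiber (p e + disp t). f x)"
        unfolding of_real_sum
        by (rule sum.reindex_bij_betw[OF act_fiber_bij])
      finally show "cmod (\<Sum>s\<in>mm ` fiber (p e). 1 * h (s + t)) \<le> 0"
        using zero by simp
    qed
    then have "(\<Sum>s\<in>mm ` fiber (p e). \<kappa> s) = 0" by simp
    then show "(\<Sum>x\<in>fiber (p e). \<psi> x) = 0"
      by (subst (asm) sum.reindex[OF inj]) (simp add: \<psi>_def)
  qed (use \<kappa> in auto)
qed

end

section \<open>Divisibility implies triviality\<close>

lemma character_group_pow: "(\<phi> [^]\<^bsub>character_group\<^esub> (n::nat)) x = \<phi> x ^ n"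
proof -
  have "(\<phi> [^]\<^bsub>character_group\<^esub> n) = (\<lambda>x. \<phi> x ^ n)"
    by (induction n) (simp_all add: character_group_def nat_pow_def fun_eq_iff mult.commute)
  then show ?thesis by simp
qed

lemma divisible_by_character_group_iff:
  "divisible_by n (character_group :: ('g::topological_ab_group_add \<Rightarrow> complex) monoid) \<longleftrightarrow>
    (\<forall>\<kappa>\<in>carrier character_group. \<exists>\<phi>\<in>carrier (character_group :: ('g \<Rightarrow> complex) monoid). \<forall>x. \<phi> x ^ n = \<kappa> x)"
proof -
  interpret comm_group "character_group :: ('g \<Rightarrow> complex) monoid"
    by (rule comm_group_character_group)
  have "\<phi> [^]\<^bsub>character_group\<^esub> n = \<kappa> \<longleftrightarrow> (\<forall>x. \<phi> x ^ n = \<kappa> x)" for \<phi> \<kappa> :: "'g \<Rightarrow> complex"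
    by (simp add: fun_eq_iff character_group_pow)
  moreover have "divisible_by n (character_group :: ('g \<Rightarrow> complex) monoid) \<longleftrightarrow>
    (\<forall>\<kappa>\<in>carrier character_group. \<exists>\<phi>\<in>carrier (character_group :: ('g \<Rightarrow> complex) monoid). \<phi> [^]\<^bsub>character_group\<^esub> n = \<kappa>)"
    unfolding divisible_by_def by (auto simp: image_iff set_eq_iff) metis+
  ultimately show ?thesis by simp
qed

lemma divisible_by_dvd:
  assumes "divisible_by n (character_group :: ('g::topological_ab_group_add \<Rightarrow> complex) monoid)" "m dvd n"
  shows "divisible_by m (character_group :: ('g \<Rightarrow> complex) monoid)"
  unfolding divisible_by_character_group_iff
proof
  interpret comm_group "character_group :: ('g \<Rightarrow> complex) monoid"
    by (rule comm_group_character_group)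
  fix \<kappa> :: "'g \<Rightarrow> complex" assume "\<kappa> \<in> carrier character_group"
  then obtain \<phi> :: "'g \<Rightarrow> complex" where \<phi>: "\<phi> \<in> carrier character_group" "\<And>x. \<phi> x ^ n = \<kappa> x"
    using assms(1) unfolding divisible_by_character_group_iff by blast
  obtain l where "n = l * m" using assms(2) by (metis dvd_def mult.commute)
  then show "\<exists>\<phi>\<in>carrier (character_group :: ('g \<Rightarrow> complex) monoid). \<forall>x. \<phi> x ^ m = \<kappa> x"
    using \<phi> by (intro bexI[of _ "\<phi> [^]\<^bsub>character_group\<^esub> l"]) (auto simp: character_group_pow power_mult)
qed

lemma divisible_by_mult:
  assumes "divisible_by m (character_group :: ('g::topological_ab_group_add \<Rightarrow> complex) monoid)"
    "divisible_by n (character_group :: ('g \<Rightarrow> complex) monoid)"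
  shows "divisible_by (m * n) (character_group :: ('g \<Rightarrow> complex) monoid)"
  using assms unfolding divisible_by_character_group_iff by (metis power_mult)

lemma connected_roots_of_unity_valued:
  fixes h :: "'x \<Rightarrow> complex"
  assumes "connected_space X" "continuous_map X euclidean h" "n > 0"
    "\<And>x. x \<in> topspace X \<Longrightarrow> h x ^ n = 1" "x \<in> topspace X" "y \<in> topspace X"
  shows "h x = h y"
proof -
  have "connectedin X (topspace X)" using assms(1) by (simp add: connectedin_topspace)
  then have "connected (h ` topspace X)"
    using connectedin_continuous_map_image[OF assms(2)] by simp
  moreover have "finite (h ` topspace X)"
    using finite_roots_unity[of n] assms(3,4)
    by (intro finite_subset[of "h ` topspace X" "{z. z ^ n = 1}"]) auto
  ultimately obtain c where "h ` topspace X \<subseteq> {c}"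
    using connected_finite_iff_sing by (metis subset_refl empty_subsetI)
  then show ?thesis using assms(5,6) by auto
qed

context compact_group_cover
begin

text \<open>Weights 1 and -1 are put on two different sheets and 0 on all others; this is where a
  second sheet enters.\<close>

lemma balanced_bump:
  assumes "card (fiber y) \<ge> 2"
  obtains f e where "continuous_map X euclideanreal f" "\<And>x. x \<in> topspace X \<Longrightarrow> \<bar>f x\<bar> \<le> 1"
    "e \<in> fiber y" "f e \<noteq> 0" "\<And>z. (\<Sum>x\<in>fiber z. f x) = 0"
proof -
  obtain W S where W: "y \<in> W" "local_sections X p W S" using loc by blast
  note D = local_sectionsD[OF W(2)]
  obtain b K where b: "continuous_on UNIV b" "closed K" "K \<subseteq> W" "\<And>z. z \<notin> K \<Longrightarrow> b z = (0::real)" "b y = 1"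
    "\<And>z. 0 \<le> b z" "\<And>z. b z \<le> 1"
    using compact_t2_bump[OF compact_base D(1) W(1)] by metis
  have "card S \<ge> 2" using card_fiber[OF W(2,1)] assms by simp
  then obtain S' where "S' \<subseteq> S" "card S' = 2" by (meson obtain_subset_with_card_n)
  then obtain \<sigma> \<tau> where \<sigma>: "\<sigma> \<in> S" "\<tau> \<in> S" "\<sigma> \<noteq> \<tau>" by (auto simp: card_2_iff)
  define w where "w = (\<lambda>\<rho>. (if \<rho> = \<sigma> then 1 else 0) - (if \<rho> = \<tau> then 1 else 0 :: real))"
  obtain f where f: "continuous_map X euclideanreal f"
    "\<And>\<sigma> z. \<sigma> \<in> S \<Longrightarrow> z \<in> W \<Longrightarrow> f (\<sigma> z) = w \<sigma> * b z" "\<And>x. p x \<notin> W \<Longrightarrow> f x = 0"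
    using bump_function[OF W(2) b(1-4), of w] by blast
  show thesis
  proof (rule that[of f "\<sigma> y"])
    show "\<bar>f x\<bar> \<le> 1" if x: "x \<in> topspace X" for x
    proof (cases "p x \<in> W")
      case True
      obtain \<rho> where "\<rho> \<in> S" "\<rho> (p x) = x" using D(7)[OF x True] by blast
      then have "f x = w \<rho> * b (p x)" using f(2)[of \<rho> "p x"] True by simp
      then show ?thesis using b(6,7) \<sigma>(3) by (auto simp: w_def)
    qed (simp add: f(3))
    show "\<sigma> y \<in> fiber y"
      using D(4,5) \<sigma>(1) W(1) by (simp add: fiber_def)
    show "f (\<sigma> y) \<noteq> 0"
      using f(2) \<sigma> W(1) b(5) by (simp add: w_def)
    show "(\<Sum>x\<in>fiber z. f x) = 0" for z
    proof (cases "z \<in> W")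
      case True
      have "(\<Sum>x\<in>fiber z. f x) = (\<Sum>\<rho>\<in>S. w \<rho> * b z)"
        unfolding fiber_eq_sections(1)[OF W(2) True]
        using f(2) True by (subst sum.reindex[OF fiber_eq_sections(2)[OF W(2) True]]) simp
      also have "\<dots> = (\<Sum>\<rho>\<in>S. w \<rho>) * b z" by (simp add: sum_distrib_right)
      also have "(\<Sum>\<rho>\<in>S. w \<rho>) = 0"
        unfolding w_def using \<sigma> D(2) by (simp add: sum_subtractf)
      finally show ?thesis by simp
    qed (auto simp: fiber_def f(3) intro: sum.neutral)
  qed (rule f(1))
qed

text \<open>Divisibility is asked only for the exact degree, so that the theorem applies to a clopen
  piece of any degree up to that of the whole covering.\<close>

theorem connected_cover_one_sheet:
  assumes conn: "connected_space X" and base: "connected (UNIV :: 'g set)"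
    and div: "card (fiber 0) > 0 \<Longrightarrow> divisible_by (card (fiber 0)) (character_group :: ('g \<Rightarrow> complex) monoid)"
  shows "card (fiber 0) \<le> 1"
proof (rule ccontr)
  assume "\<not> card (fiber 0) \<le> 1"
  define j where "j = card (fiber 0)"
  have j: "j \<ge> 2" using \<open>\<not> card (fiber 0) \<le> 1\<close> by (simp add: j_def)
  obtain f e where f: "continuous_map X euclideanreal f" "\<And>x. x \<in> topspace X \<Longrightarrow> \<bar>f x\<bar> \<le> 1"
    "e \<in> fiber 0" "f e \<noteq> 0" "\<And>z. (\<Sum>x\<in>fiber z. f x) = 0"
    using balanced_bump[of 0] j unfolding j_def by blast
  have e: "e \<in> topspace X" "p e = 0" using f(3) by (auto simp: fiber_def)
  obtain F0 :: "('x \<Rightarrow> real) set" where F0: "finite F0" "\<And>F. F \<in> F0 \<Longrightarrow> continuous_map X euclideanreal F"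
    "\<And>x x'. x \<in> topspace X \<Longrightarrow> x' \<in> topspace X \<Longrightarrow> p x = p x' \<Longrightarrow> x \<noteq> x' \<Longrightarrow>
      \<exists>F\<in>F0. \<bar>F x - F x'\<bar> \<ge> 1 / 2"
    using separating_family by blast
  define FF where "FF = insert f F0"
  have fFF: "f \<in> FF" by (simp add: FF_def)
  have FF: "finite FF" "\<And>F. F \<in> FF \<Longrightarrow> continuous_map X euclideanreal F"
    using F0 f(1) by (auto simp: FF_def)
  obtain N where N: "open N" "0 \<in> N" "\<And>x g. x \<in> topspace X \<Longrightarrow> g \<in> N \<Longrightarrow>
      \<exists>x'\<in>topspace X. p x' = p x + g \<and> (\<forall>F\<in>FF. \<bar>F x - F x'\<bar> < 1 / 8)"
    using uniform_lift[OF FF, of "1 / 8"] by (metis zero_less_divide_1_iff zero_less_numeral)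
  have "open (uminus -` N)"
    using N(1) by (intro open_vimage continuous_intros)
  then interpret local_action X p FF "N \<inter> uminus -` N"
    using FF F0(3) N by unfold_locales (auto simp: FF_def)
  obtain \<psi> :: "'x \<Rightarrow> complex" and \<kappa> where \<psi>: "continuous_map X euclidean \<psi>" "\<psi> e = 1"
    "\<And>x M. x \<in> topspace X \<Longrightarrow> \<psi> (act M x) = \<kappa> M * \<psi> x"
    and \<kappa>: "\<And>M. cmod (\<kappa> M) = 1" "\<And>M M'. \<kappa> (M + M') = \<kappa> M * \<kappa> M'"
    and zero: "(\<Sum>x\<in>fiber (p e). \<psi> x) = 0"
    using character_of_action[OF conn fFF f(2) e(1) f(4)] f(5) by metis
  have act_e: "\<psi> (act M e) = \<kappa> M" for M using \<psi>(2,3) e(1) by simp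
  have trans: "\<exists>M. act M e = x" if "x \<in> topspace X" for x
    using act_transitive[OF conn e(1) that] .
  have cmod_\<psi>: "cmod (\<psi> x) = 1" if "x \<in> topspace X" for x
    using trans[OF that] act_e \<kappa>(1) by metis
  have card_j: "card (fiber y) = j" for y
    unfolding j_def by (rule card_fiber_eq[OF base])
  \<comment> \<open>A multiset \<open>M\<close> joining two points of a fibre has displacement 0 and
    permutes the fibre. Comparing the nonzero product of \<psi> over the fibre with itself gives
    \<open>\<kappa> M ^ j = 1\<close>.\<close>
  have same: "\<psi> x ^ j = \<psi> x' ^ j" if x: "x \<in> topspace X" "x' \<in> topspace X" "p x = p x'" for x x'
  proof -
    obtain M where M: "act M x = x'" using act_transitive[OF conn x(1,2)] by blast
    have "disp M = 0" using p_act[OF x(1), of M] M x(3) by simp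
    then have "bij_betw (act M) (fiber (p x)) (fiber (p x))" using act_fiber_bij[of M "p x"] by simp
    then have "(\<Prod>z\<in>fiber (p x). \<psi> z) = (\<Prod>z\<in>fiber (p x). \<psi> (act M z))"
      by (rule prod.reindex_bij_betw[symmetric])
    also have "\<dots> = (\<Prod>z\<in>fiber (p x). \<kappa> M * \<psi> z)"
      using \<psi>(3) by (intro prod.cong) (auto simp: fiber_def)
    also have "\<dots> = \<kappa> M ^ j * (\<Prod>z\<in>fiber (p x). \<psi> z)"
      by (simp add: prod.distrib card_j)
    finally have "\<kappa> M ^ j * (\<Prod>z\<in>fiber (p x). \<psi> z) = (\<Prod>z\<in>fiber (p x). \<psi> z)" ..
    moreover have "(\<Prod>z\<in>fiber (p x). \<psi> z) \<noteq> 0"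
      using cmod_\<psi> finite_fiber by (force simp: fiber_def)
    ultimately have "\<kappa> M ^ j = 1" by simp
    then show ?thesis using \<psi>(3)[OF x(1), of M] M by (simp add: power_mult_distrib)
  qed
  have "\<exists>x. x \<in> topspace X \<and> p x = y" for y
  proof -
    have "fiber y \<noteq> {}" using card_j[of y] j by auto
    then show ?thesis by (auto simp: fiber_def)
  qed
  \<comment> \<open>The choice \<open>s\<close> need not be continuous. As \<theta> does not depend
    on it, continuity is checked along a local section instead.\<close>
  then obtain s where s: "\<And>y. s y \<in> topspace X" "\<And>y. p (s y) = y" by metis
  define \<theta> where "\<theta> y = \<psi> (s y) ^ j" for y
  have \<theta>: "\<theta> (p x) = \<psi> x ^ j" if "x \<in> topspace X" for x
    unfolding \<theta>_def using that s by (intro same) auto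
  have "\<theta> \<in> carrier character_group"
  proof -
    have "continuous_on UNIV \<theta>"
    proof (subst continuous_on_eq_continuous_at, simp, intro ballI)
      fix y
      obtain W S where W: "y \<in> W" "local_sections X p W S" using loc by blast
      note D = local_sectionsD[OF W(2)]
      obtain \<sigma> where \<sigma>: "\<sigma> \<in> S" using D(7)[of "s y"] s W(1) by auto
      have "continuous_map (top_of_set W) euclidean (\<psi> \<circ> \<sigma>)"
        using D(3)[OF \<sigma>] \<psi>(1) by (rule continuous_map_compose)
      then have "continuous_on W (\<lambda>z. \<psi> (\<sigma> z) ^ j)"
        by (intro continuous_on_power) (simp add: o_def)
      then have "continuous_on W \<theta>"
        by (rule continuous_on_eq) (use \<theta> D(4,5)[OF \<sigma>] in metis)
      then show "continuous (at y) \<theta>"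
        using W(1) D(1) by (simp add: continuous_on_eq_continuous_at)
    qed
    moreover have "\<theta> (y + z) = \<theta> y * \<theta> z" for y z
    proof -
      obtain M M' where M: "act M e = s y" "act M' e = s z" using trans s(1) by metis
      have "y = disp M" using p_act[OF e(1), of M] M s(2) e(2) by simp
      then have "p (act (M + M') e) = y + z"
        unfolding act_union using p_act[OF act_in_topspace[OF e(1)], of M M'] M(2) s(2)[of z]
        by (simp add: add.commute)
      then have "\<theta> (y + z) = \<psi> (act (M + M') e) ^ j"
        using \<theta>[OF act_in_topspace[OF e(1)], of "M + M'"] by simp
      also have "\<dots> = \<psi> (act M e) ^ j * \<psi> (act M' e) ^ j"
        by (simp add: act_e \<kappa>(2) power_mult_distrib)
      finally show ?thesis by (simp add: M \<theta>_def)
    qed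
    moreover have "cmod (\<theta> y) = 1" for y
      using cmod_\<psi>[OF s(1)] by (simp add: \<theta>_def norm_power)
    ultimately show ?thesis by (simp add: character_group_def)
  qed
  moreover have "divisible_by j (character_group :: ('g \<Rightarrow> complex) monoid)"
    using div j by (simp add: j_def)
  ultimately obtain \<phi> :: "'g \<Rightarrow> complex" where \<phi>: "\<phi> \<in> carrier character_group" "\<And>y. \<phi> y ^ j = \<theta> y"
    unfolding divisible_by_character_group_iff by blast
  have \<phi>': "continuous_on UNIV \<phi>" "\<And>y. cmod (\<phi> y) = 1" "\<And>y z. \<phi> (y + z) = \<phi> y * \<phi> z"
    using \<phi>(1) by (auto simp: character_group_def)
  have \<phi>_nz: "\<phi> y \<noteq> 0" for y using \<phi>'(2)[of y] by auto
  have \<phi>0: "\<phi> 0 = 1" using \<phi>'(3)[of 0 0] \<phi>_nz[of 0] by simp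
  define h where "h x = \<psi> x * inverse (\<phi> (p x))" for x
  have h_root: "h x ^ j = 1" if "x \<in> topspace X" for x
  proof -
    have "\<psi> x \<noteq> 0" using cmod_\<psi>[OF that] by auto
    then show ?thesis
      using \<theta>[OF that] \<phi>(2)[of "p x"] by (simp add: h_def power_mult_distrib power_inverse)
  qed
  have h_cont: "continuous_map X euclidean h"
  proof -
    have "continuous_map X euclidean ((\<lambda>y. inverse (\<phi> y)) \<circ> p)"
      using \<phi>'(1) \<phi>_nz by (intro continuous_map_compose[OF cont]) (auto intro: continuous_on_inverse)
    then have "continuous_map X (prod_topology euclidean euclidean) (\<lambda>x. (\<psi> x, inverse (\<phi> (p x))))"
      using \<psi>(1) by (intro continuous_map_pairedI) (simp_all add: o_def)
    moreover have "continuous_map euclidean euclidean (\<lambda>z. fst z * snd z :: complex)"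
      by (simp, intro continuous_intros)
    ultimately have "continuous_map X euclidean ((\<lambda>z. fst z * snd z) \<circ> (\<lambda>x. (\<psi> x, inverse (\<phi> (p x)))))"
      by (metis continuous_map_compose prod_topology_euclidean)
    then show ?thesis by (simp add: o_def h_def[abs_def])
  qed
  have h_const: "h x = h e" if "x \<in> topspace X" for x
    by (rule connected_roots_of_unity_valued[OF conn h_cont _ h_root that e(1)]) (use j in simp)
  \<comment> \<open>The constant value of \<open>h\<close> is its value 1 at \<open>e\<close>, and
    \<open>\<phi> 0 = 1\<close>.\<close>
  have "\<psi> x = 1" if "x \<in> fiber 0" for x
    using h_const[of x] that \<phi>0 \<psi>(2) e by (simp add: h_def fiber_def)
  then have "(\<Sum>x\<in>fiber 0. \<psi> x) = of_nat j"
    by (simp add: j_def)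
  then show False using zero e(2) j by simp
qed

text \<open>Components of \<open>X\<close> are not known to be open, as the base need not be locally
  connected. A clopen set around \<open>x\<close> with the fewest points over 0 takes the place of
  the component and turns out to be connected.\<close>

lemma clopen_section:
  assumes base: "connected (UNIV :: 'g set)" and x: "x \<in> fiber 0"
    and div: "\<And>j. 0 < j \<Longrightarrow> j \<le> card (fiber 0) \<Longrightarrow> divisible_by j (character_group :: ('g \<Rightarrow> complex) monoid)"
  obtains C where "openin X C" "closedin X C" "x \<in> C" "\<And>y. card (fiber y \<inter> C) = 1"
proof -
  define P where "P C \<longleftrightarrow> openin X C \<and> closedin X C \<and> x \<in> C" for C
  have sub_fiber: "finite_cover.fiber (subtopology X C) p y = fiber y \<inter> C" if "openin X C" "closedin X C" for C y
  proof -
    interpret sub: finite_cover "subtopology X C" p by (rule clopen_subcover[OF that])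
    show ?thesis by (auto simp: sub.fiber_def fiber_def)
  qed
  have const: "card (fiber y \<inter> C) = card (fiber z \<inter> C)" if "openin X C" "closedin X C" for C y z
  proof -
    interpret sub: finite_cover "subtopology X C" p by (rule clopen_subcover[OF that])
    show ?thesis using sub.card_fiber_eq[OF base, of y z] by (simp add: sub_fiber that)
  qed
  have "P (topspace X)" using x by (auto simp: P_def fiber_def)
  then obtain C where C: "P C" "\<And>D. P D \<Longrightarrow> card (fiber 0 \<inter> C) \<le> card (fiber 0 \<inter> D)"
    using ex_has_least_nat[of P "topspace X" "\<lambda>C. card (fiber 0 \<inter> C)"] by blast
  have C': "openin X C" "closedin X C" "x \<in> C" using C(1) by (auto simp: P_def)
  \<comment> \<open>By minimality \<open>D\<close> has all the points of \<open>C\<close> over 0.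
    The clopen difference then has none over 0, hence none over any point of the connected
    base.\<close>
  have minimal: "D = C" if D: "P D" "D \<subseteq> C" for D
  proof -
    have "fiber 0 \<inter> D = fiber 0 \<inter> C"
      using D C(2)[OF D(1)] finite_fiber by (intro card_seteq) auto
    then have "fiber 0 \<inter> (C - D) = {}" by blast
    moreover have "openin X (C - D)" "closedin X (C - D)"
      using C' D(1) by (auto simp: P_def)
    ultimately have "card (fiber y \<inter> (C - D)) = 0" for y
      using const[of "C - D" y 0] by simp
    then have "fiber y \<inter> (C - D) = {}" for y
      using finite_fiber by (simp add: card_eq_0_iff)
    then have "C - D = {}"
      using openin_subset[OF C'(1)] by (fastforce simp: fiber_def)
    then show ?thesis using D(2) by blast
  qed
  have conn: "connected_space (subtopology X C)"
    unfolding connected_space_clopen_in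
  proof (intro allI impI)
    fix D assume D: "openin (subtopology X C) D \<and> closedin (subtopology X C) D"
    then have D': "openin X D" "closedin X D" "D \<subseteq> C"
      using C' openin_trans_full closedin_trans_full openin_subset by (blast, blast, fastforce)
    \<comment> \<open>Whichever of \<open>D\<close> and \<open>C - D\<close> contains
      \<open>x\<close> is all of \<open>C\<close>.\<close>
    have "D = C \<or> C - D = C"
      using minimal[of D] minimal[of "C - D"] D' C' by (cases "x \<in> D") (auto simp: P_def)
    then show "D = {} \<or> D = topspace (subtopology X C)"
      using D'(3) openin_subset[OF C'(1)] by auto
  qed
  interpret sub: compact_group_cover "subtopology X C" p
    using clopen_subcover[OF C'(1,2)] compact_base
    by (simp add: compact_group_cover_def compact_group_cover_axioms_def)
  have fib: "sub.fiber y = fiber y \<inter> C" for y by (simp add: sub_fiber C')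
  have "card (fiber 0 \<inter> C) \<le> card (fiber 0)"
    using finite_fiber by (intro card_mono) auto
  then have "card (fiber 0 \<inter> C) \<le> 1"
    using sub.connected_cover_one_sheet[OF conn base] div unfolding fib by blast
  moreover have "fiber 0 \<inter> C \<noteq> {}" using x C'(3) by blast
  ultimately have "card (fiber 0 \<inter> C) = 1"
    using finite_fiber by (metis One_nat_def card_0_eq finite_Int le_Suc_eq le_zero_eq)
  then have "card (fiber y \<inter> C) = 1" for y
    using const[OF C'(1,2), of y 0] by simp
  then show thesis using C' that by blast
qed

end

section \<open>From clopen sections to a trivialisation\<close>

lemma sheeted_covering_map_imp_finite_cover:
  assumes "sheeted_covering_map k X euclidean p"
  shows "finite_cover X p" "card (finite_cover.fiber X p y) = k"
proof -
  have cont: "continuous_map X euclidean p"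
    using assms by (simp add: sheeted_covering_map_def)
  have ex: "\<exists>W S. y \<in> W \<and> local_sections X p W S \<and> card S = k" for y
  proof -
    have y: "y \<in> topspace euclidean" by simp
    from bspec[OF assms[unfolded sheeted_covering_map_def, THEN conjunct2, THEN conjunct2] this]
    obtain W V where W': "openin euclidean W" "y \<in> W" and V: "disjoint_family_on V {1..k}"
      "{x \<in> topspace X. p x \<in> W} = (\<Union>i\<in>{1..k}. V i)"
      and V': "\<forall>i\<in>{1..k}. openin X (V i) \<and> homeomorphic_map (subtopology X (V i)) (top_of_set W) p"
      by blast
    have W: "open W" "y \<in> W" using W' open_openin by blast+
    have V_open: "openin X (V i)" and V_homeo: "homeomorphic_map (subtopology X (V i)) (top_of_set W) p"
      if "i \<in> {1..k}" for i using V' that by blast+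
    have "\<exists>\<sigma>. continuous_map (top_of_set W) X \<sigma> \<and> \<sigma> ` W = V i \<and> (\<forall>z\<in>W. p (\<sigma> z) = z) \<and> (\<forall>x\<in>V i. \<sigma> (p x) = x)"
      if i: "i \<in> {1..k}" for i
    proof -
      have sub: "V i \<subseteq> topspace X" using V_open[OF i] by (rule openin_subset)
      obtain \<sigma> where "homeomorphic_maps (subtopology X (V i)) (top_of_set W) p \<sigma>"
        using V_homeo[OF i] by (auto simp: homeomorphic_map_maps)
      then have \<sigma>: "continuous_map (subtopology X (V i)) (top_of_set W) p"
        "continuous_map (top_of_set W) (subtopology X (V i)) \<sigma>"
        "\<forall>x\<in>V i. \<sigma> (p x) = x" "\<forall>z\<in>W. p (\<sigma> z) = z"
        using sub by (auto simp: homeomorphic_maps_def)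
      have "p ` V i \<subseteq> W" using \<sigma>(1) sub by (auto simp: continuous_map_in_subtopology)
      then have "\<sigma> ` W = V i"
        using \<sigma>(2,3) by (force simp: continuous_map_in_subtopology image_iff)
      then show ?thesis using \<sigma> by (auto simp: continuous_map_in_subtopology)
    qed
    then obtain \<sigma> where \<sigma>: "\<And>i. i \<in> {1..k} \<Longrightarrow> continuous_map (top_of_set W) X (\<sigma> i)"
      "\<And>i. i \<in> {1..k} \<Longrightarrow> \<sigma> i ` W = V i" "\<And>i z. i \<in> {1..k} \<Longrightarrow> z \<in> W \<Longrightarrow> p (\<sigma> i z) = z"
      "\<And>i x. i \<in> {1..k} \<Longrightarrow> x \<in> V i \<Longrightarrow> \<sigma> i (p x) = x"
      by metis
    have inj: "i = j" if ij: "i \<in> {1..k}" "j \<in> {1..k}" "z \<in> W" "\<sigma> i z = \<sigma> j z" for i j z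
    proof (rule ccontr)
      assume "i \<noteq> j"
      then have "V i \<inter> V j = {}" using V(1) ij by (simp add: disjoint_family_on_def)
      then show False using \<sigma>(2) ij by (metis disjoint_iff image_eqI)
    qed
    have "inj_on \<sigma> {1..k}" using inj W(2) by (auto intro: inj_onI)
    then have "card (\<sigma> ` {1..k}) = k" by (simp add: card_image)
    moreover have "local_sections X p W (\<sigma> ` {1..k})"
      unfolding local_sections_def
    proof (intro conjI)
      show "\<forall>x\<in>topspace X. p x \<in> W \<longrightarrow> (\<exists>\<rho>\<in>\<sigma> ` {1..k}. \<rho> (p x) = x)"
        using V(2) \<sigma>(4) by blast
      show "\<forall>\<rho>\<in>\<sigma> ` {1..k}. \<forall>\<tau>\<in>\<sigma> ` {1..k}. \<forall>z\<in>W. \<rho> z = \<tau> z \<longrightarrow> \<rho> = \<tau>"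
        using inj by blast
    qed (use W \<sigma> V_open in auto)
    ultimately show ?thesis using W(2) by blast
  qed
  show fc: "finite_cover X p"
    using cont ex by unfold_locales blast+
  show "card (finite_cover.fiber X p y) = k"
    using ex[of y] finite_cover.card_fiber[OF fc] by metis
qed

text \<open>Each of the \<open>k\<close> points over 0 lies in a clopen set that meets every fibre
  once, and these sets partition \<open>X\<close>. The map from the product is then a continuous
  bijection of a compact space onto a Hausdorff space, so continuity of the inverse is
  automatic.\<close>

theorem divisible_imp_trivial_covering:
  fixes p :: "'x \<Rightarrow> 'g::{topological_ab_group_add, t2_space}"
  assumes compact: "compact (UNIV :: 'g set)" and base: "connected (UNIV :: 'g set)"
    and div: "divisible_by (fact k) (character_group :: ('g \<Rightarrow> complex) monoid)"
    and haus: "Hausdorff_space X" and cover: "sheeted_covering_map k X euclidean p"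
  shows "trivial_covering_map k X euclidean p"
proof -
  interpret compact_group_cover X p
    using sheeted_covering_map_imp_finite_cover(1)[OF cover] compact
    by (simp add: compact_group_cover_def compact_group_cover_axioms_def)
  have card_k: "card (fiber y) = k" for y
    by (rule sheeted_covering_map_imp_finite_cover(2)[OF cover])
  obtain q where q: "bij_betw q {1..k} (fiber 0)"
    using finite_same_card_bij[OF _ finite_fiber, of "{1..k}" 0] card_k by auto
  define Q where "Q x C \<longleftrightarrow> openin X C \<and> closedin X C \<and> x \<in> C \<and> (\<forall>y. card (fiber y \<inter> C) = 1)" for x C
  have div': "divisible_by j (character_group :: ('g \<Rightarrow> complex) monoid)" if "0 < j" "j \<le> card (fiber 0)" for j
    using that card_k by (intro divisible_by_dvd[OF div] dvd_fact) auto
  have Q_ex: "\<exists>C. Q x C" if "x \<in> fiber 0" for x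
    using clopen_section[OF base that div'] unfolding Q_def by metis
  have Q: "Q x (SOME C. Q x C)" if "x \<in> fiber 0" for x
    by (rule someI_ex[OF Q_ex[OF that]])
  define C where "C i = (SOME C. Q (q i) C)" for i
  have q_fiber: "q i \<in> fiber 0" if "i \<in> {1..k}" for i
    using q that by (auto simp: bij_betw_def)
  have C: "openin X (C i)" "closedin X (C i)" "q i \<in> C i" "card (fiber y \<inter> C i) = 1" if "i \<in> {1..k}" for i y
    using Q[OF q_fiber[OF that]] unfolding C_def Q_def by blast+
  \<comment> \<open>A clopen set has equally many points over all base points. This yields both the
    disjointness of the sheets and the fact that they exhaust \<open>X\<close>.\<close>
  have fiber_clopen_empty: "D = {}" if D: "openin X D" "closedin X D" "fiber 0 \<inter> D = {}" for D
  proof -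
    interpret sub: finite_cover "subtopology X D" p by (rule clopen_subcover[OF D(1,2)])
    have fib: "sub.fiber y = fiber y \<inter> D" for y by (auto simp: sub.fiber_def fiber_def)
    have "card (fiber y \<inter> D) = 0" for y
      using sub.card_fiber_eq[OF base, of y 0] D(3) by (simp add: fib)
    then have "fiber y \<inter> D = {}" for y using finite_fiber by (simp add: card_eq_0_iff)
    then show ?thesis using openin_subset[OF D(1)] by (fastforce simp: fiber_def)
  qed
  have fib0: "fiber 0 \<inter> C i = {q i}" if i: "i \<in> {1..k}" for i
  proof -
    have "q i \<in> fiber 0 \<inter> C i" using C(3) q_fiber i by blast
    moreover obtain z where "fiber 0 \<inter> C i = {z}"
      using C(4)[OF i, of 0] by (rule card_1_singletonE)
    ultimately show ?thesis by simp
  qed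
  have disj: "C i \<inter> C j = {}" if "i \<in> {1..k}" "j \<in> {1..k}" "i \<noteq> j" for i j
  proof (rule fiber_clopen_empty)
    have ne: "q i \<noteq> q j" using inj_onD[OF bij_betw_imp_inj_on[OF q] _ that(1,2)] that(3) by blast
    have "fiber 0 \<inter> (C i \<inter> C j) = (fiber 0 \<inter> C i) \<inter> (fiber 0 \<inter> C j)" by auto
    also have "\<dots> = {}" unfolding fib0[OF that(1)] fib0[OF that(2)] using ne by simp
    finally show "fiber 0 \<inter> (C i \<inter> C j) = {}" .
  qed (use C that in auto)
  have "topspace X - (\<Union>i\<in>{1..k}. C i) = {}"
  proof (rule fiber_clopen_empty)
    have "closedin X (\<Union>i\<in>{1..k}. C i)" using C(2) by (intro closedin_Union) auto
    then show "openin X (topspace X - (\<Union>i\<in>{1..k}. C i))" by blast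
    have "openin X (\<Union>i\<in>{1..k}. C i)" using C(1) by blast
    then show "closedin X (topspace X - (\<Union>i\<in>{1..k}. C i))" by blast
    have "fiber 0 \<subseteq> (\<Union>i\<in>{1..k}. C i)"
      unfolding bij_betw_imp_surj_on[OF q, symmetric] using C(3) by blast
    then show "fiber 0 \<inter> (topspace X - (\<Union>i\<in>{1..k}. C i)) = {}" by blast
  qed
  then have cov: "topspace X \<subseteq> (\<Union>i\<in>{1..k}. C i)" by blast
  define \<rho> where "\<rho> = (\<lambda>(y, i). THE x. x \<in> fiber y \<inter> C i)"
  have \<rho>: "fiber y \<inter> C i = {\<rho> (y, i)}" if i: "i \<in> {1..k}" for y i
  proof -
    obtain x where "fiber y \<inter> C i = {x}" using C(4)[OF i, of y] by (rule card_1_singletonE)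
    then show ?thesis by (simp add: \<rho>_def del: Int_iff)
  qed
  have \<rho>D: "\<rho> (y, i) \<in> topspace X" "p (\<rho> (y, i)) = y" "\<rho> (y, i) \<in> C i" if "i \<in> {1..k}" for y i
    using \<rho>[OF that, of y] by (auto simp: fiber_def)
  let ?P = "prod_topology (euclidean :: 'g topology) (discrete_topology {1..k})"
  have "continuous_map ?P X \<rho>"
    unfolding continuous_map_def
  proof (intro conjI allI impI)
    show "\<rho> \<in> topspace ?P \<rightarrow> topspace X" using \<rho>D by auto
    fix V assume V: "openin X V"
    show "openin ?P {x \<in> topspace ?P. \<rho> x \<in> V}"
      unfolding openin_prod_topology_alt
    proof (intro allI impI)
      fix y i assume "(y, i) \<in> {x \<in> topspace ?P. \<rho> x \<in> V}"
      then have i: "i \<in> {1..k}" and yi: "\<rho> (y, i) \<in> V" by auto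
      obtain W S where W: "y \<in> W" "local_sections X p W S" using loc by blast
      note D = local_sectionsD[OF W(2)]
      obtain \<sigma> where \<sigma>: "\<sigma> \<in> S" "\<sigma> y = \<rho> (y, i)"
        using D(7)[OF \<rho>D(1)[OF i, of y]] \<rho>D(2)[OF i, of y] W(1) by auto
      define U where "U = {z \<in> W. \<sigma> z \<in> V \<inter> C i}"
      have "open U"
        unfolding U_def using V C(1)[OF i] by (intro open_section_preimage[OF W(2) \<sigma>(1)]) auto
      moreover have "y \<in> U" using W(1) \<sigma>(2) yi \<rho>D(3)[OF i] by (simp add: U_def)
      moreover have "\<rho> (z, i) \<in> V" if "z \<in> U" for z
      proof -
        have "\<sigma> z \<in> fiber z \<inter> C i"
          using that D(4,5)[OF \<sigma>(1)] by (auto simp: U_def fiber_def)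
        then have "\<sigma> z = \<rho> (z, i)" using \<rho>[OF i] by blast
        then show ?thesis using that by (auto simp: U_def)
      qed
      ultimately show "\<exists>U V'. openin euclidean U \<and> openin (discrete_topology {1..k}) V' \<and> y \<in> U \<and> i \<in> V' \<and>
          U \<times> V' \<subseteq> {x \<in> topspace ?P. \<rho> x \<in> V}"
        using i by (intro exI[of _ U] exI[of _ "{i}"]) auto
    qed
  qed
  moreover have "\<rho> ` topspace ?P = topspace X"
  proof (intro equalityI subsetI)
    fix x assume x: "x \<in> topspace X"
    then obtain i where i: "i \<in> {1..k}" "x \<in> C i" using cov by blast
    then have "x = \<rho> (p x, i)" using \<rho>[OF i(1), of "p x"] x by (auto simp: fiber_def)
    then show "x \<in> \<rho> ` topspace ?P" using i(1) by (metis UNIV_I image_eqI mem_Sigma_iff topspace_discrete_topology topspace_euclidean topspace_prod_topology)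
  qed (use \<rho>D in auto)
  moreover have "inj_on \<rho> (topspace ?P)"
  proof (rule inj_onI)
    fix a b assume "a \<in> topspace ?P" "b \<in> topspace ?P" "\<rho> a = \<rho> b"
    then obtain y i z j where ab: "a = (y, i)" "b = (z, j)" "i \<in> {1..k}" "j \<in> {1..k}" "\<rho> (y, i) = \<rho> (z, j)"
      by auto
    have "y = z" using \<rho>D(2) ab(3-5) by metis
    moreover have "i = j" using disj[OF ab(3,4)] \<rho>D(3) ab(3-5) by (metis disjoint_iff)
    ultimately show "a = b" by (simp add: ab)
  qed
  moreover have "compact_space ?P"
    using compact by (simp add: compact_space_prod_topology compact_space_discrete_topology compact_space_def[of euclidean])
  ultimately have "homeomorphic_map ?P X \<rho>"
    using haus by (intro continuous_imp_homeomorphic_map) auto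
  then show ?thesis
    unfolding trivial_covering_map_def using \<rho>D(2) by blast
qed

section \<open>Triviality implies divisibility\<close>

text \<open>Openness of the sheets comes from the Hausdorff property: the image of a section is the
  set where \<open>s i \<circ> p\<close> agrees with the identity, so it is closed over
  \<open>W\<close>, and it is the complement there of the finitely many other images.\<close>

lemma sheeted_covering_map_of_sections:
  assumes haus: "Hausdorff_space X" and cont: "continuous_map X euclidean p" and k: "k \<ge> 1"
    and ex: "\<And>y. \<exists>W s. open W \<and> y \<in> W \<and>
      (\<forall>i\<in>{1..k}. continuous_map (top_of_set W) X (s i) \<and> (\<forall>z\<in>W. p (s i z) = z)) \<and>
      (\<forall>x\<in>topspace X. p x \<in> W \<longrightarrow> (\<exists>i\<in>{1..k}. s i (p x) = x)) \<and>
      (\<forall>i\<in>{1..k}. \<forall>j\<in>{1..k}. \<forall>z\<in>W. s i z = s j z \<longrightarrow> i = j)"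
  shows "sheeted_covering_map k X euclidean p"
  unfolding sheeted_covering_map_def
proof (intro conjI ballI)
  show "continuous_map X euclidean p" by (rule cont)
  have "y \<in> p ` topspace X" for y
  proof -
    obtain W s where "open W" "y \<in> W" and s: "\<forall>i\<in>{1..k}. continuous_map (top_of_set W) X (s i) \<and> (\<forall>z\<in>W. p (s i z) = z)"
      using ex[of y] by blast
    then have "s 1 y \<in> topspace X" "p (s 1 y) = y" using k by (auto simp: continuous_map_def)
    then show ?thesis by (metis image_eqI)
  qed
  then show "p ` topspace X = topspace euclidean" by auto
  fix y
  obtain W s where W: "open W" "y \<in> W"
    and s: "\<forall>i\<in>{1..k}. continuous_map (top_of_set W) X (s i) \<and> (\<forall>z\<in>W. p (s i z) = z)"
    and cov: "\<forall>x\<in>topspace X. p x \<in> W \<longrightarrow> (\<exists>i\<in>{1..k}. s i (p x) = x)"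
    and inj: "\<forall>i\<in>{1..k}. \<forall>j\<in>{1..k}. \<forall>z\<in>W. s i z = s j z \<longrightarrow> i = j"
    using ex[of y] by blast
  have s_cont: "continuous_map (top_of_set W) X (s i)" if "i \<in> {1..k}" for i
    using s that by blast
  have s_top: "s i z \<in> topspace X" if "i \<in> {1..k}" "z \<in> W" for i z
    using s_cont[OF that(1)] that(2) by (auto simp: continuous_map_def)
  have s_p: "p (s i z) = z" if "i \<in> {1..k}" "z \<in> W" for i z
    using s that by blast
  define P where "P = {x \<in> topspace X. p x \<in> W}"
  have P: "openin X P" using cont W(1) by (simp add: P_def continuous_map_def)
  have PV: "P = (\<Union>i\<in>{1..k}. s i ` W)"
  proof (intro equalityI subsetI)
    fix x assume "x \<in> P"
    then have x: "x \<in> topspace X" "p x \<in> W" by (auto simp: P_def)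
    then obtain i where "i \<in> {1..k}" "s i (p x) = x" using cov by blast
    then show "x \<in> (\<Union>i\<in>{1..k}. s i ` W)" using x(2) by (metis UN_iff image_eqI)
  next
    fix x assume "x \<in> (\<Union>i\<in>{1..k}. s i ` W)"
    then obtain i z where "i \<in> {1..k}" "z \<in> W" "x = s i z" by blast
    then show "x \<in> P" using s_top s_p by (simp add: P_def)
  qed
  have closed: "closedin (subtopology X P) (s i ` W)" if i: "i \<in> {1..k}" for i
  proof -
    have "continuous_map (subtopology X P) (top_of_set W) p"
      using cont by (auto simp: continuous_map_in_subtopology continuous_map_from_subtopology P_def)
    then have "continuous_map (subtopology X P) X (s i \<circ> p)"
      by (rule continuous_map_compose) (rule s_cont[OF i])
    moreover have "continuous_map (subtopology X P) X id"
      by (rule continuous_map_from_subtopology) simp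
    ultimately have "closedin (subtopology X P) {x \<in> topspace (subtopology X P). (s i \<circ> p) x = id x}"
      by (rule closedin_continuous_maps_eq[OF haus])
    moreover have "{x \<in> topspace (subtopology X P). (s i \<circ> p) x = id x} = s i ` W"
    proof (intro equalityI subsetI)
      fix x assume "x \<in> {x \<in> topspace (subtopology X P). (s i \<circ> p) x = id x}"
      then have "p x \<in> W" "x = s i (p x)" by (auto simp: P_def)
      then show "x \<in> s i ` W" by (metis image_eqI)
    next
      fix x assume "x \<in> s i ` W"
      then show "x \<in> {x \<in> topspace (subtopology X P). (s i \<circ> p) x = id x}"
        using s_top[OF i] s_p[OF i] by (auto simp: P_def)
    qed
    ultimately show ?thesis by simp
  qed
  have disj: "s i ` W \<inter> s j ` W = {}" if "i \<in> {1..k}" "j \<in> {1..k}" "i \<noteq> j" for i j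
  proof (rule ccontr)
    assume "s i ` W \<inter> s j ` W \<noteq> {}"
    then obtain z w where zw: "z \<in> W" "w \<in> W" "s i z = s j w" by blast
    then have "z = w" using s_p that by metis
    then show False using inj zw that by blast
  qed
  have open_V: "openin X (s i ` W)" if i: "i \<in> {1..k}" for i
  proof -
    have "closedin (subtopology X P) (\<Union>j\<in>{1..k} - {i}. s j ` W)"
      using closed by (intro closedin_Union) auto
    then have "openin (subtopology X P) (topspace (subtopology X P) - (\<Union>j\<in>{1..k} - {i}. s j ` W))"
      by blast
    moreover have "topspace (subtopology X P) = P" using openin_subset[OF P] by auto
    moreover have "P - (\<Union>j\<in>{1..k} - {i}. s j ` W) = s i ` W"
      unfolding PV using i disj by blast
    ultimately show ?thesis using P openin_trans_full by metis
  qed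
  show "\<exists>W. openin euclidean W \<and> y \<in> W \<and>
        (\<exists>V :: nat \<Rightarrow> 'a set.
           disjoint_family_on V {1..k} \<and>
           {x \<in> topspace X. p x \<in> W} = (\<Union>i\<in>{1..k}. V i) \<and>
           (\<forall>i\<in>{1..k}. openin X (V i) \<and>
              homeomorphic_map (subtopology X (V i)) (subtopology euclidean W) p))"
  proof (intro exI[of _ W] exI[of _ "\<lambda>i. s i ` W"] conjI ballI)
    show "disjoint_family_on (\<lambda>i. s i ` W) {1..k}"
      using disj by (auto simp: disjoint_family_on_def)
    show "{x \<in> topspace X. p x \<in> W} = (\<Union>i\<in>{1..k}. s i ` W)"
      using PV by (simp add: P_def)
    fix i assume i: "i \<in> {1..k}"
    have "homeomorphic_maps (subtopology X (s i ` W)) (top_of_set W) p (s i)"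
      unfolding homeomorphic_maps_def
    proof (intro conjI ballI)
      show "continuous_map (subtopology X (s i ` W)) (top_of_set W) p"
        using cont s_p[OF i] by (auto simp: continuous_map_in_subtopology continuous_map_from_subtopology)
      show "continuous_map (top_of_set W) (subtopology X (s i ` W)) (s i)"
        using s_cont[OF i] by (auto simp: continuous_map_in_subtopology)
    qed (use s_p[OF i] in auto)
    then show "homeomorphic_map (subtopology X (s i ` W)) (subtopology euclidean W) p"
      by (auto simp: homeomorphic_map_maps)
  qed (use W open_V open_openin in auto)
qed

text \<open>The \<open>j\<close>-th roots of \<open>\<theta>\<close> form a \<open>j\<close>-fold covering inside \<open>'g \<times> complex\<close>; the numbers
  \<open>j + 1, \<dots>, k\<close>, which lie off the unit circle, provide \<open>k - j\<close> additional trivial sheets.\<close>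

lemma character_root_of_trivial_covers:
  fixes \<theta> :: "'g::{topological_ab_group_add, t2_space} \<Rightarrow> complex"
  assumes base: "connected (UNIV :: 'g set)" and j: "1 \<le> j" "j \<le> k"
    and triv: "\<And>(X :: ('g \<times> nat) topology) (p :: 'g \<times> nat \<Rightarrow> 'g).
      Hausdorff_space X \<Longrightarrow> sheeted_covering_map k X euclidean p \<Longrightarrow> trivial_covering_map k X euclidean p"
    and \<theta>: "\<theta> \<in> carrier character_group"
  shows "\<exists>\<phi>\<in>carrier (character_group :: ('g \<Rightarrow> complex) monoid). \<forall>x. \<phi> x ^ j = \<theta> x"
proof -
  have \<theta>': "continuous_on UNIV \<theta>" "\<And>y. cmod (\<theta> y) = 1" "\<And>y z. \<theta> (y + z) = \<theta> y * \<theta> z"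
    using \<theta> by (auto simp: character_group_def)
  have \<theta>_nz: "\<theta> y \<noteq> 0" for y using \<theta>'(2)[of y] by auto
  have \<theta>0: "\<theta> 0 = 1" using \<theta>'(3)[of 0 0] \<theta>_nz[of 0] by simp
  have root: "exp (Ln c / of_nat j) ^ j = c" if "c \<noteq> 0" for c
    using that j(1) by (simp flip: exp_of_nat_mult)
  have unit_root: "cmod c = 1" if "c ^ j = \<theta> z" for c z
  proof -
    have "cmod c ^ j = 1 ^ j" using that \<theta>'(2)[of z] by (metis norm_power power_one)
    then show ?thesis using j(1) power_eq_imp_eq_base[of "cmod c" j 1] by simp
  qed
  \<comment> \<open>A choice of roots, in general discontinuous; it serves to label the points of
    the covering by numbers.\<close>
  define r where "r z = exp (Ln (\<theta> z) / of_nat j)" for z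
  have r: "r z ^ j = \<theta> z" for z using root \<theta>_nz by (simp add: r_def)
  have "card {1..j} = card {c :: complex. c ^ j = 1}"
    using card_roots_unity_eq j(1) by simp
  then obtain \<omega> where \<omega>: "bij_betw \<omega> {1..j} {c :: complex. c ^ j = 1}"
    using finite_same_card_bij[of "{1..j}" "{c :: complex. c ^ j = 1}"] finite_roots_unity[of j] j(1) by auto
  have \<omega>_root: "\<omega> i ^ j = 1" if "i \<in> {1..j}" for i using \<omega> that by (auto simp: bij_betw_def)
  define val where "val c i = (if i \<le> j then c * \<omega> i else of_nat i)" for c i
  have val_root: "val c i ^ j = \<theta> z" if "c ^ j = \<theta> z" "i \<in> {1..k}" "i \<le> j" for c z i
    using that \<omega>_root[of i] by (simp add: val_def power_mult_distrib)
  have norm_val: "cmod (val c i) = (if i \<le> j then 1 else real i)" if "c ^ j = \<theta> z" "i \<in> {1..k}" for c z i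
    using unit_root[OF val_root[OF that]] by (simp add: val_def)
  have val_inj: "i = i'" if "c ^ j = \<theta> z" "i \<in> {1..k}" "i' \<in> {1..k}" "val c i = val c i'" for c z i i'
  proof (cases "i \<le> j \<and> i' \<le> j")
    case True
    have "c \<noteq> 0" using unit_root[OF that(1)] by auto
    then have "\<omega> i = \<omega> i'" using that(4) True by (simp add: val_def)
    then show ?thesis
      using True that(2,3) by (intro inj_onD[OF bij_betw_imp_inj_on[OF \<omega>]]) auto
  next
    case False
    have "(if i \<le> j then 1 else real i) = (if i' \<le> j then 1 else real i')"
      using norm_val[OF that(1,2)] norm_val[OF that(1,3)] that(4) by simp
    then show ?thesis using False j(1) by (simp split: if_split_asm)
  qed
  have val_surj: "\<exists>m\<in>{1..k}. val c' m = val c i" if c: "c ^ j = \<theta> z" "c' ^ j = \<theta> z" and i: "i \<in> {1..k}" for c c' z i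
  proof (cases "i \<le> j")
    case True
    have c': "c' \<noteq> 0" using unit_root[OF c(2)] by auto
    have "(val c i / c') ^ j = 1"
      using val_root[OF c(1) i True] c(2) \<theta>_nz[of z] by (simp add: power_divide)
    then have "val c i / c' \<in> \<omega> ` {1..j}" using bij_betw_imp_surj_on[OF \<omega>] by simp
    then obtain m where "m \<in> {1..j}" "\<omega> m = val c i / c'" by (metis imageE)
    then show ?thesis using c' j(2) by (intro bexI[of _ m]) (auto simp: val_def)
  qed (use i in \<open>auto simp: val_def\<close>)
  \<comment> \<open>The hypothesis speaks of topologies on \<open>'g \<times> nat\<close>. The
    covering inside \<open>'g \<times> complex\<close> is therefore transported there, by pulling
    the topology back along the injection \<open>enc\<close>.\<close>
  define enc where "enc = (\<lambda>(z, i). (z, val (r z) i))"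
  define A where "A = (UNIV :: 'g set) \<times> {1..k}"
  define X where "X = pullback_topology A enc (euclidean :: ('g \<times> complex) topology)"
  have top: "topspace X = A" by (simp add: X_def topspace_pullback_topology)
  have enc_inj: "inj_on enc A"
    using val_inj[OF r] by (auto simp: inj_on_def A_def enc_def)
  have enc_cont: "continuous_map X euclidean (f \<circ> enc)" if "continuous_on UNIV f" for f :: "'g \<times> complex \<Rightarrow> 'b::topological_space"
    unfolding X_def by (rule continuous_map_pullback) (use that in simp)
  have haus: "Hausdorff_space X"
  proof (rule Hausdorff_space_injective_preimage)
    show "continuous_map X euclidean enc" using enc_cont[of id] by (simp add: continuous_on_id)
  qed (use enc_inj top Hausdorff_space_euclidean_t2 in auto)
  have fst_cont: "continuous_map X euclidean fst"
  proof -
    have "fst \<circ> enc = fst" by (auto simp: enc_def)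
    then show ?thesis using enc_cont[of fst] continuous_on_fst[OF continuous_on_id] by metis
  qed
  have "sheeted_covering_map k X euclidean fst"
  proof (rule sheeted_covering_map_of_sections[OF haus fst_cont])
    show "k \<ge> 1" using j by simp
    fix y :: 'g
    \<comment> \<open>Over \<open>W\<close> the quotient stays in the right half plane, where
      \<open>Ln\<close> is continuous, so \<open>c\<close> is a continuous root of \<theta>
      there.\<close>
    define W where "W = {z. Re (\<theta> z / \<theta> y) > 0}"
    define c where "c z = r y * exp (Ln (\<theta> z / \<theta> y) / of_nat j)" for z
    have "open W"
      unfolding W_def using \<theta>'(1) \<theta>_nz by (intro open_Collect_less continuous_intros) auto
    have "y \<in> W" using \<theta>_nz[of y] by (simp add: W_def)
    have c_root: "c z ^ j = \<theta> z" for z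
      using \<theta>_nz root[of "\<theta> z / \<theta> y"] by (simp add: c_def power_mult_distrib r)
    have c_cont: "continuous_on W c"
    proof -
      have "continuous_on W (\<lambda>z. Ln (\<theta> z / \<theta> y))"
      proof (rule continuous_on_Ln')
        show "continuous_on W (\<lambda>z. \<theta> z / \<theta> y)"
          using continuous_on_subset[OF \<theta>'(1)] \<theta>_nz by (intro continuous_intros) auto
        show "\<theta> z / \<theta> y \<notin> \<real>\<^sub>\<le>\<^sub>0" if "z \<in> W" for z
          using that by (auto simp: W_def complex_nonpos_Reals_iff)
      qed
      then show ?thesis
        unfolding c_def using j(1)
        by (intro continuous_on_mult continuous_on_const continuous_on_exp continuous_on_divide) auto
    qed
    define s where "s i z = (SOME x. x \<in> A \<and> enc x = (z, val (c z) i))" for i z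
    have s: "s i z \<in> A" "enc (s i z) = (z, val (c z) i)" if i: "i \<in> {1..k}" for i z
    proof -
      obtain m where "m \<in> {1..k}" "val (r z) m = val (c z) i" using val_surj[OF c_root r i] by blast
      then have "\<exists>x. x \<in> A \<and> enc x = (z, val (c z) i)"
        by (intro exI[of _ "(z, m)"]) (simp add: A_def enc_def)
      from someI_ex[OF this] show "s i z \<in> A" "enc (s i z) = (z, val (c z) i)" by (auto simp: s_def)
    qed
    have s_fst: "fst (s i z) = z" if "i \<in> {1..k}" for i z
      using s(2)[OF that, of z] by (auto simp: enc_def case_prod_unfold)
    have s_cont: "continuous_map (top_of_set W) X (s i)" if i: "i \<in> {1..k}" for i
      unfolding X_def
    proof (rule continuous_map_pullback')
      have "continuous_on W (\<lambda>z. (z, val (c z) i))"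
        using c_cont by (cases "i \<le> j") (auto simp: val_def intro!: continuous_intros)
      then show "continuous_map (top_of_set W) euclidean (enc \<circ> s i)"
        using s(2)[OF i] by (simp add: o_def)
      show "topspace (top_of_set W) \<subseteq> s i -` A" using s(1)[OF i] by auto
    qed
    have s_cover: "\<exists>i\<in>{1..k}. s i (fst x) = x" if x: "x \<in> topspace X" for x
    proof -
      obtain z m where zm: "x = (z, m)" "m \<in> {1..k}" using x by (auto simp: top A_def)
      obtain i where i: "i \<in> {1..k}" "val (c z) i = val (r z) m" using val_surj[OF r c_root zm(2)] by blast
      then have "enc (s i z) = enc x" using s(2)[OF i(1), of z] by (simp add: zm enc_def)
      then have "s i z = x" using enc_inj s(1)[OF i(1)] x top by (auto dest: inj_onD)
      then show ?thesis using i(1) zm(1) by auto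
    qed
    have s_inj: "i = i'" if "i \<in> {1..k}" "i' \<in> {1..k}" "s i z = s i' z" for i i' z
    proof (rule val_inj[OF c_root that(1,2)])
      show "val (c z) i = val (c z) i'"
        using s(2)[OF that(1), of z] s(2)[OF that(2), of z] that(3) by simp
    qed
    show "\<exists>W s. open W \<and> y \<in> W \<and>
      (\<forall>i\<in>{1..k}. continuous_map (top_of_set W) X (s i) \<and> (\<forall>z\<in>W. fst (s i z) = z)) \<and>
      (\<forall>x\<in>topspace X. fst x \<in> W \<longrightarrow> (\<exists>i\<in>{1..k}. s i (fst x) = x)) \<and>
      (\<forall>i\<in>{1..k}. \<forall>j\<in>{1..k}. \<forall>z\<in>W. s i z = s j z \<longrightarrow> i = j)"
      by (intro exI[of _ W] exI[of _ s] conjI ballI impI \<open>open W\<close> \<open>y \<in> W\<close>)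
        (use s_cont s_fst s_cover s_inj in blast)+
  qed
  then have "trivial_covering_map k X euclidean fst" by (rule triv[OF haus])
  then obtain \<rho> where \<rho>: "homeomorphic_map (prod_topology euclidean (discrete_topology {1..k})) X \<rho>"
    "\<And>z n. n \<in> {1..k} \<Longrightarrow> fst (\<rho> (z, n)) = z"
    unfolding trivial_covering_map_def by auto
  have \<rho>_cont: "continuous_map (prod_topology euclidean (discrete_topology {1..k})) X \<rho>"
    and \<rho>_surj: "\<rho> ` (UNIV \<times> {1..k}) = A"
    using homeomorphic_imp_continuous_map[OF \<rho>(1)] homeomorphic_imp_surjective_map[OF \<rho>(1)] by (auto simp: top)
  \<comment> \<open>Label 1 is a genuine root, as \<open>1 \<le> j\<close>. The sheet of the
    trivialisation through this point stays among the roots: its modulus is continuous with integer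
    values, hence constantly 1, whereas the padding sheets have modulus at least 2.\<close>
  have "(0, 1) \<in> A" using j by (simp add: A_def)
  then have "(0, 1) \<in> \<rho> ` (UNIV \<times> {1..k})" unfolding \<rho>_surj .
  then obtain u where u: "u \<in> UNIV \<times> {1..k}" "\<rho> u = (0, 1)" by (metis imageE)
  obtain z n where zn: "u = (z, n)" by (cases u)
  have n: "n \<in> {1..k}" "\<rho> (z, n) = (0, 1)" using u zn by blast+
  have z0: "z = 0" using \<rho>(2)[OF n(1), of z] n(2) by simp
  define Z where "Z z = snd (enc (\<rho> (z, n)))" for z
  have "\<exists>m\<in>{1..k}. Z z = val (r z) m" for z
  proof -
    have "\<rho> (z, n) \<in> A" using \<rho>_surj n(1) by blast
    moreover have "fst (\<rho> (z, n)) = z" by (rule \<rho>(2)[OF n(1)])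
    ultimately obtain m where "m \<in> {1..k}" "\<rho> (z, n) = (z, m)" by (auto simp: A_def)
    then show ?thesis by (auto simp: Z_def enc_def)
  qed
  then obtain m where m: "\<And>z. m z \<in> {1..k}" "\<And>z. Z z = val (r z) (m z)" by metis
  have Z_cont: "continuous_on UNIV Z"
  proof -
    have "continuous_map euclidean (prod_topology euclidean (discrete_topology {1..k})) (\<lambda>z. (z, n))"
      using n(1) by (intro continuous_map_pairedI) auto
    then have "continuous_map euclidean X (\<rho> \<circ> (\<lambda>z. (z, n)))"
      using \<rho>_cont by (rule continuous_map_compose)
    then have "continuous_map euclidean euclidean ((snd \<circ> enc) \<circ> (\<rho> \<circ> (\<lambda>z. (z, n))))"
      by (rule continuous_map_compose) (rule enc_cont, intro continuous_intros)
    then show ?thesis by (simp add: o_def Z_def[abs_def])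
  qed
  have Z0: "cmod (Z 0) = 1"
    using n(2) j norm_val[OF r[of 0], of 1] by (simp add: Z_def enc_def z0)
  have "connected ((\<lambda>z. cmod (Z z)) ` UNIV)"
    by (intro connected_continuous_image continuous_intros Z_cont base)
  moreover have "cmod (Z z) \<in> real ` {1..k}" for z
  proof -
    have "cmod (Z z) = (if m z \<le> j then 1 else real (m z))" using m norm_val[OF r m(1)] by metis
    then show ?thesis using m(1)[of z] j by (auto split: if_splits intro!: image_eqI[of _ real 1])
  qed
  then have "(\<lambda>z. cmod (Z z)) ` UNIV \<subseteq> real ` {1..k}" by (rule image_subsetI)
  then have "finite ((\<lambda>z. cmod (Z z)) ` UNIV)" by (rule finite_subset) simp
  ultimately obtain a where a: "(\<lambda>z. cmod (Z z)) ` UNIV = {a}"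
    using connected_finite_iff_sing[of "(\<lambda>z. cmod (Z z)) ` UNIV"] by auto
  have norm_Z: "cmod (Z z) = 1" for z
  proof -
    have "cmod (Z z) \<in> {a}" "cmod (Z 0) \<in> {a}" unfolding a[symmetric] by blast+
    then show ?thesis using Z0 by simp
  qed
  have Z_root: "Z z ^ j = \<theta> z" for z
  proof -
    have "m z \<le> j" using norm_Z[of z] norm_val[OF r m(1), of z z] m(2)[of z] j(1) by (auto split: if_splits)
    then show ?thesis using val_root[OF r m(1)] m(2) by metis
  qed
  have Z_nz: "Z z \<noteq> 0" for z using norm_Z[of z] by auto
  \<comment> \<open>The factor \<open>Z 0\<close> builds in the normalisation, so that
    \<open>D\<close> takes the value 1 at the origin.\<close>
  define D where "D = (\<lambda>(x, y). Z (x + y) * Z 0 / (Z x * Z y))"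
  have D_const: "D u = D (0, 0)" for u
  proof (rule connected_roots_of_unity_valued[where h = D and X = euclidean and n = j])
    have "connected ((UNIV :: 'g set) \<times> (UNIV :: 'g set))"
      by (intro connected_Times base)
    then show "connected_space (euclidean :: ('g \<times> 'g) topology)"
      using connectedin_topspace[of "euclidean :: ('g \<times> 'g) topology"] by simp
    have "continuous_on UNIV D"
      unfolding D_def case_prod_unfold
      by (intro continuous_intros continuous_on_compose2[OF Z_cont]) (auto simp: Z_nz)
    then show "continuous_map euclidean euclidean D" by simp
    show "D u ^ j = 1" for u
      using \<theta>_nz by (cases u) (simp add: D_def power_mult_distrib power_divide Z_root \<theta>' \<theta>0)
    show "j > 0" using j by simp
  qed auto
  have Z_mult: "Z (x + y) * Z 0 = Z x * Z y" for x y
    using D_const[of "(x, y)"] Z_nz by (simp add: D_def field_simps)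
  show ?thesis
  proof (intro bexI[of _ "\<lambda>z. Z z / Z 0"] allI)
    show "(Z z / Z 0) ^ j = \<theta> z" for z by (simp add: power_divide Z_root \<theta>0)
    show "(\<lambda>z. Z z / Z 0) \<in> carrier character_group"
      using Z_cont Z_nz norm_Z Z_mult
      by (auto simp: character_group_def norm_divide field_simps intro!: continuous_intros)
  qed
qed

text \<open>Taking roots of the orders 1, ..., \<open>k\<close> in succession amounts to taking a
  root of order \<open>k!\<close>.\<close>

theorem trivial_covers_imp_divisible:
  assumes base: "connected (UNIV :: 'g::{topological_ab_group_add, t2_space} set)"
    and triv: "\<And>(X :: ('g \<times> nat) topology) (p :: 'g \<times> nat \<Rightarrow> 'g).
      Hausdorff_space X \<Longrightarrow> sheeted_covering_map k X euclidean p \<Longrightarrow> trivial_covering_map k X euclidean p"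
  shows "divisible_by (fact k) (character_group :: ('g \<Rightarrow> complex) monoid)"
proof -
  have div: "divisible_by j (character_group :: ('g \<Rightarrow> complex) monoid)" if "1 \<le> j" "j \<le> k" for j
    unfolding divisible_by_character_group_iff
    using character_root_of_trivial_covers[OF base that triv] by blast
  have "i \<le> k \<Longrightarrow> divisible_by (fact i) (character_group :: ('g \<Rightarrow> complex) monoid)" for i
  proof (induction i)
    case 0
    then show ?case by (auto simp: divisible_by_character_group_iff)
  next
    case (Suc i)
    then show ?case
      using divisible_by_mult[OF div[of "Suc i"]] by (simp add: fact_Suc del: mult_Suc)
  qed
  then show ?thesis by simp
qed

theorem theorem3:
  fixes k :: nat
  assumes "compact (UNIV :: 'g::{topological_ab_group_add, t2_space} set)"
    and "connected (UNIV :: 'g set)"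
    and "k \<ge> 1"
  shows "((\<forall>(X :: ('g \<times> nat) topology) (p :: 'g \<times> nat \<Rightarrow> 'g).
             Hausdorff_space X \<and> sheeted_covering_map k X euclidean p \<longrightarrow>
             trivial_covering_map k X euclidean p)
          \<longleftrightarrow> divisible_by (fact k) (character_group :: ('g \<Rightarrow> complex) monoid))
       \<and> (divisible_by (fact k) (character_group :: ('g \<Rightarrow> complex) monoid) \<longrightarrow>
          (\<forall>(X :: 'x topology) (p :: 'x \<Rightarrow> 'g).
             Hausdorff_space X \<and> sheeted_covering_map k X euclidean p \<longrightarrow>
             trivial_covering_map k X euclidean p))"
proof (intro conjI impI iffI allI)
  assume triv: "\<forall>(X :: ('g \<times> nat) topology) (p :: 'g \<times> nat \<Rightarrow> 'g).
    Hausdorff_space X \<and> sheeted_covering_map k X euclidean p \<longrightarrow> trivial_covering_map k X euclidean p"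
  show "divisible_by (fact k) (character_group :: ('g \<Rightarrow> complex) monoid)"
    using triv by (intro trivial_covers_imp_divisible[OF assms(2)]) blast
qed (use divisible_imp_trivial_covering[OF assms(1,2)] in blast)+

end
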